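(* Let $(\mathfrak g,A)$ be a compatible pair over a field $\Bbbk$ of characteristic $0$. Then: (a) If $(\mathfrak g,A)$ is perfect, then for every associative $\Bbbk$-algebra $\mathcal F$ one has $(\mathfrak g,A)(\mathcal F)=\widetilde{(\mathfrak g,A)}(\mathcal F)$, i.e. $$(\mathfrak g,A)(\mathcal F)=\mathcal F\cdot\mathfrak g+\sum_{k\ge 1}\Big(I_k(\mathcal F)\cdot[\mathfrak g,\mathfrak g^{k+1}]+[\mathcal F,I_{k-1}(\mathcal F)]\cdot\mathfrak g^{k+1}\Big).$$ (b) If the Lie algebra $\overline{\mathfrak g}=\overline{\Bbbk}\otimes\mathfrak g$ over the algebraic closure $\overline{\Bbbk}$ of $\Bbbk$ is strongly graded, then $(\mathfrak g,A)$ is perfect. (c) If $\mathfrak g$ is semisimple over $\Bbbk$, then for every associative $\Bbbk$-algebra $\mathcal F$ one has $$(\mathfrak g,A)(\mathcal F)=\mathcal F\cdot\mathfrak g+\sum_{k\ge 2}\Big(I_{k-1}(\mathcal F)\cdot(\mathfrak g^k)_+ +[\mathcal F,I_{k-2}(\mathcal F)]\cdot Z_k(\mathfrak g)\Big),$$ where $(\mathfrak g^k)_+=[\mathfrak g,\mathfrak g^k]$, $Z_k(\mathfrak g)=Z(\langle\mathfrak g\rangle)\cap\mathfrak g^k$, and $Z(\langle\mathfrak g\rangle)$ is the center of $\langle\mathfrak g\rangle=\sum_{k\ge1}\mathfrak g^k$.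
   Context: $\Bbbk$ is a field of characteristic $0$; algebras are associative $\Bbbk$-algebras, not necessarily unital unless stated; tensor products are over $\Bbbk$. For subsets $X,Y$ of an algebra, $XY$ denotes the linear span of all products $xy$, and $[X,Y]$ the linear span of all commutators $[x,y]=xy-yx$ ($x\in X$, $y\in Y$). Write $\mathcal F\cdot A:=\mathcal F\otimes A$, and for subspaces $X\subset\mathcal F$, $Y\subset A$ let $X\cdot Y\subset\mathcal F\cdot A$ be the span of all $x\otimes y$. A compatible pair $(\mathfrak g,A)$ is a unital algebra $A$ with a subspace $\mathfrak g\subset A$ such that $[\mathfrak g,\mathfrak g]\subset\mathfrak g$. $\mathfrak g^k\subset A$ is the span of all products $g_1\cdots g_k$, $g_i\in\mathfrak g$. $(\mathfrak g,A)(\mathcal F)$ denotes the Lie subalgebra (for the commutator bracket) of $\mathcal F\cdot A$ generated by $\mathcal F\cdot\mathfrak g$. For an algebra $\mathcal F$ put $\mathcal F^{(0)}=\mathcal F$, $\mathcal F^{(k)}=[\mathcal F,\mathcal F^{(k-1)}]$ for $k\geq 1$; $I_k^\ell(\mathcal F)=\sum_{\lambda}\mathcal F^{(\lambda_1)}\cdots\mathcal F^{(\lambda_\ell)}$, the sum over $\lambda\in(\mathbb Z_{\ge0})^\ell$ with $\lambda_1+\dots+\lambda_\ell=k$; and $I_k(\mathcal F)=\sum_{\ell\ge1}I_k^\ell(\mathcal F)$, a two-sided ideal of $\mathcal F$ ($I_0(\mathcal F)=\mathcal F$). The pair $(\mathfrak g,A)$ is perfect if $[\mathfrak g,\mathfrak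 g^k]\mathfrak g+(\mathfrak g^k\cap\mathfrak g^{k+1})=\mathfrak g^{k+1}$ for all $k\ge2$. A Lie algebra $\overline{\mathfrak g}$ over an algebraically closed field $\overline{\Bbbk}$ is strongly graded if there is $h_0\in\overline{\mathfrak g}$ such that (i) $\mathrm{ad}\,h_0$ is diagonalizable on $\overline{\mathfrak g}$, i.e. $\overline{\mathfrak g}=\bigoplus_{c\in\overline{\Bbbk}}\overline{\mathfrak g}_c$ where $\overline{\mathfrak g}_c$ is the $c$-eigenspace of $\mathrm{ad}\,h_0$; and (ii) $\overline{\mathfrak g}_0$ is spanned by the subspaces $[\overline{\mathfrak g}_c,\overline{\mathfrak g}_{-c}]$, $c\in\overline{\Bbbk}\setminus\{0\}$. Semisimple Lie algebras are understood to be finite-dimensional. *)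

theory Defs
  imports
    "HOL-Algebra.Algebraic_Closure_Type"
    "HOL-Library.Poly_Mapping"
begin

section \<open>Associative algebras and products of subspaces\<close>

text \<open>
  Algebras are types with an explicit scalar multiplication. No unit is required.
\<close>

locale k_algebra = vector_space scale
  for scale :: "'k::field \<Rightarrow> 'b::ring \<Rightarrow> 'b" +
  assumes scale_mult_left: "scale c x * y = scale c (x * y)"
    and scale_mult_right: "x * scale c y = scale c (x * y)"

definition prod_span :: "('k::field \<Rightarrow> 'b::ring \<Rightarrow> 'b) \<Rightarrow> 'b set \<Rightarrow> 'b set \<Rightarrow> 'b set" where
  "prod_span s S T = module.span s {x * y |x y. x \<in> S \<and> y \<in> T}"

definition comm_span :: "('k::field \<Rightarrow> 'b::ring \<Rightarrow> 'b) \<Rightarrow> 'b set \<Rightarrow> 'b set \<Rightarrow> 'b set" where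
  "comm_span s S T = module.span s {x * y - y * x |x y. x \<in> S \<and> y \<in> T}"

text \<open>
  The product \<open>S\<^sub>1 \<cdots> S\<^sub>l\<close> of a nonempty list of subspaces; the value at the empty list is
  irrelevant (in a non-unital algebra there is no empty product).
\<close>

fun prod_spans :: "('k::field \<Rightarrow> 'b::ring \<Rightarrow> 'b) \<Rightarrow> 'b set list \<Rightarrow> 'b set" where
  "prod_spans s [] = {0}"
| "prod_spans s [S] = S"
| "prod_spans s (S # T # Ss) = prod_span s S (prod_spans s (T # Ss))"

primrec lower_central :: "('k::field \<Rightarrow> 'f::ring \<Rightarrow> 'f) \<Rightarrow> nat \<Rightarrow> 'f set" where
  "lower_central s 0 = UNIV"
| "lower_central s (Suc k) = comm_span s UNIV (lower_central s k)"

text \<open>Here and below, a sum of subspaces is the span of their union.\<close>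

definition I_len :: "('k::field \<Rightarrow> 'f::ring \<Rightarrow> 'f) \<Rightarrow> nat \<Rightarrow> nat \<Rightarrow> 'f set" where
  "I_len s k l = module.span s
     (\<Union>ms\<in>{ms. length ms = l \<and> sum_list ms = k}. prod_spans s (map (lower_central s) ms))"

definition I_ideal :: "('k::field \<Rightarrow> 'f::ring \<Rightarrow> 'f) \<Rightarrow> nat \<Rightarrow> 'f set" where
  "I_ideal s k = module.span s (\<Union>l\<in>{1..}. I_len s k l)"


section \<open>Compatible pairs\<close>

text \<open>
  The unital algebra \<open>A\<close> has sort \<open>{ring,monoid_mult}\<close> rather than \<open>ring_1\<close>, so that the zero
  algebra is not excluded.
\<close>

definition compatible_pair :: "('k::field \<Rightarrow> 'a::{ring,monoid_mult} \<Rightarrow> 'a) \<Rightarrow> 'a set \<Rightarrow> bool" where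
  "compatible_pair s g \<longleftrightarrow> k_algebra s \<and> module.subspace s g \<and> comm_span s g g \<subseteq> g"

definition gpow :: "('k::field \<Rightarrow> 'a::{ring,monoid_mult} \<Rightarrow> 'a) \<Rightarrow> 'a set \<Rightarrow> nat \<Rightarrow> 'a set" where
  "gpow s g k = module.span s {prod_list xs |xs. length xs = k \<and> set xs \<subseteq> g}"

definition perfect_pair :: "('k::field \<Rightarrow> 'a::{ring,monoid_mult} \<Rightarrow> 'a) \<Rightarrow> 'a set \<Rightarrow> bool" where
  "perfect_pair s g \<longleftrightarrow>
     (\<forall>k\<ge>2. module.span s
        (prod_span s (comm_span s g (gpow s g k)) g \<union> (gpow s g k \<inter> gpow s g (k + 1)))
        = gpow s g (k + 1))"

definition gen_alg :: "('k::field \<Rightarrow> 'a::{ring,monoid_mult} \<Rightarrow> 'a) \<Rightarrow> 'a set \<Rightarrow> 'a set" where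
  "gen_alg s g = module.span s (\<Union>k\<in>{1..}. gpow s g k)"

definition center_of :: "'a::ring set \<Rightarrow> 'a set" where
  "center_of B = {z\<in>B. \<forall>x\<in>B. z * x = x * z}"

definition Z_k :: "('k::field \<Rightarrow> 'a::{ring,monoid_mult} \<Rightarrow> 'a) \<Rightarrow> 'a set \<Rightarrow> nat \<Rightarrow> 'a set" where
  "Z_k s g k = center_of (gen_alg s g) \<inter> gpow s g k"


section \<open>Semisimplicity\<close>

primrec derived_series :: "('k::field \<Rightarrow> 'a::ring \<Rightarrow> 'a) \<Rightarrow> 'a set \<Rightarrow> nat \<Rightarrow> 'a set" where
  "derived_series s h 0 = h"
| "derived_series s h (Suc n) = comm_span s (derived_series s h n) (derived_series s h n)"

definition solvable_lie :: "('k::field \<Rightarrow> 'a::ring \<Rightarrow> 'a) \<Rightarrow> 'a set \<Rightarrow> bool" where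
  "solvable_lie s h \<longleftrightarrow> (\<exists>n. derived_series s h n = {0})"

definition lie_ideal :: "('k::field \<Rightarrow> 'a::ring \<Rightarrow> 'a) \<Rightarrow> 'a set \<Rightarrow> 'a set \<Rightarrow> bool" where
  "lie_ideal s g h \<longleftrightarrow> module.subspace s h \<and> h \<subseteq> g \<and> comm_span s g h \<subseteq> h"

text \<open>
  Finite-dimensional with zero radical, for a Lie subalgebra \<open>g\<close> of an associative algebra with
  its commutator bracket.
\<close>

definition semisimple_lie :: "('k::field \<Rightarrow> 'a::ring \<Rightarrow> 'a) \<Rightarrow> 'a set \<Rightarrow> bool" where
  "semisimple_lie s g \<longleftrightarrow>
     (\<exists>B. finite B \<and> g = module.span s B) \<and>
     (\<forall>h. lie_ideal s g h \<and> solvable_lie s h \<longrightarrow> h = {0})"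


section \<open>Lie algebras with explicit carrier\<close>

text \<open>
  Tensor products are quotient spaces whose operations depend on the scalar multiplications of
  the factors, so they are given as structures with a carrier.
\<close>

record ('c, 'v) lie_struct = "'v partial_object" +
  lzero :: 'v
  ladd :: "'v \<Rightarrow> 'v \<Rightarrow> 'v"
  lsmult :: "'c \<Rightarrow> 'v \<Rightarrow> 'v"
  lbracket :: "'v \<Rightarrow> 'v \<Rightarrow> 'v"

inductive_set lie_span :: "('c, 'v) lie_struct \<Rightarrow> 'v set \<Rightarrow> 'v set"
  for L :: "('c, 'v) lie_struct" and S :: "'v set" where
  zero: "lzero L \<in> lie_span L S"
| base: "x \<in> S \<Longrightarrow> x \<in> lie_span L S"
| add: "x \<in> lie_span L S \<Longrightarrow> y \<in> lie_span L S \<Longrightarrow> ladd L x y \<in> lie_span L S"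
| smult: "x \<in> lie_span L S \<Longrightarrow> lsmult L c x \<in> lie_span L S"

inductive_set lie_generated :: "('c, 'v) lie_struct \<Rightarrow> 'v set \<Rightarrow> 'v set"
  for L :: "('c, 'v) lie_struct" and S :: "'v set" where
  zero: "lzero L \<in> lie_generated L S"
| base: "x \<in> S \<Longrightarrow> x \<in> lie_generated L S"
| add: "x \<in> lie_generated L S \<Longrightarrow> y \<in> lie_generated L S \<Longrightarrow> ladd L x y \<in> lie_generated L S"
| smult: "x \<in> lie_generated L S \<Longrightarrow> lsmult L c x \<in> lie_generated L S"
| bracket: "x \<in> lie_generated L S \<Longrightarrow> y \<in> lie_generated L S \<Longrightarrow>
    lbracket L x y \<in> lie_generated L S"

definition ad_eigenspace :: "('c, 'v) lie_struct \<Rightarrow> 'v \<Rightarrow> 'c \<Rightarrow> 'v set" where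
  "ad_eigenspace L h c = {x \<in> carrier L. lbracket L h x = lsmult L c x}"

text \<open>
  The sum of the eigenspaces is automatically direct, so diagonalizability only requires that
  the eigenspaces span.
\<close>

definition strongly_graded :: "('c::alg_closed_field, 'v) lie_struct \<Rightarrow> bool" where
  "strongly_graded L \<longleftrightarrow> (\<exists>h0 \<in> carrier L.
     carrier L = lie_span L (\<Union>c. ad_eigenspace L h0 c) \<and>
     ad_eigenspace L h0 0 = lie_span L (\<Union>c\<in>UNIV - {0}.
       lie_span L {lbracket L x y |x y. x \<in> ad_eigenspace L h0 c \<and> y \<in> ad_eigenspace L h0 (- c)}))"


section \<open>Tensor products over the base field\<close>

text \<open>
  The free vector space on a set of pairs is the space of finitely supported functions
  \<^typ>\<open>('b \<times> 'd) \<Rightarrow>\<^sub>0 'k\<close>, and \<open>V \<otimes> W\<close> is its quotient by the bilinearity relations, the elements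
  being cosets.
\<close>

definition free_scale :: "'k::field \<Rightarrow> ('b \<Rightarrow>\<^sub>0 'k) \<Rightarrow> ('b \<Rightarrow>\<^sub>0 'k)" where
  "free_scale c p = Poly_Mapping.map ((*) c) p"

lemma lookup_free_scale: "Poly_Mapping.lookup (free_scale c p) i = c * Poly_Mapping.lookup p i"
  by (simp add: free_scale_def Poly_Mapping.map.rep_eq when_def)

interpretation free_vs: vector_space "free_scale :: 'k::field \<Rightarrow> ('b \<Rightarrow>\<^sub>0 'k) \<Rightarrow> ('b \<Rightarrow>\<^sub>0 'k)"
  by unfold_locales
     (auto intro!: poly_mapping_eqI simp: lookup_free_scale lookup_add algebra_simps)

definition tensor_rel ::
  "('k::field \<Rightarrow> 'b::ab_group_add \<Rightarrow> 'b) \<Rightarrow> 'b set \<Rightarrow> ('k \<Rightarrow> 'd::ab_group_add \<Rightarrow> 'd) \<Rightarrow> 'd set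
    \<Rightarrow> ('b \<times> 'd \<Rightarrow>\<^sub>0 'k) set" where
  "tensor_rel s1 V s2 W = module.span free_scale (
     {Poly_Mapping.single (x + x', y) 1 - Poly_Mapping.single (x, y) 1 - Poly_Mapping.single (x', y) 1
        |x x' y. x \<in> V \<and> x' \<in> V \<and> y \<in> W} \<union>
     {Poly_Mapping.single (x, y + y') 1 - Poly_Mapping.single (x, y) 1 - Poly_Mapping.single (x, y') 1
        |x y y'. x \<in> V \<and> y \<in> W \<and> y' \<in> W} \<union>
     {Poly_Mapping.single (s1 c x, y) 1 - free_scale c (Poly_Mapping.single (x, y) 1)
        |c x y. x \<in> V \<and> y \<in> W} \<union>
     {Poly_Mapping.single (x, s2 c y) 1 - free_scale c (Poly_Mapping.single (x, y) 1)
        |c x y. x \<in> V \<and> y \<in> W})"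

text \<open>
  The bilinear extension of \<open>(x, y), (x', y') \<mapsto> (m1 x x', m2 y y')\<close> to the free vector space.
\<close>

definition free_bilin ::
  "('b \<Rightarrow> 'b \<Rightarrow> 'b) \<Rightarrow> ('d \<Rightarrow> 'd \<Rightarrow> 'd) \<Rightarrow> ('b \<times> 'd \<Rightarrow>\<^sub>0 'k::field) \<Rightarrow> ('b \<times> 'd \<Rightarrow>\<^sub>0 'k) \<Rightarrow> ('b \<times> 'd \<Rightarrow>\<^sub>0 'k)"
  where
  "free_bilin m1 m2 p q =
     (\<Sum>(x, y)\<in>Poly_Mapping.keys p. \<Sum>(x', y')\<in>Poly_Mapping.keys q.
        Poly_Mapping.single (m1 x x', m2 y y') (Poly_Mapping.lookup p (x, y) * Poly_Mapping.lookup q (x', y')))"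

text \<open>
  The quotient of \<open>P\<close> by \<open>R\<close> with the operations induced by scalar multiplication \<open>sc\<close> and
  bracket \<open>br\<close>. When these are compatible with \<open>R\<close>, each union below is a union of equal cosets.
\<close>

definition quotient_lie ::
  "'p::ab_group_add set \<Rightarrow> 'p set \<Rightarrow> ('c \<Rightarrow> 'p \<Rightarrow> 'p) \<Rightarrow> ('p \<Rightarrow> 'p \<Rightarrow> 'p) \<Rightarrow> ('c, 'p set) lie_struct"
  where
  "quotient_lie P R sc br =
     \<lparr> carrier = {(+) p ` R |p. p \<in> P},
       lzero = R,
       ladd = (\<lambda>U V. \<Union>u\<in>U. \<Union>v\<in>V. (+) (u + v) ` R),
       lsmult = (\<lambda>c U. \<Union>u\<in>U. (+) (sc c u) ` R),
       lbracket = (\<lambda>U V. \<Union>u\<in>U. \<Union>v\<in>V. (+) (br u v) ` R) \<rparr>"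


subsection \<open>The algebra \<open>F \<otimes> A\<close> with its commutator bracket\<close>

definition tensor_lie ::
  "('k::field \<Rightarrow> 'f::ring \<Rightarrow> 'f) \<Rightarrow> ('k \<Rightarrow> 'a::ring \<Rightarrow> 'a) \<Rightarrow> ('k, ('f \<times> 'a \<Rightarrow>\<^sub>0 'k) set) lie_struct"
  where
  "tensor_lie sF sA =
     quotient_lie UNIV (tensor_rel sF UNIV sA UNIV) free_scale
       (\<lambda>p q. free_bilin (*) (*) p q - free_bilin (*) (*) q p)"

definition pure_tensor ::
  "('k::field \<Rightarrow> 'f::ring \<Rightarrow> 'f) \<Rightarrow> ('k \<Rightarrow> 'a::ring \<Rightarrow> 'a) \<Rightarrow> 'f \<Rightarrow> 'a \<Rightarrow> ('f \<times> 'a \<Rightarrow>\<^sub>0 'k) set"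
  where
  "pure_tensor sF sA x y = (+) (Poly_Mapping.single (x, y) 1) ` tensor_rel sF UNIV sA UNIV"

definition tensor_dot ::
  "('k::field \<Rightarrow> 'f::ring \<Rightarrow> 'f) \<Rightarrow> ('k \<Rightarrow> 'a::ring \<Rightarrow> 'a) \<Rightarrow> 'f set \<Rightarrow> 'a set
    \<Rightarrow> ('f \<times> 'a \<Rightarrow>\<^sub>0 'k) set set"
  where
  "tensor_dot sF sA S T =
     lie_span (tensor_lie sF sA) {pure_tensor sF sA x y |x y. x \<in> S \<and> y \<in> T}"

text \<open>The Lie algebra \<open>(g, A)(F)\<close>.\<close>

definition pair_lie ::
  "('k::field \<Rightarrow> 'a::{ring,monoid_mult} \<Rightarrow> 'a) \<Rightarrow> 'a set \<Rightarrow> ('k \<Rightarrow> 'f::ring \<Rightarrow> 'f)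
    \<Rightarrow> ('f \<times> 'a \<Rightarrow>\<^sub>0 'k) set set"
  where
  "pair_lie sA g sF = lie_generated (tensor_lie sF sA) (tensor_dot sF sA UNIV g)"


subsection \<open>Extension of scalars to the algebraic closure\<close>

text \<open>
  The tensor product of the algebraic closure with \<open>g\<close> over the base field, as a Lie algebra over
  the algebraic closure: \<open>c (d \<otimes> x) = cd \<otimes> x\<close> and \<open>[d \<otimes> x, d' \<otimes> x'] = dd' \<otimes> [x, x']\<close>.
\<close>

definition closure_lie ::
  "('k::field \<Rightarrow> 'a::ring \<Rightarrow> 'a) \<Rightarrow> 'a set
    \<Rightarrow> ('k alg_closure, ('k alg_closure \<times> 'a \<Rightarrow>\<^sub>0 'k) set) lie_struct"
  where
  "closure_lie sA g =
     quotient_lie {p. Poly_Mapping.keys p \<subseteq> UNIV \<times> g} (tensor_rel (\<lambda>c d. to_ac c * d) UNIV sA g)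
       (\<lambda>c p. \<Sum>(d, x)\<in>Poly_Mapping.keys p. Poly_Mapping.single (c * d, x) (Poly_Mapping.lookup p (d, x)))
       (free_bilin (*) (\<lambda>x x'. x * x' - x' * x))"

end

theory Submission
  imports Defs
begin

text \<open>
  For the formula in (a), the right-hand side is stable under bracketing with \<open>F \<cdot> g\<close>, hence by
  the Jacobi identity contains the generated Lie algebra. Conversely, if the Lie algebra contains
  \<open>[F, I\<^sub>n] \<cdot> g\<^sup>n\<^sup>+\<^sup>2\<close>, then modulo it the element \<open>i f \<otimes> [x, w]\<close> depends on the word
  \<open>x w\<close> only up to rotation; as the commutators of all rotations of a word sum to zero, it also
  contains \<open>I\<^sub>n\<^sub>+\<^sub>1 \<cdot> [g, g\<^sup>n\<^sup>+\<^sup>2]\<close>, and perfectness gives the next step.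

  Perfectness of the pair follows from \<open>[g, g] = g\<close> alone. For a strongly graded extension of
  scalars this equality descends to the base field, since a functional on \<open>g\<close> vanishing on
  \<open>[g, g]\<close> extends to the closure. For semisimple \<open>g\<close> both \<open>[g, g] = g\<close> and
  \<open>g\<^sup>k = [g, g\<^sup>k] + Z\<^sub>k\<close> follow from \<open>V = [g, V] + V\<^sup>g\<close> for finite-dimensional modules
  \<open>V\<close>, which is proved with Casimir elements and Cartan's criterion.
\<close>

section \<open>Finite-dimensional subspaces and Engel's theorem\<close>

text \<open>\<open>F\<close> may lack a unit, so \<open>I (Suc k)\<close> is
  \<open>FI k + FI k * F\<close> rather than just \<open>FI k * F\<close>, and the inductive step
  treats elements \<open>j\<close> and \<open>j * f\<close> of the two summands separately.
  Characteristic 0 enters through divisions: by the length \<open>n + 3\<close> of a rotated word,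
  by \<open>k\<close> when a derivation is averaged over the letters of a word, and through the
  trace \<open>dim J\<close> of the Casimir operator, which must not vanish in the field. It also
  makes the field a rational vector space, and rational-valued functionals take the place of complex
  conjugation in Cartan's criterion: a vanishing sum of rational squares forces the eigenvalues to
  be 0. In (b) an eigenvector \<open>x\<close> for \<open>c \<noteq> 0\<close> is a multiple of
  \<open>[h0, x]\<close>, while condition (ii) writes the zero eigenspace by brackets. The splitting
  \<open>V = [g, V] + V^g\<close> comes from an induction on the dimension that splits off the image
  of a power of the Casimir operator; neither irreducible modules nor Schur's lemma appear.\<close>

context k_algebra
begin

text \<open>Containment in a span, rather than equality, lets the notion pass to arbitrary subsets,
  which need not be subspaces.\<close>

definition fin_dim :: "'b set \<Rightarrow> bool" where
  "fin_dim V \<longleftrightarrow> (\<exists>B. finite B \<and> V \<subseteq> span B)"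

lemma fin_dim_subset: "fin_dim V \<Longrightarrow> U \<subseteq> V \<Longrightarrow> fin_dim U"
  by (auto simp: fin_dim_def)

lemma fin_dim_basis:
  assumes "fin_dim V" "subspace V"
  obtains B where "finite B" "B \<subseteq> V" "independent B" "span B = V" "card B = dim V"
proof -
  obtain B where B: "B \<subseteq> V" "independent B" "V \<subseteq> span B" "card B = dim V"
    using basis_exists by blast
  obtain T where T: "finite T" "V \<subseteq> span T"
    using assms by (auto simp: fin_dim_def)
  have "finite B" using independent_span_bound[OF T(1) B(2)] B(1) T(2) by blast
  moreover have "span B = V" using B assms(2) by (simp add: span_subspace)
  ultimately show ?thesis using that B by blast
qed

lemma independent_card_le_dim_fd:
  assumes "fin_dim V" "subspace V" "S \<subseteq> V" "independent S"
  shows "finite S" "card S \<le> dim V"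
proof -
  obtain B where B: "finite B" "span B = V" "card B = dim V"
    using fin_dim_basis[OF assms(1,2)] by metis
  show "finite S" "card S \<le> dim V"
    using independent_span_bound[OF B(1) assms(4)] assms(3) B(2,3) by auto
qed

text \<open>Dimensions are compared inside a finite-dimensional \<open>V\<close>, because the
  surrounding algebra may have infinite dimension.\<close>

lemma dim_mono_fd:
  assumes "fin_dim V" "subspace V" "U \<subseteq> V" "subspace U"
  shows "dim U \<le> dim V"
proof -
  obtain B where B: "B \<subseteq> U" "independent B" "card B = dim U"
    using fin_dim_basis[OF fin_dim_subset[OF assms(1,3)] assms(4)] by metis
  show ?thesis using independent_card_le_dim_fd[OF assms(1,2) _ B(2)] B assms(3) by auto
qed

lemma subspace_eq_fd:
  assumes "fin_dim V" "subspace V" "U \<subseteq> V" "subspace U" "dim V \<le> dim U"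
  shows "U = V"
proof (rule ccontr)
  assume "U \<noteq> V"
  then obtain v where v: "v \<in> V" "v \<notin> U" using assms(3) by auto
  obtain B where B: "finite B" "B \<subseteq> U" "independent B" "span B = U" "card B = dim U"
    using fin_dim_basis[OF fin_dim_subset[OF assms(1,3)] assms(4)] by metis
  have "independent (insert v B)" using v B by (intro independent_insertI) auto
  then have "card (insert v B) \<le> dim V"
    using v B assms(3) by (intro independent_card_le_dim_fd(2)[OF assms(1,2)]) auto
  moreover have "v \<notin> B" using v B by auto
  ultimately show False using B assms(5) by simp
qed

lemma dim_less_fd:
  assumes "fin_dim V" "subspace V" "U \<subset> V" "subspace U"
  shows "dim U < dim V"
proof (rule ccontr)
  assume "\<not> dim U < dim V"
  then have "U = V" using assms(3) by (intro subspace_eq_fd assms) auto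
  then show False using assms(3) by simp
qed

text \<open>Each strict inclusion lowers the dimension by at least 1. The lemma serves the images of
  the powers of an operator, as in Fitting's lemma, and the derived series.\<close>

lemma decreasing_subspaces_stabilise:
  assumes "fin_dim (U 0)" "\<And>n. subspace (U n)" "\<And>n. U (Suc n) \<subseteq> U n"
  obtains n where "U (Suc n) = U n"
proof -
  have sub: "U n \<subseteq> U 0" for n by (induction n) (use assms(3) in auto)
  then have fd: "fin_dim (U n)" for n using fin_dim_subset[OF assms(1)] by blast
  have "\<exists>n. \<not> dim (U (Suc n)) < dim (U n)"
  proof (rule ccontr)
    assume "\<not> ?thesis"
    then have less: "dim (U (Suc n)) < dim (U n)" for n by blast
    have "dim (U n) + n \<le> dim (U 0)" for n
    proof (induction n)
      case (Suc n)
      then show ?case using less[of n] by linarith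
    qed simp
    from this[of "Suc (dim (U 0))"] show False by simp
  qed
  then obtain n where "\<not> dim (U (Suc n)) < dim (U n)" by blast
  then have "U (Suc n) = U n"
    using subspace_eq_fd[OF fd[of n] assms(2) assms(3) assms(2)] by simp
  then show ?thesis by (rule that)
qed

end

section \<open>Products and commutators of spans\<close>

context k_algebra
begin

lemma mult_left_span:
  assumes "\<And>x. x \<in> S \<Longrightarrow> a * x \<in> U" "subspace U" "x \<in> span S"
  shows "a * x \<in> U"
  using assms(3)
proof (induction rule: span_induct_alt)
  case base then show ?case using assms(2) by (simp add: subspace_0)
next
  case (step c x y)
  then show ?case using assms(1,2)
    by (simp add: distrib_left scale_mult_right subspace_add subspace_scale)
qed

lemma mult_right_span:
  assumes "\<And>x. x \<in> S \<Longrightarrow> x * a \<in> U" "subspace U" "x \<in> span S"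
  shows "x * a \<in> U"
  using assms(3)
proof (induction rule: span_induct_alt)
  case base then show ?case using assms(2) by (simp add: subspace_0)
next
  case (step c x y)
  then show ?case using assms(1,2)
    by (simp add: distrib_right scale_mult_left subspace_add subspace_scale)
qed

lemma mult_span:
  assumes "\<And>x y. x \<in> S \<Longrightarrow> y \<in> T \<Longrightarrow> x * y \<in> U" "subspace U" "x \<in> span S" "y \<in> span T"
  shows "x * y \<in> U"
  by (rule mult_right_span[OF mult_left_span]) (use assms in auto)

lemma commutator_left_span:
  assumes "\<And>x. x \<in> S \<Longrightarrow> a * x - x * a \<in> U" "subspace U" "x \<in> span S"
  shows "a * x - x * a \<in> U"
  using assms(3)
proof (induction rule: span_induct_alt)
  case base then show ?case using assms(2) by (simp add: subspace_0)
next
  case (step c x y)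
  have "a * (scale c x + y) - (scale c x + y) * a = scale c (a * x - x * a) + (a * y - y * a)"
    by (simp add: algebra_simps scale_mult_left scale_mult_right scale_right_diff_distrib)
  then show ?case using assms(1)[OF step(1)] step(2) assms(2)
    by (simp add: subspace_add subspace_scale)
qed

lemma commutator_span:
  assumes "\<And>x y. x \<in> S \<Longrightarrow> y \<in> T \<Longrightarrow> x * y - y * x \<in> U" "subspace U" "x \<in> span S" "y \<in> span T"
  shows "x * y - y * x \<in> U"
proof -
  have 1: "x * y - y * x \<in> U" if "x \<in> S" for x
    using commutator_left_span[OF assms(1)[OF that] assms(2,4)] .
  then have "y * x - x * y \<in> U" if "x \<in> S" for x
    using subspace_neg[OF assms(2) 1[OF that]] by simp
  from commutator_left_span[OF this assms(2,3)] have "y * x - x * y \<in> U" .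
  from subspace_neg[OF assms(2) this] show ?thesis by simp
qed

lemma prod_spanI: "x \<in> S \<Longrightarrow> y \<in> T \<Longrightarrow> x * y \<in> prod_span scale S T"
  unfolding prod_span_def by (rule span_base) auto

lemma comm_spanI: "x \<in> S \<Longrightarrow> y \<in> T \<Longrightarrow> x * y - y * x \<in> comm_span scale S T"
  unfolding comm_span_def by (rule span_base) auto

lemma subspace_prod_span [simp]: "subspace (prod_span scale S T)"
  by (simp add: prod_span_def)

lemma subspace_comm_span [simp]: "subspace (comm_span scale S T)"
  by (simp add: comm_span_def)

lemma prod_span_subset: 
  "(\<And>x y. x \<in> S \<Longrightarrow> y \<in> T \<Longrightarrow> x * y \<in> U) \<Longrightarrow> subspace U \<Longrightarrow> prod_span scale S T \<subseteq> U"
  unfolding prod_span_def by (rule span_minimal) auto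

lemma comm_span_subset: 
  "(\<And>x y. x \<in> S \<Longrightarrow> y \<in> T \<Longrightarrow> x * y - y * x \<in> U) \<Longrightarrow> subspace U \<Longrightarrow> comm_span scale S T \<subseteq> U"
  unfolding comm_span_def by (rule span_minimal) auto

lemma comm_span_mono: "S \<subseteq> S' \<Longrightarrow> T \<subseteq> T' \<Longrightarrow> comm_span scale S T \<subseteq> comm_span scale S' T'"
  unfolding comm_span_def by (rule span_mono) blast

end

section \<open>Vanishing words and Engel's theorem\<close>

locale unital_k_algebra = k_algebra scale
  for scale :: "'k::field \<Rightarrow> 'a::{ring,monoid_mult} \<Rightarrow> 'a"
begin

lemma prod_list_span:
  "set xs \<subseteq> span S \<Longrightarrow> prod_list xs \<in> span {prod_list ys |ys. length ys = length xs \<and> set ys \<subseteq> S}"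
proof (induction xs)
  case Nil
  then show ?case by (auto intro!: span_base)
next
  case (Cons x xs)
  let ?T = "\<lambda>xs::'a list. {prod_list ys |ys. length ys = length xs \<and> set ys \<subseteq> S}"
  have "a * b \<in> span (?T (x # xs))" if "a \<in> S" "b \<in> ?T xs" for a b
  proof -
    from that(2) obtain ys where "b = prod_list ys" "length ys = length xs" "set ys \<subseteq> S" by blast
    then have "a * b \<in> ?T (x # xs)" using that(1) by (auto intro!: exI[of _ "a # ys"])
    then show ?thesis by (rule span_base)
  qed
  then have "x * prod_list xs \<in> span (?T (x # xs))"
    using Cons.prems by (intro mult_span[of S "?T xs", OF _ subspace_span _ Cons.IH]) simp_all
  then show ?case by simp
qed

text \<open>Nilpotency is expressed in the associative algebra, so that Engel's theorem can be
  proved without choosing a flag in a module.\<close>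

definition nilpotent_words :: "nat \<Rightarrow> 'a set \<Rightarrow> bool" where
  "nilpotent_words n Q \<longleftrightarrow> (\<forall>xs. length xs = n \<and> set xs \<subseteq> Q \<longrightarrow> prod_list xs = 0)"

lemma nilpotent_words_mono:
  assumes "nilpotent_words n Q" "n \<le> length xs" "set xs \<subseteq> Q"
  shows "prod_list xs = 0"
proof -
  have "prod_list xs = prod_list (take n xs) * prod_list (drop n xs)"
    by (metis append_take_drop_id prod_list.append)
  moreover have "prod_list (take n xs) = 0"
    using assms set_take_subset[of n xs] unfolding nilpotent_words_def by simp
  ultimately show ?thesis by simp
qed

lemma iterated_commutator_in_span:
  assumes "set qs \<subseteq> Q"
  shows "foldr (\<lambda>q z. q * z - z * q) qs z \<in>
    span {prod_list as * z * prod_list bs |as bs. set as \<subseteq> Q \<and> set bs \<subseteq> Q \<and> length as + length bs =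
        length qs}"
  using assms
proof (induction qs)
  case Nil
  show ?case by (rule span_base) auto
next
  case (Cons q qs)
  let ?T = "\<lambda>qs::'a list. {prod_list as * z * prod_list bs |as bs. set as \<subseteq> Q \<and> set bs \<subseteq> Q
    \<and> length as + length bs = length qs}"
  have "q * u - u * q \<in> span (?T (q # qs))" if "u \<in> ?T qs" for u
  proof -
    from that obtain as bs where u: "u = prod_list as * z * prod_list bs" "set as \<subseteq> Q" "set bs \<subseteq> Q"
      "length as + length bs = length qs" by blast
    have "q * u \<in> ?T (q # qs)" using u Cons.prems
      by (intro CollectI exI[of _ "q # as"] exI[of _ bs]) (simp add: mult.assoc)
    moreover have "u * q \<in> ?T (q # qs)" using u Cons.prems
      by (intro CollectI exI[of _ as] exI[of _ "bs @ [q]"]) (simp add: mult.assoc)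
    ultimately show ?thesis by (intro span_diff span_base)
  qed
  from commutator_left_span[of "?T qs", OF this subspace_span] show ?case using Cons by simp
qed

text \<open>In the expansion every letter stands to the left or to the right of \<open>z\<close>; of
  \<open>2 * n\<close> letters at least \<open>n\<close> stand on the same side.\<close>

lemma iterated_commutator_eq_0:
  assumes "nilpotent_words n Q" "set qs \<subseteq> Q" "2 * n \<le> length qs"
  shows "foldr (\<lambda>q z. q * z - z * q) qs z = 0"
proof -
  have "{prod_list as * z * prod_list bs |as bs. set as \<subseteq> Q \<and> set bs \<subseteq> Q
      \<and> length as + length bs = length qs} \<subseteq> {0}"
  proof (clarsimp)
    fix as bs assume as: "set as \<subseteq> Q" "set bs \<subseteq> Q" "length as + length bs = length qs"
    then have "n \<le> length as \<or> n \<le> length bs" using assms(3) by linarith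
    then show "prod_list as * z * prod_list bs = 0"
      using nilpotent_words_mono[OF assms(1)] as by auto
  qed
  from span_mono[OF this] show ?thesis
    using iterated_commutator_in_span[OF assms(2), of z] by auto
qed

text \<open>The word is cut into \<open>k\<close> blocks of length \<open>m\<close>; a block without
  a letter from \<open>Q\<close> is \<open>z ^ m = 0\<close>.\<close>

lemma word_with_many_letters:
  fixes z :: 'a
  assumes "z ^ m = 0" "set xs \<subseteq> insert z Q" "k * m \<le> length xs"
  shows "prod_list xs = 0 \<or> k \<le> length (filter (\<lambda>x. x \<in> Q) xs)"
  using assms(2,3)
proof (induction k arbitrary: xs)
  case (Suc k)
  let ?a = "take m xs" and ?b = "drop m xs"
  have len: "length ?a = m" using Suc.prems(2) by simp
  have xs: "xs = ?a @ ?b" by simp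
  have sub: "set ?a \<subseteq> insert z Q" "set ?b \<subseteq> insert z Q"
    using Suc.prems(1) set_take_subset set_drop_subset by (metis subset_trans)+
  have IH: "prod_list ?b = 0 \<or> k \<le> length (filter (\<lambda>x. x \<in> Q) ?b)"
    using Suc.prems by (intro Suc.IH sub) auto
  show ?case
  proof (cases "\<exists>x\<in>set ?a. x \<in> Q")
    case True
    then have "filter (\<lambda>x. x \<in> Q) ?a \<noteq> []" by (simp add: filter_empty_conv)
    then have "1 \<le> length (filter (\<lambda>x. x \<in> Q) ?a)" by (simp add: Suc_le_eq)
    moreover have "length (filter (\<lambda>x. x \<in> Q) xs) =
      length (filter (\<lambda>x. x \<in> Q) ?a) + length (filter (\<lambda>x. x \<in> Q) ?b)"
      by (subst xs, subst filter_append) simp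
    moreover have "prod_list xs = prod_list ?a * prod_list ?b"
      by (subst xs, subst prod_list.append) simp
    ultimately show ?thesis using IH mult_zero_right[of "prod_list ?a"] by (elim disjE) simp_all
  next
    case False
    then have "?a = replicate m z" using sub(1) len by (intro replicate_eqI) auto
    then have "prod_list ?a = 0" using assms(1) by simp
    moreover have "prod_list xs = prod_list ?a * prod_list ?b"
      by (subst xs, subst prod_list.append) simp
    ultimately show ?thesis by simp
  qed
qed simp

text \<open>The letters \<open>z\<close> are moved to the right end by
  \<open>z q = q z - [q, z]\<close>. As \<open>[q, z]\<close> is again in \<open>Q\<close>, the
  number of letters from \<open>Q\<close> does not change.\<close>

lemma normalizer_word_span:
  assumes Q: "subspace Q" and z: "\<And>q. q \<in> Q \<Longrightarrow> q * z - z * q \<in> Q"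
    and xs: "set xs \<subseteq> insert z Q"
  shows "prod_list xs \<in> span {prod_list qs * z ^ e |qs e. set qs \<subseteq> Q \<and> length qs = length (filter
      (\<lambda>x. x \<in> Q) xs)}"
  using xs
proof (induction xs)
  case Nil
  show ?case by (rule span_base) (auto intro!: exI[of _ "0::nat"])
next
  case (Cons x xs)
  let ?S = "\<lambda>j. {prod_list qs * z ^ e |qs e. set qs \<subseteq> Q \<and> length qs = j}"
  let ?j = "length (filter (\<lambda>x. x \<in> Q) xs)"
  have IH: "prod_list xs \<in> span (?S ?j)" using Cons by simp
  show ?case
  proof (cases "x \<in> Q")
    case True
    have "x * u \<in> span (?S (Suc ?j))" if "u \<in> ?S ?j" for u
    proof -
      from that obtain qs e where "u = prod_list qs * z ^ e" "set qs \<subseteq> Q" "length qs = ?j" by blast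
      then have "x * u \<in> ?S (Suc ?j)" using True
        by (auto intro!: exI[of _ "x # qs"] exI[of _ e] simp: mult.assoc)
      then show ?thesis by (rule span_base)
    qed
    from mult_left_span[OF this subspace_span IH] show ?thesis using True by simp
  next
    case False
    then have x: "x = z" using Cons.prems by simp
    have zq: "z * (prod_list qs * z ^ e) \<in> span (?S (length qs))" if "set qs \<subseteq> Q" for qs e
      using that
    proof (induction qs)
      case Nil
      show ?case by (rule span_base) (auto intro!: exI[of _ "Suc e"])
    next
      case (Cons q qs)
      have "z * (prod_list (q # qs) * z ^ e) =
        q * (z * (prod_list qs * z ^ e)) - (prod_list ((q * z - z * q) # qs) * z ^ e)"
        by (simp add: algebra_simps)
      have "q * v \<in> span (?S (Suc (length qs)))" if "v \<in> ?S (length qs)" for v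
      proof -
        from that obtain ps e where "v = prod_list ps * z ^ e" "set ps \<subseteq> Q" "length ps = length qs"
            by blast
        then have "q * v \<in> ?S (Suc (length qs))" using Cons.prems
          by (auto intro!: exI[of _ "q # ps"] exI[of _ e] simp: mult.assoc)
        then show ?thesis by (rule span_base)
      qed
      from mult_left_span[of "?S (length qs)", OF this subspace_span] 
      have 1: "q * (z * (prod_list qs * z ^ e)) \<in> span (?S (Suc (length qs)))"
        using Cons by simp
      have "prod_list ((q * z - z * q) # qs) * z ^ e \<in> ?S (Suc (length qs))"
        using Cons.prems z by (intro CollectI exI[of _ "(q * z - z * q) # qs"] exI[of _ e]) auto
      from span_diff[OF 1 span_base[OF this]] show ?case
        unfolding \<open>z * (prod_list (q # qs) * z ^ e) = _\<close> by simp
    qed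
    have "z * u \<in> span (?S ?j)" if "u \<in> ?S ?j" for u
      using that zq by fastforce
    from mult_left_span[OF this subspace_span IH] show ?thesis using False x by simp
  qed
qed

text \<open>A nonzero word of length \<open>n * m\<close> would contain at least \<open>n\<close>
  letters from \<open>Q\<close>. Once the letters \<open>z\<close> stand at the end, these form a
  product of at least \<open>n\<close> elements of \<open>Q\<close>, which is 0.\<close>

lemma nilpotent_words_span_insert:
  assumes Q: "subspace Q" "nilpotent_words n Q" and z: "\<And>q. q \<in> Q \<Longrightarrow> q * z - z * q \<in> Q"
    and zm: "z ^ m = 0"
  shows "nilpotent_words (n * m) (span (insert z Q))"
proof -
  have 0: "prod_list xs = 0" if xs: "set xs \<subseteq> insert z Q" "length xs = n * m" for xs
  proof (rule ccontr)
    assume nz: "prod_list xs \<noteq> 0"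
    then have "n \<le> length (filter (\<lambda>x. x \<in> Q) xs)"
      using word_with_many_letters[OF zm xs(1), of n] xs(2) by simp
    then have "{prod_list qs * z ^ e |qs e. set qs \<subseteq> Q \<and> length qs = length (filter (\<lambda>x. x \<in> Q) xs)}
        \<subseteq> {0}"
      using nilpotent_words_mono[OF Q(2)] by fastforce
    from span_mono[OF this] normalizer_word_span[OF Q(1) z xs(1)] nz show False by auto
  qed
  show ?thesis unfolding nilpotent_words_def
  proof (intro allI impI, elim conjE)
    fix xs assume xs: "length xs = n * m" "set xs \<subseteq> span (insert z Q)"
    have "{prod_list ys |ys. length ys = length xs \<and> set ys \<subseteq> insert z Q} \<subseteq> {0}"
      using 0 xs(1) by auto
    from span_mono[OF this] prod_list_span[OF xs(2)] show "prod_list xs = 0" by auto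
  qed
qed

text \<open>Among the subalgebras with vanishing long words one of maximal dimension,
  \<open>Q\<close>, is chosen. If it were proper, some element of \<open>P\<close> outside
  \<open>Q\<close> would normalise \<open>Q\<close>, and adjoining it would contradict
  maximality.\<close>

theorem engel:
  assumes P: "subspace P" "fin_dim P" "\<And>x y. x \<in> P \<Longrightarrow> y \<in> P \<Longrightarrow> x * y - y * x \<in> P"
    and nil: "\<And>x. x \<in> P \<Longrightarrow> \<exists>m. x ^ m = 0"
  shows "\<exists>n. nilpotent_words n P"
proof -
  define good where "good Q \<longleftrightarrow> subspace Q \<and> Q \<subseteq> P \<and> (\<forall>x\<in>Q. \<forall>y\<in>Q. x * y - y * x \<in> Q) \<and>
    (\<exists>n. nilpotent_words n Q)" for Q
  have "nilpotent_words 1 {0}" unfolding nilpotent_words_def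
  proof (intro allI impI, elim conjE)
    fix xs :: "'a list" assume "length xs = 1" "set xs \<subseteq> {0}"
    then show "prod_list xs = 0" by (cases xs) auto
  qed
  then have "good {0}" using P(1) unfolding good_def by (auto simp: subspace_0)
  moreover have "\<forall>Q. good Q \<longrightarrow> dim Q < Suc (dim P)"
    using dim_mono_fd[OF P(2,1)] unfolding good_def by (auto simp: less_Suc_eq_le)
  ultimately obtain Q where Q: "good Q" and max: "\<And>Q'. good Q' \<Longrightarrow> dim Q' \<le> dim Q"
    using ex_has_greatest_nat[of good "{0}" dim "Suc (dim P)"] by (auto simp: less_imp_le)
  then obtain n where n: "nilpotent_words n Q" and sQ: "subspace Q" and QP: "Q \<subseteq> P"
    and cQ: "\<And>x y. x \<in> Q \<Longrightarrow> y \<in> Q \<Longrightarrow> x * y - y * x \<in> Q"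
    unfolding good_def by blast
  have "Q = P"
  proof (rule ccontr)
    assume "Q \<noteq> P"
    then obtain z0 where z0: "z0 \<in> P" "z0 \<notin> Q" using QP by auto
    have "\<exists>z\<in>P. z \<notin> Q \<and> (\<forall>q\<in>Q. q * z - z * q \<in> Q)"
    proof (rule ccontr)
      assume neg: "\<not> ?thesis"
      \<comment> \<open>Without a normalising element, brackets with suitable elements of
        \<open>Q\<close> never lead into \<open>Q\<close>; but \<open>2 * n\<close> of them give
        0.\<close>
      have "\<exists>qs. set qs \<subseteq> Q \<and> length qs = j \<and> foldr (\<lambda>q z. q * z - z * q) qs z0 \<in> P - Q" for j
      proof (induction j)
        case 0 then show ?case using z0 by auto
      next
        case (Suc j)
        then obtain qs where qs: "set qs \<subseteq> Q" "length qs = j"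
          "foldr (\<lambda>q z. q * z - z * q) qs z0 \<in> P - Q" by blast
        obtain q where q: "q \<in> Q" 
          "q * foldr (\<lambda>q z. q * z - z * q) qs z0 - foldr (\<lambda>q z. q * z - z * q) qs z0 * q \<notin> Q"
          using neg qs(3) by blast
        have "q * foldr (\<lambda>q z. q * z - z * q) qs z0 - foldr (\<lambda>q z. q * z - z * q) qs z0 * q \<in> P"
          using P(3) q(1) qs(3) QP by blast
        then show ?case using qs(1,2) q by (intro exI[of _ "q # qs"]) simp
      qed
      from this[of "2 * n"] obtain qs where "set qs \<subseteq> Q" "length qs = 2 * n"
        "foldr (\<lambda>q z. q * z - z * q) qs z0 \<in> P - Q" by blast
      then show False using iterated_commutator_eq_0[OF n, of qs z0] sQ by (simp add: subspace_0)
    qed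
    then obtain z where z: "z \<in> P" "z \<notin> Q" "\<And>q. q \<in> Q \<Longrightarrow> q * z - z * q \<in> Q" by blast
    obtain m where m: "z ^ m = 0" using nil z(1) by blast
    let ?Q = "span (insert z Q)"
    have sub: "?Q \<subseteq> P" using z(1) QP P(1) by (intro span_minimal) auto
    have gens: "x * y - y * x \<in> ?Q" if "x \<in> insert z Q" "y \<in> insert z Q" for x y
    proof -
      have "x * y - y * x \<in> Q"
        using that z(3) cQ subspace_neg[OF sQ z(3)] subspace_0[OF sQ] by auto
      then show ?thesis by (simp add: span_base)
    qed
    have "good ?Q" unfolding good_def
      using sub commutator_span[OF gens subspace_span] nilpotent_words_span_insert[OF sQ n z(3) m]
      by blast
    then have "dim ?Q \<le> dim Q" by (rule max)
    moreover have "Q \<subset> ?Q" using z(2) span_superset[of "insert z Q"] by auto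
    then have "dim Q < dim ?Q"
      by (intro dim_less_fd sQ fin_dim_subset[OF P(2) sub]) simp_all
    ultimately show False by simp
  qed
  then show ?thesis using n by blast
qed

text \<open>Substituting \<open>P \<subseteq> [P, P]\<close> again and again writes every element of
  \<open>P\<close> as a combination of arbitrarily long words.\<close>

lemma perfect_nilpotent_words_eq_0:
  assumes P: "P \<subseteq> comm_span scale P P" "subspace P" and n: "nilpotent_words n P"
  shows "P = {0}"
proof -
  let ?W = "\<lambda>k. {prod_list xs |xs. length xs = k \<and> set xs \<subseteq> P}"
  have "P \<subseteq> span (?W (Suc k))" for k
  proof (induction k)
    case 0
    have "P \<subseteq> ?W 1" by (auto intro!: exI[of _ "[_]"])
    then show ?case using span_superset by fastforce
  next
    case (Suc k)
    have l: "x * y \<in> span (?W (Suc (Suc k)))" if "x \<in> P" "y \<in> P" for x y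
    proof -
      have "x * w \<in> span (?W (Suc (Suc k)))" if "w \<in> ?W (Suc k)" for w
      proof -
        from that obtain xs where "w = prod_list xs" "length xs = Suc k" "set xs \<subseteq> P" by blast
        then have "x * w \<in> ?W (Suc (Suc k))" using \<open>x \<in> P\<close> by (auto intro!: exI[of _ "x # xs"])
        then show ?thesis by (rule span_base)
      qed
      from mult_left_span[OF this subspace_span] show ?thesis using Suc that by blast
    qed
    have "comm_span scale P P \<subseteq> span (?W (Suc (Suc k)))"
      by (rule comm_span_subset[OF span_diff[OF l l]]) auto
    with P show ?case by blast
  qed
  moreover have "?W (Suc n) \<subseteq> {0}" using nilpotent_words_mono[OF n] by auto
  ultimately have "P \<subseteq> {0}" using span_mono[of "?W (Suc n)" "{0}"] by fastforce
  then show ?thesis using subspace_0[OF P(2)] by auto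
qed

end

section \<open>Block triangular bases\<close>

context k_algebra
begin

context
  fixes T :: "'b \<Rightarrow> 'b"
  assumes T_add: "\<And>x y. T (x + y) = T x + T y"
    and T_scale: "\<And>c x. T (scale c x) = scale c (T x)"
begin

lemma T_0 [simp]: "T 0 = 0"
  using T_scale[of 0 0] by simp

lemma T_diff: "T (x - y) = T x - T y"
  using T_add[of "x - y" y] by simp

lemma T_sum: "T (sum f A) = (\<Sum>x\<in>A. T (f x))"
  by (induction A rule: infinite_finite_induct) (simp_all add: T_add)

lemma linear_image_span:
  assumes "\<And>x. x \<in> S \<Longrightarrow> T x \<in> U" "subspace U" "x \<in> span S"
  shows "T x \<in> U"
  using assms(3)
proof (induction rule: span_induct_alt)
  case base then show ?case using assms(2) by (simp add: subspace_0)
next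
  case (step c x y)
  then show ?case using assms(1,2)
    by (simp add: T_add T_scale subspace_add subspace_scale)
qed

text \<open>Modulo earlier vectors of its block, \<open>T - c\<close> multiplies \<open>v i\<close>
  by \<open>l i - c\<close>, which is nonzero; so \<open>v i\<close> lies in the image of
  \<open>T - c\<close> by induction within the block.\<close>

lemma eigenvalue_block_span:
  fixes i m :: nat
  assumes i: "i < m" and T: "\<And>i. i < m \<Longrightarrow> T (v i) - scale (l i) (v i) \<in> span (v ` {j. j < i \<and> l j = l
      i})"
    and c: "l i \<noteq> c"
  shows "\<exists>w\<in>span (v ` {..<m}). v i = T w - scale c w"
  using i c
proof (induction i rule: less_induct)
  case (less i)
  let ?R = "{T w - scale c w |w. w \<in> span (v ` {..<m})}"
  have R: "subspace ?R"
    unfolding subspace_def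
  proof (intro conjI ballI allI)
    show "0 \<in> ?R" using span_zero T_0 by force
  next
    fix x y assume "x \<in> ?R" "y \<in> ?R"
    then obtain a b where "x = T a - scale c a" "y = T b - scale c b"
      "a \<in> span (v ` {..<m})" "b \<in> span (v ` {..<m})" by blast
    then show "x + y \<in> ?R"
      by (intro CollectI exI[of _ "a + b"]) (auto simp: T_add scale_right_distrib span_add)
  next
    fix d x assume "x \<in> ?R"
    then obtain a where "x = T a - scale c a" "a \<in> span (v ` {..<m})" by blast
    then show "scale d x \<in> ?R"
      by (intro CollectI exI[of _ "scale d a"])
        (auto simp: T_scale scale_right_diff_distrib span_scale scale_left_commute)
  qed
  define r where "r = T (v i) - scale (l i) (v i)"
  have "v ` {j. j < i \<and> l j = l i} \<subseteq> ?R" using less by force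
  then have "r \<in> ?R" using T[OF less.prems(1)] span_minimal[OF _ R] unfolding r_def by blast
  moreover have "T (v i) - scale c (v i) \<in> ?R" using less.prems by (auto intro: span_base)
  ultimately have "(T (v i) - scale c (v i)) - r \<in> ?R" by (rule subspace_diff[OF R, rotated])
  then have "scale (l i - c) (v i) \<in> ?R" unfolding r_def by (simp add: scale_left_diff_distrib)
  from subspace_scale[OF R this, of "inverse (l i - c)"] have "v i \<in> ?R"
    using less.prems(2) unfolding scale_scale by simp
  then show ?case by auto
qed

text \<open>
  A basis is extended by an eigenvector modulo its span; the components of the error in the other
  generalised eigenspaces are removed because the operator minus its new eigenvalue is onto there.
\<close>

lemma block_triangular_basis:
  assumes V: "fin_dim V" "subspace V" "T ` V \<subseteq> V"
    and ev: "\<And>W. subspace W \<Longrightarrow> W \<subset> V \<Longrightarrow> T ` W \<subseteq> W \<Longrightarrow> \<exists>v\<in>V - W. \<exists>c\<in>L. T v - scale c v \<in> W"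
  obtains m :: nat and v l where "span (v ` {..<m}) = V" "independent (v ` {..<m})" "inj_on v
      {..<m}"
    "l ` {..<m} \<subseteq> L" "\<And>i. i < m \<Longrightarrow> T (v i) - scale (l i) (v i) \<in> span (v ` {j. j < i \<and> l j = l i})"
proof -
  \<comment> \<open>A candidate is a basis of a part of \<open>V\<close> in triangular form; its
    length is bounded by \<open>dim V\<close>, and one of greatest length will be shown to span
    \<open>V\<close>.\<close>
  define good where "good = (\<lambda>(m :: nat, v, l). v ` {..<m} \<subseteq> V \<and> independent (v ` {..<m}) \<and> inj_on v
      {..<m} \<and>
    l ` {..<m} \<subseteq> L \<and> (\<forall>i<m. T (v i) - scale (l i) (v i) \<in> span (v ` {j. j < i \<and> l j = l i})))"
  have "good (0, \<lambda>_. 0, \<lambda>_. 0)" by (simp add: good_def independent_empty)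
  moreover have "fst p < Suc (dim V)" if "good p" for p
  proof -
    obtain m v l where pm: "p = (m, v, l)" by (cases p) auto
    then have g: "good (m, v, l)" using that by simp
    then have "card (v ` {..<m}) \<le> dim V" unfolding good_def
      by (intro independent_card_le_dim_fd(2)[OF V(1,2)]) auto
    then show ?thesis using g unfolding pm good_def by (simp add: card_image)
  qed
  ultimately obtain p where p: "good p" "\<And>q. good q \<Longrightarrow> fst q \<le> fst p"
    using ex_has_greatest_nat[of good "(0, \<lambda>_. 0, \<lambda>_. 0)" fst "Suc (dim V)"] by blast
  obtain m v l where pm: "p = (m, v, l)" by (cases p) auto
  have g: "v ` {..<m} \<subseteq> V" "independent (v ` {..<m})" "inj_on v {..<m}" "l ` {..<m} \<subseteq> L"
    and tri: "\<And>i. i < m \<Longrightarrow> T (v i) - scale (l i) (v i) \<in> span (v ` {j. j < i \<and> l j = l i})"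
    using p(1) unfolding pm good_def by auto
  let ?W = "span (v ` {..<m})"
  have WV: "?W \<subseteq> V" using g(1) V(2) by (rule span_minimal)
  have TW: "T x \<in> ?W" if "x \<in> ?W" for x
  proof (rule linear_image_span[OF _ subspace_span that])
    fix x assume "x \<in> v ` {..<m}"
    then obtain i where i: "i < m" "x = v i" by auto
    have "v ` {j. j < i \<and> l j = l i} \<subseteq> v ` {..<m}" using i by auto
    from span_mono[OF this] tri[OF i(1)] have "T x - scale (l i) x \<in> ?W" using i by auto
    moreover have "scale (l i) x \<in> ?W" using i by (intro span_scale span_base) auto
    ultimately have "T x - scale (l i) x + scale (l i) x \<in> ?W" by (rule span_add)
    then show "T x \<in> ?W" by simp
  qed
  have "?W = V"
  proof (rule ccontr)
    assume "?W \<noteq> V"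
    then obtain u c where u: "u \<in> V" "u \<notin> ?W" "c \<in> L" "T u - scale c u \<in> ?W"
      using ev[of ?W] WV TW by (auto simp: psubset_eq)
    \<comment> \<open>\<open>?R\<close> is the image of \<open>T - c\<close> on \<open>?W\<close>
      plus the block of \<open>c\<close>. It contains every \<open>v i\<close>: those in the block
      of \<open>c\<close> directly, the others because \<open>T - c\<close> is onto on their blocks.
      The error \<open>T u - c u\<close> therefore becomes an element of the block of
      \<open>c\<close> once \<open>u\<close> is replaced by \<open>u - w\<close>.\<close>
    let ?R = "{T w - scale c w + b |w b. w \<in> ?W \<and> b \<in> span (v ` {j. j < m \<and> l j = c})}"
    have R: "subspace ?R"
      unfolding subspace_def
    proof (intro conjI ballI allI)
      show "0 \<in> ?R" using span_zero T_0 by force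
    next
      fix x y assume "x \<in> ?R" "y \<in> ?R"
      then obtain a b a' b' where "x = T a - scale c a + b" "y = T a' - scale c a' + b'"
        "a \<in> ?W" "a' \<in> ?W" "b \<in> span (v ` {j. j < m \<and> l j = c})" "b' \<in> span (v ` {j. j < m \<and> l j =
            c})"
        by blast
      then show "x + y \<in> ?R"
        by (intro CollectI exI[of _ "a + a'"] exI[of _ "b + b'"]) (auto simp: T_add
            scale_right_distrib span_add)
    next
      fix d x assume "x \<in> ?R"
      then obtain a b where "x = T a - scale c a + b" "a \<in> ?W" "b \<in> span (v ` {j. j < m \<and> l j = c})"
          by blast
      then show "scale d x \<in> ?R"
        by (intro CollectI exI[of _ "scale d a"] exI[of _ "scale d b"])
          (auto simp: T_scale scale_right_diff_distrib scale_right_distrib span_scale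
              scale_left_commute)
    qed
    have "v ` {..<m} \<subseteq> ?R"
    proof (rule image_subsetI)
      fix i assume i: "i \<in> {..<m}"
      show "v i \<in> ?R"
      proof (cases "l i = c")
        case True
        then have "v i \<in> span (v ` {j. j < m \<and> l j = c})" using i by (intro span_base) auto
        then show ?thesis by (intro CollectI exI[of _ 0] exI[of _ "v i"]) (auto simp: span_zero)
      next
        case False
        then obtain w where "w \<in> ?W" "v i = T w - scale c w"
          using eigenvalue_block_span[of i m v l c] tri i by auto
        then show ?thesis by (intro CollectI exI[of _ w] exI[of _ 0]) (auto simp: span_zero)
      qed
    qed
    then have "?W \<subseteq> ?R" by (rule span_minimal[OF _ R])
    then obtain w b where wb: "T u - scale c u = T w - scale c w + b" "w \<in> ?W"
      "b \<in> span (v ` {j. j < m \<and> l j = c})" using u(4) by blast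
    let ?v = "v(m := u - w)" and ?l = "l(m := c)"
    have nW: "u - w \<notin> ?W" using u(2) wb(2) span_add[of "u - w" "v ` {..<m}" w] by auto
    have im: "?v ` {..<m} = v ` {..<m}" by auto
    have imS: "?v ` {..<Suc m} = insert (u - w) (v ` {..<m})" unfolding lessThan_Suc using im by
        auto
    have "good (Suc m, ?v, ?l)" unfolding good_def prod.case
    proof (intro conjI allI impI)
      show "?v ` {..<Suc m} \<subseteq> V" unfolding imS using g(1) u(1) wb(2) WV V(2) subspace_diff by blast
      show "independent (?v ` {..<Suc m})" unfolding imS using nW g(2) by (rule independent_insertI)
      have "u - w \<notin> v ` {..<m}" using nW by (rule contra_subsetD[OF span_superset])
      then have "\<And>i. i < m \<Longrightarrow> v i \<noteq> u - w" by force
      then show "inj_on ?v {..<Suc m}" unfolding lessThan_Suc using g(3)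
        by (auto simp: inj_on_def eq_commute[of "u - w"])
      show "?l ` {..<Suc m} \<subseteq> L" using g(4) u(3) by (auto simp: less_Suc_eq)
    next
      fix i assume "i < Suc m"
      then consider "i < m" | "i = m" by linarith
      then show "T (?v i) - scale (?l i) (?v i) \<in> span (?v ` {j. j < i \<and> ?l j = ?l i})"
      proof cases
        case 1
        then have "?v ` {j. j < i \<and> ?l j = ?l i} = v ` {j. j < i \<and> l j = l i}" by (auto simp:
            image_iff)
        then show ?thesis using tri[OF 1] 1 by simp
      next
        case 2
        have "T u = T (u - w) + T w" using T_add[of "u - w" w] by simp
        then have "T (u - w) - scale c (u - w) = b" using wb(1) by (simp add:
            scale_right_diff_distrib algebra_simps)
        moreover have "?v ` {j. j < i \<and> ?l j = ?l i} = v ` {j. j < m \<and> l j = c}" using 2 by (auto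
            simp: image_iff)
        ultimately show ?thesis using 2 wb(3) by simp
      qed
    qed
    from p(2)[OF this] show False unfolding pm by simp
  qed
  then show ?thesis using that[OF _ g(2,3,4) tri] by blast
qed

lemma eventually_dependent:
  fixes f :: "nat \<Rightarrow> 'b"
  assumes "fin_dim V" "subspace V" "range f \<subseteq> V"
  shows "\<exists>n. f n \<in> span (f ` {..<n})"
proof (rule ccontr)
  assume neg: "\<not> ?thesis"
  have "independent (f ` {..<n}) \<and> card (f ` {..<n}) = n" for n
  proof (induction n)
    case (Suc n)
    have "f n \<notin> span (f ` {..<n})" using neg by blast
    then have "f n \<notin> f ` {..<n}" by (rule contra_subsetD[OF span_superset])
    moreover have "independent (insert (f n) (f ` {..<n}))"
      using Suc neg by (intro independent_insertI) auto
    ultimately show ?case using Suc unfolding lessThan_Suc image_insert by simp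
  qed (simp add: independent_empty)
  note ind = this[of "Suc (dim V)"]
  have "f ` {..<Suc (dim V)} \<subseteq> V" using assms(3) by auto
  from independent_card_le_dim_fd(2)[OF assms(1,2) this] ind show False by simp
qed

text \<open>This is \<open>p(T) u\<close>.\<close>

definition poly_apply :: "'k poly \<Rightarrow> 'b \<Rightarrow> 'b" where
  "poly_apply p u = (\<Sum>i\<le>degree p. scale (coeff p i) ((T ^^ i) u))"

lemma poly_apply_eq: "degree p \<le> n \<Longrightarrow> poly_apply p u = (\<Sum>i\<le>n. scale (coeff p i) ((T ^^ i) u))"
  unfolding poly_apply_def by (rule sum.mono_neutral_left) (auto simp: coeff_eq_0)

lemma poly_apply_linear_factor:
  "poly_apply ([:-c, 1:] * q) u = T (poly_apply q u) - scale c (poly_apply q u)"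
proof -
  let ?n = "degree q"
  have deg: "degree ([:-c, 1:] * q) \<le> Suc ?n"
    using degree_mult_le[of "[:-c, 1:]" q] by simp
  have co: "coeff ([:-c, 1:] * q) i = (case i of 0 \<Rightarrow> 0 | Suc j \<Rightarrow> coeff q j) - c * coeff q i" for i
    by (simp add: coeff_pCons)
  have "poly_apply ([:-c, 1:] * q) u =
    (\<Sum>i\<le>Suc ?n. scale (case i of 0 \<Rightarrow> 0 | Suc j \<Rightarrow> coeff q j) ((T ^^ i) u)) -
    (\<Sum>i\<le>Suc ?n. scale (c * coeff q i) ((T ^^ i) u))"
    unfolding poly_apply_eq[OF deg] co scale_left_diff_distrib sum_subtractf ..
  also have "(\<Sum>i\<le>Suc ?n. scale (c * coeff q i) ((T ^^ i) u)) = scale c (poly_apply q u)"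
    unfolding poly_apply_eq[of q "Suc ?n" u, simplified] by (simp add: scale_sum_right
        scale_right_distrib)
  also have "(\<Sum>i\<le>Suc ?n. scale (case i of 0 \<Rightarrow> 0 | Suc j \<Rightarrow> coeff q j) ((T ^^ i) u)) = T (poly_apply q
      u)"
    unfolding poly_apply_def sum.atMost_Suc_shift by (simp add: T_sum T_scale)
  finally show ?thesis .
qed

text \<open>Let \<open>p\<close> be a nonzero polynomial of least degree with
  \<open>p(T) u \<in> W\<close>, where \<open>u\<close> is outside \<open>W\<close>. If
  \<open>c\<close> is a root and \<open>p = (X - c) q\<close>, then \<open>q(T) u\<close> is outside
  \<open>W\<close> by minimality and is an eigenvector modulo \<open>W\<close>.\<close>

lemma eigenvector_modulo:
  fixes W :: "'b set"
  assumes root: "\<And>p :: 'k poly. degree p > 0 \<Longrightarrow> \<exists>z. poly p z = 0"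
    and V: "fin_dim V" "subspace V" "T ` V \<subseteq> V" and W: "subspace W" "W \<subset> V"
  shows "\<exists>v\<in>V - W. \<exists>c. T v - scale c v \<in> W"
proof -
  obtain u where u: "u \<in> V" "u \<notin> W" using W(2) by auto
  have TV: "(T ^^ i) u \<in> V" for i by (induction i) (use u V(3) in auto)
  obtain n where n: "(T ^^ n) u \<in> span ((\<lambda>i. (T ^^ i) u) ` {..<n})"
    using eventually_dependent[OF V(1,2), of "\<lambda>i. (T ^^ i) u"] TV by auto
  have "\<exists>q. (\<forall>i\<ge>n. coeff q i = 0) \<and> x = poly_apply q u" if "x \<in> span ((\<lambda>i. (T ^^ i) u) ` {..<n})"
      for x
    using that
  proof (induction rule: span_induct_alt)
    case base
    show ?case by (rule exI[of _ 0]) (simp add: poly_apply_def)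
  next
    case (step c x y)
    then obtain i q where q: "i < n" "x = (T ^^ i) u" "\<forall>i\<ge>n. coeff q i = 0" "y = poly_apply q u" by
        auto
    let ?p = "monom c i + q" and ?N = "max i (degree q)"
    have "poly_apply ?p u = (\<Sum>j\<le>?N. scale (coeff ?p j) ((T ^^ j) u))"
      by (rule poly_apply_eq) (meson degree_add_le_max degree_monom_le max.mono order.trans
          order_refl)
    also have "\<dots> = (\<Sum>j\<le>?N. if i = j then scale c ((T ^^ j) u) else 0) + (\<Sum>j\<le>?N. scale (coeff q j)
        ((T ^^ j) u))"
      unfolding sum.distrib[symmetric] by (rule sum.cong) (auto simp: scale_left_distrib)
    also have "\<dots> = scale c x + y"
      using q poly_apply_eq[of q ?N u] by simp
    finally show ?case using q by (intro exI[of _ ?p]) auto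
  qed
  from this[OF n] obtain q where q: "\<forall>i\<ge>n. coeff q i = 0" "(T ^^ n) u = poly_apply q u" by blast
  \<comment> \<open>A linear dependence among the iterates of \<open>u\<close> gives a monic
    polynomial with \<open>p(T) u = 0\<close>, so there is a polynomial of least degree to
    choose.\<close>
  let ?p = "monom 1 n - q"
  have "coeff ?p n = 1" using q by simp
  then have nz: "?p \<noteq> 0" by (metis coeff_0 zero_neq_one)
  have deg: "degree q \<le> n" using q(1) by (intro degree_le) auto
  then have "degree ?p \<le> n" by (intro degree_diff_le) (auto intro: degree_monom_le)
  then have "poly_apply ?p u = (\<Sum>j\<le>n. scale (coeff ?p j) ((T ^^ j) u))" by (rule poly_apply_eq)
  also have "\<dots> = (\<Sum>j\<le>n. if n = j then (T ^^ j) u else 0) - (\<Sum>j\<le>n. scale (coeff q j) ((T ^^ j) u))"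
    unfolding sum_subtractf[symmetric] by (rule sum.cong) (auto simp: scale_left_diff_distrib)
  also have "\<dots> = 0" using q(2) poly_apply_eq[OF deg, of u] by simp
  finally have "?p \<noteq> 0 \<and> poly_apply ?p u \<in> W" using nz W(1) by (simp add: subspace_0)
  then obtain p where p: "p \<noteq> 0" "poly_apply p u \<in> W"
    and min: "\<And>q. q \<noteq> 0 \<Longrightarrow> poly_apply q u \<in> W \<Longrightarrow> degree p \<le> degree q"
    using ex_has_least_nat[of "\<lambda>p. p \<noteq> 0 \<and> poly_apply p u \<in> W" ?p degree] by blast
  have "degree p \<noteq> 0"
  proof
    assume "degree p = 0"
    then obtain a where a: "p = [:a:]" by (rule degree_eq_zeroE)
    then have a0: "a \<noteq> 0" using p(1) by simp
    have "scale a u \<in> W" using p(2) a by (simp add: poly_apply_def)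
    from subspace_scale[OF W(1) this, of "inverse a"] show False using u(2) a0 by simp
  qed
  then obtain c where "poly p c = 0" using root by blast
  then obtain q where pq: "p = [:-c, 1:] * q" by (metis poly_eq_0_iff_dvd dvdE)
  have q0: "q \<noteq> 0" using p(1) pq by auto
  have "degree p = Suc (degree q)" unfolding pq using q0 by (subst degree_mult_eq) auto
  then have "poly_apply q u \<notin> W" using min[of q] q0 by auto
  moreover have "poly_apply q u \<in> V" unfolding poly_apply_def
    using TV by (intro subspace_sum subspace_scale V(2)) auto
  ultimately show ?thesis using p(2) unfolding pq poly_apply_linear_factor by blast
qed

definition gen_eigenspace :: "'k \<Rightarrow> 'b set" where
  "gen_eigenspace c = {u. \<exists>N. ((\<lambda>u. T u - scale c u) ^^ N) u = 0}"

lemma shift_pow_0: "((\<lambda>u. T u - scale c u) ^^ N) 0 = 0"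
  by (induction N) simp_all

lemma shift_pow_Suc: "((\<lambda>u. T u - scale c u) ^^ Suc N) x = ((\<lambda>u. T u - scale c u) ^^ N) (T x - scale
    c x)"
  by (simp only: funpow_Suc_right comp_apply)

lemma shift_pow_add: "((\<lambda>u. T u - scale c u) ^^ N) (x + y) =
  ((\<lambda>u. T u - scale c u) ^^ N) x + ((\<lambda>u. T u - scale c u) ^^ N) y"
  by (induction N) (simp_all add: T_add scale_right_distrib)

lemma shift_pow_scale: "((\<lambda>u. T u - scale c u) ^^ N) (scale d x) =
  scale d (((\<lambda>u. T u - scale c u) ^^ N) x)"
  by (induction N) (simp_all add: T_scale scale_right_diff_distrib scale_left_commute)

lemma shift_pow_mono: 
  assumes "((\<lambda>u. T u - scale c u) ^^ N) x = 0" "N \<le> M"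
  shows "((\<lambda>u. T u - scale c u) ^^ M) x = 0"
proof -
  have "((\<lambda>u. T u - scale c u) ^^ M) x =
    ((\<lambda>u. T u - scale c u) ^^ (M - N)) (((\<lambda>u. T u - scale c u) ^^ N) x)"
    using assms(2) by (subst comp_apply[of "(\<lambda>u. T u - scale c u) ^^ (M - N)", symmetric], subst
        funpow_add[symmetric]) simp
  then show ?thesis by (simp add: assms(1) shift_pow_0)
qed

lemma subspace_gen_eigenspace: "subspace (gen_eigenspace c)"
  unfolding subspace_def
proof (intro conjI ballI allI)
  show "0 \<in> gen_eigenspace c" by (auto simp: gen_eigenspace_def shift_pow_0)
next
  fix x y assume "x \<in> gen_eigenspace c" "y \<in> gen_eigenspace c"
  then obtain N M where "((\<lambda>u. T u - scale c u) ^^ N) x = 0" "((\<lambda>u. T u - scale c u) ^^ M) y = 0"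
    by (auto simp: gen_eigenspace_def)
  then have "((\<lambda>u. T u - scale c u) ^^ (max N M)) (x + y) = 0"
    unfolding shift_pow_add by (simp add: shift_pow_mono[of N c x "max N M"] shift_pow_mono[of M c y
        "max N M"])
  then show "x + y \<in> gen_eigenspace c" unfolding gen_eigenspace_def by blast
next
  fix d x assume "x \<in> gen_eigenspace c"
  then show "scale d x \<in> gen_eigenspace c" by (auto simp: gen_eigenspace_def shift_pow_scale)
qed

lemma gen_eigenspaceI:
  assumes "T u - scale c u \<in> gen_eigenspace c"
  shows "u \<in> gen_eigenspace c"
proof -
  obtain N where "((\<lambda>u. T u - scale c u) ^^ N) (T u - scale c u) = 0"
    using assms by (auto simp: gen_eigenspace_def)
  then have "((\<lambda>u. T u - scale c u) ^^ Suc N) u = 0" unfolding shift_pow_Suc .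
  then show ?thesis unfolding gen_eigenspace_def by blast
qed

text \<open>Modulo \<open>W\<close> the vector \<open>v\<close> is a \<open>c\<close>-eigenvector,
  so \<open>(T - d)^M\<close> multiplies it by \<open>(c - d)^M\<close>, which is nonzero.\<close>

lemma gen_eigenspace_cancel:
  assumes W: "subspace W" "\<And>w. w \<in> W \<Longrightarrow> T w \<in> W"
    and cd: "c \<noteq> d" and v: "((\<lambda>u. T u - scale d u) ^^ M) v = 0" "T v - scale c v \<in> W"
  shows "v \<in> W"
  using v
proof (induction M arbitrary: v)
  case 0
  then show ?case using W(1) by (simp add: subspace_0)
next
  case (Suc M)
  let ?v = "T v - scale d v"
  have "T (T v - scale c v) - scale d (T v - scale c v) \<in> W"
    by (rule subspace_diff[OF W(1) W(2)[OF Suc.prems(2)] subspace_scale[OF W(1) Suc.prems(2)]])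
  also have "T (T v - scale c v) - scale d (T v - scale c v) = T ?v - scale c ?v"
    by (simp add: T_diff T_scale scale_right_diff_distrib mult.commute)
  finally have "?v \<in> W" by (rule Suc.IH[OF Suc.prems(1)[unfolded shift_pow_Suc]])
  then have "?v - (T v - scale c v) \<in> W" using Suc.prems(2) by (rule subspace_diff[OF W(1)])
  then have "scale (c - d) v \<in> W" by (simp add: scale_left_diff_distrib)
  from subspace_scale[OF W(1) this, of "inverse (c - d)"] show ?case
    using cd unfolding scale_scale by simp
qed

text \<open>A power of \<open>T - d\<close> removes the component \<open>u d\<close> from the sum.
  The induction hypothesis puts the images of the other components into \<open>W\<close>, and from
  there the components themselves are recovered, since \<open>T - d\<close> is injective modulo
  \<open>W\<close> on generalised eigenspaces of other eigenvalues.\<close>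

lemma gen_eigenspace_components:
  assumes W: "subspace W" "\<And>w. w \<in> W \<Longrightarrow> T w \<in> W"
    and "finite D" "\<And>c. c \<in> D \<Longrightarrow> u c \<in> gen_eigenspace c" "(\<Sum>c\<in>D. u c) \<in> W" "c \<in> D"
  shows "u c \<in> W"
  using assms(3-6)
proof (induction D arbitrary: u c rule: finite_induct)
  case (insert d D)
  obtain N where N: "((\<lambda>u. T u - scale d u) ^^ N) (u d) = 0"
    using insert.prems(1)[of d] by (auto simp: gen_eigenspace_def)
  let ?S = "((\<lambda>u. T u - scale d u) ^^ N)"
  have SW: "?S w \<in> W" if "w \<in> W" for w using that
    by (induction N) (simp_all add: W subspace_diff[OF W(1)] subspace_scale[OF W(1)])
  have Ssum: "?S (\<Sum>c\<in>D. u c) = (\<Sum>c\<in>D. ?S (u c))" for D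
    by (induction D rule: infinite_finite_induct) (auto simp: shift_pow_0 shift_pow_add)
  have "?S (u d + (\<Sum>c\<in>D. u c)) \<in> W" using insert.prems(2) insert.hyps by (intro SW) simp
  then have sum: "(\<Sum>c\<in>D. ?S (u c)) \<in> W" unfolding shift_pow_add N Ssum by simp
  have step: "T x - scale d x \<in> gen_eigenspace c" if x: "x \<in> gen_eigenspace c" for x c
  proof -
    obtain M where M: "((\<lambda>u. T u - scale c u) ^^ M) x = 0" using x by (auto simp:
        gen_eigenspace_def)
    have "T (((\<lambda>u. T u - scale c u) ^^ M) x) = ((\<lambda>u. T u - scale c u) ^^ M) (T x)" for M
    proof (induction M)
      case (Suc M)
      let ?y = "((\<lambda>u. T u - scale c u) ^^ M) x"
      have "T (T ?y - scale c ?y) = T (T ?y) - scale c (T ?y)"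
        using T_add[of "T ?y - scale c ?y" "scale c ?y"] by (simp add: T_scale)
      then show ?case using Suc by simp
    qed simp
    then have "((\<lambda>u. T u - scale c u) ^^ M) (T x) = 0" using M by (metis T_0)
    then have "T x \<in> gen_eigenspace c" by (auto simp: gen_eigenspace_def)
    from subspace_diff[OF subspace_gen_eigenspace this subspace_scale[OF subspace_gen_eigenspace x]]
    show ?thesis .
  qed
  have stab: "?S x \<in> gen_eigenspace c" if "x \<in> gen_eigenspace c" for x c
    using that by (induction N) (auto intro: step)
  have mem: "?S (u c) \<in> W" if "c \<in> D" for c
    using insert.IH[of "\<lambda>c. ?S (u c)" c] insert.prems(1) sum that stab by auto
  \<comment> \<open>The factors \<open>T - d\<close> are cancelled one at a time with
    \<open>gen_eigenspace_cancel\<close>, in which the two eigenvalues exchange their roles.\<close>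
  have descend: "x \<in> W" if "x \<in> gen_eigenspace c" "c \<noteq> d" "((\<lambda>u. T u - scale d u) ^^ N) x \<in> W" for x
      c N
    using that
  proof (induction N arbitrary: x)
    case (Suc N)
    have "T x - scale d x \<in> W"
      by (rule Suc.IH[OF step[OF Suc.prems(1)] Suc.prems(2) Suc.prems(3)[unfolded shift_pow_Suc]])
    moreover obtain M where "((\<lambda>u. T u - scale c u) ^^ M) x = 0"
      using Suc.prems(1) by (auto simp: gen_eigenspace_def)
    ultimately show ?case using gen_eigenspace_cancel[OF W, of d c M x] Suc.prems(2) by auto
  qed simp
  have D: "u c \<in> W" if "c \<in> D" for c
    using descend[OF insert.prems(1) _ mem[OF that]] that insert.hyps(2) by auto
  then have "(\<Sum>c\<in>D. u c) \<in> W" by (intro subspace_sum W(1))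
  then have "u d + (\<Sum>c\<in>D. u c) - (\<Sum>c\<in>D. u c) \<in> W"
    using insert.prems(2) insert.hyps by (intro subspace_diff[OF W(1)]) simp_all
  then show ?case using D insert.prems(3) by auto
qed simp

end

end

section \<open>Matrices\<close>

text \<open>
  Matrices of all sizes live in one unital ring, so that dimensions need not be types; an
  \<open>n \<times> n\<close> matrix is one supported in the first \<open>n\<close> rows and columns, so the
  unit of the ring is not in \<open>square_mats n\<close>.
\<close>

typedef (overloaded) 'k cfmat = "{f :: nat \<Rightarrow> nat \<Rightarrow> 'k::zero. \<forall>j. finite {i. f i j \<noteq> 0}}"
  morphisms entry Cfmat
  by (rule exI[of _ "\<lambda>_ _. 0"]) simp

setup_lifting type_definition_cfmat

lemma finite_entry: "finite {i. entry x i j \<noteq> 0}"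
  using entry[of x] by simp

lemma cfmat_eqI: "(\<And>i j. entry x i j = entry y i j) \<Longrightarrow> x = y"
  by (subst entry_inject[symmetric]) blast

instantiation cfmat :: (field) ring_1
begin

lift_definition zero_cfmat :: "'a cfmat" is "\<lambda>_ _. 0" by simp

lift_definition one_cfmat :: "'a cfmat" is "\<lambda>i j. if i = j then 1 else 0" by simp

lift_definition plus_cfmat :: "'a cfmat \<Rightarrow> 'a cfmat \<Rightarrow> 'a cfmat" is "\<lambda>f g i j. f i j + g i j"
proof -
  fix f g :: "nat \<Rightarrow> nat \<Rightarrow> 'a" and j
  assume "\<And>j. finite {i. f i j \<noteq> 0}" "\<And>j. finite {i. g i j \<noteq> 0}"
  then have "finite ({i. f i j \<noteq> 0} \<union> {i. g i j \<noteq> 0})" by simp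
  then show "finite {i. f i j + g i j \<noteq> 0}" by (rule rev_finite_subset) auto
qed

lift_definition uminus_cfmat :: "'a cfmat \<Rightarrow> 'a cfmat" is "\<lambda>f i j. - f i j" by simp

definition minus_cfmat :: "'a cfmat \<Rightarrow> 'a cfmat \<Rightarrow> 'a cfmat" where "minus_cfmat x y = x + - y"

text \<open>Finiteness of the columns makes the product meaningful: the sum runs over the support of
  column \<open>j\<close> of the right factor.\<close>

lift_definition times_cfmat :: "'a cfmat \<Rightarrow> 'a cfmat \<Rightarrow> 'a cfmat"
  is "\<lambda>f g i j. \<Sum>k | g k j \<noteq> 0. f i k * g k j"
proof -
  fix f g :: "nat \<Rightarrow> nat \<Rightarrow> 'a" and j
  assume f: "\<And>j. finite {i. f i j \<noteq> 0}" and g: "\<And>j. finite {i. g i j \<noteq> 0}"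
  have "finite (\<Union>k\<in>{k. g k j \<noteq> 0}. {i. f i k \<noteq> 0})" using f g by blast
  moreover have "{i. (\<Sum>k | g k j \<noteq> 0. f i k * g k j) \<noteq> 0} \<subseteq> (\<Union>k\<in>{k. g k j \<noteq> 0}. {i. f i k \<noteq> 0})"
  proof (rule subsetI, drule CollectD)
    fix i assume "(\<Sum>k | g k j \<noteq> 0. f i k * g k j) \<noteq> 0"
    then obtain k where "k \<in> {k. g k j \<noteq> 0}" "f i k * g k j \<noteq> 0"
      by (rule sum.not_neutral_contains_not_neutral)
    then show "i \<in> (\<Union>k\<in>{k. g k j \<noteq> 0}. {i. f i k \<noteq> 0})" by auto
  qed
  ultimately show "finite {i. (\<Sum>k | g k j \<noteq> 0. f i k * g k j) \<noteq> 0}" by (rule rev_finite_subset)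
qed

lemma entry_mult_eq:
  fixes x y :: "'a cfmat"
  assumes "finite S" "\<And>k. k \<notin> S \<Longrightarrow> entry x i k * entry y k j = 0"
  shows "entry (x * y) i j = (\<Sum>k\<in>S. entry x i k * entry y k j)"
proof -
  have "entry (x * y) i j = (\<Sum>k | entry y k j \<noteq> 0. entry x i k * entry y k j)"
    by transfer simp
  also have "\<dots> = (\<Sum>k\<in>{k. entry y k j \<noteq> 0} \<inter> S. entry x i k * entry y k j)"
    by (rule sum.mono_neutral_right) (use assms finite_entry in auto)
  also have "\<dots> = (\<Sum>k\<in>S. entry x i k * entry y k j)"
    by (rule sum.mono_neutral_left) (use assms in auto)
  finally show ?thesis .
qed

lemma entry_simps [simp]: 
  "entry (0 :: 'a cfmat) i j = 0" "entry (1 :: 'a cfmat) i j = (if i = j then 1 else 0)"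
  "entry (x + y :: 'a cfmat) i j = entry x i j + entry y i j"
  "entry (- x :: 'a cfmat) i j = - entry x i j"
  by (transfer, simp)+

lemma entry_diff [simp]: "entry (x - y :: 'a cfmat) i j = entry x i j - entry y i j"
  by (simp add: minus_cfmat_def)

instance
proof
  fix x y z :: "'a cfmat"
  show "x + y + z = x + (y + z)" "x + y = y + x" "0 + x = x" "- x + x = 0" "x - y = x + - y"
    by (auto intro!: cfmat_eqI)
  have "entry (0 :: 'a cfmat) 0 0 \<noteq> entry (1 :: 'a cfmat) 0 0" by simp
  then show "(0 :: 'a cfmat) \<noteq> 1" by metis
  show "1 * x = x"
  proof (rule cfmat_eqI)
    fix i j
    have "entry (1 * x) i j = (\<Sum>k\<in>{i}. entry 1 i k * entry x k j)" by (rule entry_mult_eq) auto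
    then show "entry (1 * x) i j = entry x i j" by simp
  qed
  show "x * 1 = x"
  proof (rule cfmat_eqI)
    fix i j
    have "entry (x * 1) i j = (\<Sum>k\<in>{j}. entry x i k * entry 1 k j)" by (rule entry_mult_eq) auto
    then show "entry (x * 1) i j = entry x i j" by simp
  qed
  show "(x + y) * z = x * z + y * z"
  proof (rule cfmat_eqI)
    fix i j
    let ?S = "{k. entry z k j \<noteq> 0}"
    have "entry (u * z) i j = (\<Sum>k\<in>?S. entry u i k * entry z k j)" for u
      by (rule entry_mult_eq) (auto simp: finite_entry)
    then show "entry ((x + y) * z) i j = entry (x * z + y * z) i j"
      by (simp add: distrib_right sum.distrib)
  qed
  show "x * (y + z) = x * y + x * z"
  proof (rule cfmat_eqI)
    fix i j
    let ?S = "{k. entry y k j \<noteq> 0} \<union> {k. entry z k j \<noteq> 0}"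
    have "entry (x * u) i j = (\<Sum>k\<in>?S. entry x i k * entry u k j)"
      if "\<And>k. k \<notin> ?S \<Longrightarrow> entry u k j = 0" for u
      by (rule entry_mult_eq) (auto simp: finite_entry that)
    then show "entry (x * (y + z)) i j = entry (x * y + x * z) i j"
      by (simp add: distrib_left sum.distrib)
  qed
  show "x * y * z = x * (y * z)"
  proof (rule cfmat_eqI)
    fix i j
    let ?S = "{k. entry z k j \<noteq> 0}"
    let ?T = "\<Union>k\<in>?S. {l. entry y l k \<noteq> 0}"
    have fin: "finite ?S" "finite ?T" by (auto simp: finite_entry)
    have yz: "entry (y * z) l j = (\<Sum>k\<in>?S. entry y l k * entry z k j)" for l
      by (rule entry_mult_eq) (auto simp: finite_entry)
    have "entry (x * y * z) i j = (\<Sum>k\<in>?S. entry (x * y) i k * entry z k j)"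
      by (rule entry_mult_eq) (auto simp: finite_entry)
    also have "\<dots> = (\<Sum>k\<in>?S. (\<Sum>l\<in>?T. entry x i l * entry y l k) * entry z k j)"
    proof (rule sum.cong[OF refl])
      fix k assume "k \<in> ?S"
      then have "entry (x * y) i k = (\<Sum>l\<in>?T. entry x i l * entry y l k)"
        by (intro entry_mult_eq fin(2)) auto
      then show "entry (x * y) i k * entry z k j = (\<Sum>l\<in>?T. entry x i l * entry y l k) * entry z k j"
        by simp
    qed
    also have "\<dots> = (\<Sum>l\<in>?T. \<Sum>k\<in>?S. entry x i l * entry y l k * entry z k j)"
      by (subst sum.swap) (simp add: sum_distrib_right)
    also have "\<dots> = (\<Sum>l\<in>?T. entry x i l * entry (y * z) l j)"
      unfolding yz by (simp add: sum_distrib_left mult.assoc)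
    also have "\<dots> = entry (x * (y * z)) i j"
    proof (rule entry_mult_eq[symmetric, OF fin(2)])
      fix l assume "l \<notin> ?T"
      then have "entry (y * z) l j = 0" unfolding yz by (intro sum.neutral) auto
      then show "entry x i l * entry (y * z) l j = 0" by simp
    qed
    finally show "entry (x * y * z) i j = entry (x * (y * z)) i j" .
  qed
qed

end

lemma entry_sum: "entry (sum f A :: 'k::field cfmat) i j = (\<Sum>a\<in>A. entry (f a) i j)"
  by (induction A rule: infinite_finite_induct) simp_all

lift_definition mat_scale :: "'k::field \<Rightarrow> 'k cfmat \<Rightarrow> 'k cfmat" is "\<lambda>c f i j. c * f i j"
proof -
  fix c and f :: "nat \<Rightarrow> nat \<Rightarrow> 'k" and j
  assume "\<And>j. finite {i. f i j \<noteq> 0}"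
  then show "finite {i. c * f i j \<noteq> 0}" by (rule rev_finite_subset) auto
qed

lemma entry_scale [simp]: "entry (mat_scale c x) i j = c * entry x i j"
  by transfer simp

interpretation mat: unital_k_algebra mat_scale
proof unfold_locales
  fix c and x y :: "'a cfmat"
  show "mat_scale c x * y = mat_scale c (x * y)"
  proof (rule cfmat_eqI)
    fix i j
    have "entry (u * y) i j = (\<Sum>k | entry y k j \<noteq> 0. entry u i k * entry y k j)" for u
      by (rule entry_mult_eq) (auto simp: finite_entry)
    then show "entry (mat_scale c x * y) i j = entry (mat_scale c (x * y)) i j"
      by (simp add: sum_distrib_left mult.assoc)
  qed
  show "x * mat_scale c y = mat_scale c (x * y)"
  proof (rule cfmat_eqI)
    fix i j
    have "entry (x * u) i j = (\<Sum>k | entry y k j \<noteq> 0. entry x i k * entry u k j)"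
      if "\<And>k. entry y k j = 0 \<Longrightarrow> entry u k j = 0" for u
      by (rule entry_mult_eq) (auto simp: finite_entry that)
    then show "entry (x * mat_scale c y) i j = entry (mat_scale c (x * y)) i j"
      by (simp add: sum_distrib_left mult_ac)
  qed
qed (auto intro!: cfmat_eqI simp: algebra_simps)

lift_definition unit_mat :: "nat \<Rightarrow> nat \<Rightarrow> 'k::field cfmat" is
  "\<lambda>a b i j. if i = a \<and> j = b then 1 else 0"
proof -
  fix a b j :: nat
  show "finite {i. (if i = a \<and> j = b then 1 else 0 :: 'k) \<noteq> 0}"
    by (rule finite_subset[of _ "{a}"]) auto
qed

lemma entry_unit_mat [simp]: "entry (unit_mat a b) i j = (if i = a \<and> j = b then 1 else 0)"
  by transfer simp

definition square_mats :: "nat \<Rightarrow> 'k::field cfmat set" where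
  "square_mats n = {x. \<forall>i j. entry x i j \<noteq> 0 \<longrightarrow> i < n \<and> j < n}"

definition col_vecs :: "nat \<Rightarrow> 'k::field cfmat set" where
  "col_vecs n = {x. \<forall>i j. entry x i j \<noteq> 0 \<longrightarrow> i < n \<and> j = 0}"

definition mat_trace :: "nat \<Rightarrow> 'k::field cfmat \<Rightarrow> 'k" where
  "mat_trace n x = (\<Sum>i<n. entry x i i)"

lemma mat_trace_linear:
  "mat_trace n (x + y) = mat_trace n x + mat_trace n y" "mat_trace n 0 = 0"
  "mat_trace n (mat_scale c x) = c * mat_trace n x" "mat_trace n (x - y) = mat_trace n x - mat_trace
      n y"
  "mat_trace n (sum f A) = (\<Sum>a\<in>A. mat_trace n (f a))"
  unfolding mat_trace_def entry_sum 
  by (simp_all add: sum.distrib sum_distrib_left sum_subtractf sum.swap[of _ "{..<n}"])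

lemma entry_square_mats: "x \<in> square_mats n \<Longrightarrow> \<not> (i < n \<and> j < n) \<Longrightarrow> entry x i j = 0"
  unfolding square_mats_def by blast

lemma entry_col_vecs: "x \<in> col_vecs n \<Longrightarrow> \<not> (i < n \<and> j = 0) \<Longrightarrow> entry x i j = 0"
  unfolding col_vecs_def by blast

lemma square_matsI: "(\<And>i j. \<not> (i < n \<and> j < n) \<Longrightarrow> entry x i j = 0) \<Longrightarrow> x \<in> square_mats n"
  unfolding square_mats_def by blast

lemma col_vecsI: "(\<And>i j. \<not> (i < n \<and> j = 0) \<Longrightarrow> entry x i j = 0) \<Longrightarrow> x \<in> col_vecs n"
  unfolding col_vecs_def by blast

lemma entry_mult_square:
  assumes "x \<in> square_mats n"
  shows "entry (x * y) i j = (\<Sum>k<n. entry x i k * entry y k j)"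
  by (rule entry_mult_eq) (auto simp: entry_square_mats[OF assms])

lemma square_mats_mult:
  assumes "x \<in> square_mats n" "y \<in> square_mats n" shows "x * y \<in> square_mats n"
proof (rule square_matsI)
  fix i j assume "\<not> (i < n \<and> j < n)"
  then show "entry (x * y) i j = 0"
    unfolding entry_mult_square[OF assms(1)]
    by (intro sum.neutral) (auto simp: entry_square_mats[OF assms(1)] entry_square_mats[OF
        assms(2)])
qed

lemma square_mats_mult_col:
  assumes "x \<in> square_mats n" "y \<in> col_vecs n" shows "x * y \<in> col_vecs n"
proof (rule col_vecsI)
  fix i j :: nat assume "\<not> (i < n \<and> j = 0)"
  then show "entry (x * y) i j = 0"
    unfolding entry_mult_square[OF assms(1)]
    by (intro sum.neutral) (auto simp: entry_square_mats[OF assms(1)] entry_col_vecs[OF assms(2)])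
qed

lemma col_vecs_subset_square: "0 < n \<Longrightarrow> col_vecs n \<subseteq> square_mats n"
  by (auto simp: square_mats_def col_vecs_def)

lemma subspace_square_mats: "mat.subspace (square_mats n)"
  unfolding mat.subspace_def by (auto simp: square_mats_def) (metis add_0 add_0_right)+

lemma subspace_col_vecs: "mat.subspace (col_vecs n)"
  unfolding mat.subspace_def by (auto simp: col_vecs_def) (metis add_0 add_0_right)+

lemma square_mat_eq_sum:
  assumes "x \<in> square_mats n"
  shows "x = (\<Sum>a<n. \<Sum>b<n. mat_scale (entry x a b) (unit_mat a b))"
proof (rule cfmat_eqI)
  fix i j
  have *: "(\<Sum>b<n. entry x a b * (if i = a \<and> j = b then 1 else 0)) =
      (if i = a then if j < n then entry x a j else 0 else 0)" for a
    by (simp add: if_distrib cong: if_cong)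
  show "entry x i j = entry (\<Sum>a<n. \<Sum>b<n. mat_scale (entry x a b) (unit_mat a b)) i j"
    unfolding entry_sum entry_scale entry_unit_mat *
    using entry_square_mats[OF assms, of i j] by auto
qed

lemma fin_dim_square_mats: "mat.fin_dim (square_mats n)"
proof -
  let ?B = "(\<lambda>(a, b). unit_mat a b) ` ({..<n} \<times> {..<n}) :: 'a cfmat set"
  have "x \<in> mat.span ?B" if "x \<in> square_mats n" for x
    by (subst square_mat_eq_sum[OF that])
      (intro mat.span_sum mat.span_scale mat.span_base, auto)
  then show ?thesis unfolding mat.fin_dim_def by (intro exI[of _ ?B]) auto
qed

lemma mat_trace_comm:
  assumes "x \<in> square_mats n" "y \<in> square_mats n"
  shows "mat_trace n (x * y) = mat_trace n (y * x)"
  unfolding mat_trace_def entry_mult_square[OF assms(1)] entry_mult_square[OF assms(2)]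
  by (subst sum.swap) (simp add: mult.commute)

lemma unit_mat_mult: "unit_mat a b * x = (\<Sum>j\<in>S. mat_scale (entry x b j) (unit_mat a j))"
  if "finite S" "\<And>j. j \<notin> S \<Longrightarrow> entry x b j = 0"
proof (rule cfmat_eqI)
  fix i j
  have "entry (unit_mat a b * x) i j = (\<Sum>k\<in>{b}. entry (unit_mat a b) i k * entry x k j)"
    by (rule entry_mult_eq) auto
  also have "\<dots> = (\<Sum>k\<in>S. entry x b k * (if i = a \<and> j = k then 1 else 0))"
    using that by (auto simp: if_distrib cong: if_cong)
  finally show "entry (unit_mat a b * x) i j = entry (\<Sum>j\<in>S. mat_scale (entry x b j) (unit_mat a j))
      i j"
    by (simp add: entry_sum)
qed

lemma unit_mat_mult_unit_mat: "unit_mat a b * unit_mat c d = (if b = c then unit_mat a d else 0)"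
  by (subst unit_mat_mult[where S = "{d}"]) auto

lemma unit_mat_in: "a < n \<Longrightarrow> b < n \<Longrightarrow> unit_mat a b \<in> square_mats n" 
  "a < n \<Longrightarrow> unit_mat a 0 \<in> col_vecs n"
  by (auto simp: square_mats_def col_vecs_def)

lemma mult_unit_mat:
  assumes "x \<in> square_mats n"
  shows "x * unit_mat a b = (\<Sum>i<n. mat_scale (entry x i a) (unit_mat i b))"
proof (rule cfmat_eqI)
  fix i j
  have "entry (x * unit_mat a b) i j = (\<Sum>k\<in>{a}. entry x i k * entry (unit_mat a b) k j)"
    by (rule entry_mult_eq) auto
  then show "entry (x * unit_mat a b) i j = entry (\<Sum>i<n. mat_scale (entry x i a) (unit_mat i b)) i
      j"
    using entry_square_mats[OF assms, of i a]
    by (auto simp: entry_sum if_distrib cong: if_cong)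
qed

lemma col_vec_eq_sum:
  assumes "u \<in> col_vecs n"
  shows "u = (\<Sum>a<n. mat_scale (entry u a 0) (unit_mat a 0))"
proof (rule cfmat_eqI)
  fix i j
  show "entry u i j = entry (\<Sum>a<n. mat_scale (entry u a 0) (unit_mat a 0)) i j"
    using entry_col_vecs[OF assms, of i j]
    by (cases "j = 0") (auto simp: entry_sum if_distrib cong: if_cong)
qed

lemma square_mat_eq_0I:
  assumes x: "x \<in> square_mats n" and 0: "\<And>u. u \<in> col_vecs n \<Longrightarrow> x * u = 0"
  shows "x = 0"
proof (rule cfmat_eqI)
  fix i j
  show "entry x i j = entry 0 i j"
  proof (cases "j < n")
    case True
    have "entry (x * unit_mat j 0) i 0 = (\<Sum>k\<in>{j}. entry x i k * entry (unit_mat j 0) k 0)"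
      by (rule entry_mult_eq) auto
    then show ?thesis using 0[OF unit_mat_in(2)[OF True]] by simp
  qed (simp add: entry_square_mats[OF x])
qed

interpretation mat_field: vector_space_pair "mat_scale :: 'k::field \<Rightarrow> _" "(*) :: 'k \<Rightarrow> 'k \<Rightarrow> 'k"
  by unfold_locales (auto simp: algebra_simps)

text \<open>
  Vectors are matrices supported in column 0, dual vectors those supported in row 0.
\<close>

lemma dual_frame:
  assumes n: "0 < n" and v: "mat.span (v ` {..<m}) = col_vecs n" "mat.independent (v ` {..<m})"
      "inj_on v {..<m}"
  obtains w :: "nat \<Rightarrow> 'k::field cfmat" and \<phi> :: "nat \<Rightarrow> 'k cfmat \<Rightarrow> 'k" where
    "\<And>i. i < m \<Longrightarrow> w i \<in> square_mats n"
    "\<And>i u. i < m \<Longrightarrow> u \<in> col_vecs n \<Longrightarrow> w i * u = mat_scale (\<phi> i u) (unit_mat 0 0)"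
    "\<And>i. i < m \<Longrightarrow> Vector_Spaces.linear mat_scale (*) (\<phi> i)"
    "\<And>i j. i < m \<Longrightarrow> j < m \<Longrightarrow> \<phi> i (v j) = (if i = j then 1 else 0)"
    "\<And>i. unit_mat 0 0 * w i = w i" "\<And>i. i < m \<Longrightarrow> v i * unit_mat 0 0 = v i"
    "\<And>x. x \<in> square_mats n \<Longrightarrow> x * (\<Sum>i<m. v i * w i) = x"
    "\<And>x. x \<in> square_mats n \<Longrightarrow> (\<Sum>i<m. v i * w i) * x = x"
proof -
  have "\<exists>f. Vector_Spaces.linear mat_scale (*) f \<and> (\<forall>x\<in>v ` {..<m}. f x = (if x = v i then 1 else
      0))" for i
    using mat_field.linear_independent_extend[OF v(2), of "\<lambda>x. if x = v i then 1 else 0"] .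
  then obtain \<phi> where lin: "\<And>i. Vector_Spaces.linear mat_scale (*) (\<phi> i)"
    and \<phi>: "\<And>i. \<forall>x\<in>v ` {..<m}. \<phi> i x = (if x = v i then 1 else 0)" by metis
  have \<phi>v: "\<phi> i (v j) = (if i = j then 1 else 0)" if "i < m" "j < m" for i j
    using \<phi>[of i] that v(3) by (auto simp: inj_on_def)
  \<comment> \<open>The row vector of the values of \<open>\<phi> i\<close> on the standard
    basis.\<close>
  define w where "w i = (\<Sum>a<n. mat_scale (\<phi> i (unit_mat a 0)) (unit_mat 0 a))" for i
  have wsq: "w i \<in> square_mats n" for i unfolding w_def
    by (intro mat.subspace_sum mat.subspace_scale subspace_square_mats unit_mat_in(1)) (use n in
        auto)
  have vcol: "v i \<in> col_vecs n" if "i < m" for i using v(1) that mat.span_base[of "v i" "v `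
      {..<m}"] by auto
  have wu: "w i * u = mat_scale (\<phi> i u) (unit_mat 0 0)" if u: "u \<in> col_vecs n" for i u
  proof -
    have E: "unit_mat 0 a * u = mat_scale (entry u a 0) (unit_mat 0 0)" for a
      by (subst unit_mat_mult[where S = "{0}"]) (auto simp: entry_col_vecs[OF u])
    have "\<phi> i u = (\<Sum>a<n. entry u a 0 * \<phi> i (unit_mat a 0))"
      by (subst col_vec_eq_sum[OF u]) 
        (simp add: mat_field.linear_sum[OF lin] mat_field.linear_scale[OF lin])
    moreover have "w i * u = (\<Sum>a<n. mat_scale (\<phi> i (unit_mat a 0) * entry u a 0) (unit_mat 0 0))"
      by (simp add: w_def sum_distrib_right mat.scale_mult_left E)
    ultimately show ?thesis by (simp add: mat.scale_sum_left mult.commute)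
  qed
  have Ew: "unit_mat 0 0 * w i = w i" for i
    by (simp add: w_def sum_distrib_left mat.scale_mult_right unit_mat_mult_unit_mat)
  have vE: "v i * unit_mat 0 0 = v i" if "i < m" for i
  proof -
    have "v i * unit_mat 0 0 = (\<Sum>a<n. mat_scale (entry (v i) a 0) (unit_mat a 0))"
      by (rule mult_unit_mat) (use col_vecs_subset_square[OF n] vcol[OF that] in auto)
    then show ?thesis using col_vec_eq_sum[OF vcol[OF that]] by simp
  qed
  \<comment> \<open>\<open>?e\<close> is the identity matrix of size \<open>n\<close>, which is not
    the unit of the ring \<open>cfmat\<close>.\<close>
  let ?e = "\<Sum>i<m. v i * w i"
  have esq: "?e \<in> square_mats n"
    by (intro mat.subspace_sum subspace_square_mats square_mats_mult wsq)
      (use col_vecs_subset_square[OF n] vcol in auto)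
  have id: "?e * u = u" if "u \<in> col_vecs n" for u
  proof -
    have "u \<in> mat.span (v ` {..<m})" using that v(1) by simp
    then have "?e * u - u \<in> {0}"
    proof (induction rule: mat.span_induct_alt)
      case (step c x y)
      then obtain j where j: "j < m" "x = v j" by auto
      have "?e * x = (\<Sum>i<m. if i = j then v j else 0)" unfolding sum_distrib_right
        by (rule sum.cong) (use j in \<open>auto simp: mult.assoc wu[OF vcol] \<phi>v vE\<close>)
      then have "?e * x = x" using j by simp
      moreover have "?e * y = y" using step(2) by simp
      ultimately show ?case by (simp add: distrib_left mat.scale_mult_right)
    qed simp
    then show ?thesis by simp
  qed
  have e1: "?e * x = x" if x: "x \<in> square_mats n" for x
  proof -
    have "?e * x - x = 0"
    proof (rule square_mat_eq_0I)
      show "?e * x - x \<in> square_mats n"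
        by (rule mat.subspace_diff[OF subspace_square_mats square_mats_mult[OF esq x] x])
      show "(?e * x - x) * u = 0" if "u \<in> col_vecs n" for u
        using id[OF square_mats_mult_col[OF x that]] by (simp add: left_diff_distrib mult.assoc)
    qed
    then show ?thesis by simp
  qed
  have e2: "x * ?e = x" if x: "x \<in> square_mats n" for x
  proof -
    have "x * ?e - x = 0"
    proof (rule square_mat_eq_0I)
      show "x * ?e - x \<in> square_mats n"
        by (rule mat.subspace_diff[OF subspace_square_mats square_mats_mult[OF x esq] x])
      show "(x * ?e - x) * u = 0" if "u \<in> col_vecs n" for u
        using id[OF that] by (simp add: left_diff_distrib mult.assoc)
    qed
    then show ?thesis by simp
  qed
  show ?thesis
    by (rule that[of w \<phi>]) (use wsq wu lin \<phi>v Ew vE e1 e2 in auto)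
qed

text \<open>Cyclicity of the trace replaces the rank-one matrix \<open>v * w\<close> by
  \<open>w * v\<close>, whose only possible nonzero entry is at \<open>(0, 0)\<close>.\<close>

lemma mat_trace_frame:
  assumes n: "0 < n" and "v \<in> col_vecs n" "w \<in> square_mats n" "w * v = mat_scale c (unit_mat 0 0)"
  shows "mat_trace n (v * w) = c"
proof -
  have "mat_trace n (v * w) = mat_trace n (w * v)"
    by (rule mat_trace_comm) (use assms col_vecs_subset_square in auto)
  also have "\<dots> = c" unfolding assms(4) mat_trace_linear 
    using n by (simp add: mat_trace_def if_distrib cong: if_cong)
  finally show ?thesis .
qed

section \<open>Cartan's criterion for matrices\<close>

text \<open>The set \<open>L\<close> of admissible eigenvalues will be \<open>{0}\<close> for
  nilpotent matrices and \<open>UNIV\<close> over an algebraically closed field.\<close>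

lemma block_triangular_mat:
  fixes x :: "'k::field cfmat"
  assumes n: "0 < n" and x: "x \<in> square_mats n"
    and ev: "\<forall>W. mat.subspace W \<and> W \<subset> col_vecs n \<and> (\<lambda>u. x * u) ` W \<subseteq> W \<longrightarrow>
      (\<exists>v\<in>col_vecs n - W. \<exists>c\<in>L. x * v - mat_scale c v \<in> W)"
  obtains v :: "nat \<Rightarrow> 'k cfmat" and m :: nat and l where
    "mat.span (v ` {..<m}) = col_vecs n" "mat.independent (v ` {..<m})" "inj_on v {..<m}" "l `
        {..<m} \<subseteq> L"
    "\<And>i. i < m \<Longrightarrow> x * v i - mat_scale (l i) (v i) \<in> mat.span (v ` {j. j < i \<and> l j = l i})"
proof -
  have im: "(\<lambda>u. x * u) ` col_vecs n \<subseteq> col_vecs n" using square_mats_mult_col[OF x] by auto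
  have fd: "mat.fin_dim (col_vecs n :: 'k cfmat set)"
    by (rule mat.fin_dim_subset[OF fin_dim_square_mats col_vecs_subset_square[OF n]])
  show ?thesis
    by (rule mat.block_triangular_basis[of "\<lambda>u. x * u" "col_vecs n" L,
        OF distrib_left mat.scale_mult_right fd subspace_col_vecs im], use ev in blast, rule that)
qed

text \<open>The numbers \<open>\<phi> i (x * v j)\<close> form the matrix of \<open>x\<close> in the
  basis \<open>v\<close>, and the sum in the second claim is the diagonal matrix \<open>c\<close> in
  that basis. With \<open>c = 1\<close> this yields the trace of \<open>x\<close>; with
  \<open>c\<close> the images of the eigenvalues under an additive map it yields the trace in
  Cartan's criterion.\<close>

lemma mat_trace_block_triangular:
  fixes x :: "'k::field cfmat" and v w :: "nat \<Rightarrow> 'k cfmat"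
  assumes n: "0 < n" and x: "x \<in> square_mats n"
    and v: "mat.span (v ` {..<m}) = col_vecs n"
    and tri: "\<And>i. i < m \<Longrightarrow> x * v i - mat_scale (l i) (v i) \<in> mat.span (v ` {j. j < i \<and> l j = l i})"
    and w: "\<And>i. i < m \<Longrightarrow> w i \<in> square_mats n"
      "\<And>i u. i < m \<Longrightarrow> u \<in> col_vecs n \<Longrightarrow> w i * u = mat_scale (\<phi> i u) (unit_mat 0 0)"
      "\<And>i. i < m \<Longrightarrow> Vector_Spaces.linear mat_scale (*) (\<phi> i)"
      "\<And>i j. i < m \<Longrightarrow> j < m \<Longrightarrow> \<phi> i (v j) = (if i = j then 1 else 0)"
  shows "i < m \<Longrightarrow> j < m \<Longrightarrow> \<not> (i < j \<and> l i = l j) \<Longrightarrow> \<phi> i (x * v j) = (if i = j then l j else 0)"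
    and "mat_trace n (x * (\<Sum>i<m. mat_scale (c i) (v i * w i))) = (\<Sum>i<m. c i * l i)"
proof -
  have vcol: "v i \<in> col_vecs n" if "i < m" for i using v that mat.span_base[of "v i" "v ` {..<m}"]
      by auto
  show 1: "\<phi> i (x * v j) = (if i = j then l j else 0)" if ij: "i < m" "j < m" "\<not> (i < j \<and> l i = l
      j)" for i j
  proof -
    have "\<phi> i (x * v j - mat_scale (l j) (v j)) = 0"
      using tri[OF ij(2)]
    proof (induction rule: mat.span_induct_alt)
      case base
      then show ?case by (rule mat_field.linear_0[OF w(3)[OF ij(1)]])
    next
      case (step c a b)
      then obtain k where k: "k < j" "l k = l j" "a = v k" by auto
      then have "k < m" using ij(2) by linarith
      then have "\<phi> i a = 0" using ij k w(4)[OF ij(1), of k] by auto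
      then show ?case using step(2)
        by (auto simp: mat_field.linear_add[OF w(3)[OF ij(1)]] mat_field.linear_scale[OF w(3)[OF
            ij(1)]])
    qed
    then have "\<phi> i (x * v j) = l j * \<phi> i (v j)"
      by (simp add: mat_field.linear_diff[OF w(3)[OF ij(1)]] mat_field.linear_scale[OF w(3)[OF
          ij(1)]])
    then show ?thesis using w(4)[OF ij(1,2)] by simp
  qed
  have "mat_trace n (x * (v i * w i)) = l i" if "i < m" for i
    unfolding mult.assoc[symmetric]
    by (rule mat_trace_frame[OF n square_mats_mult_col[OF x vcol[OF that]] w(1)[OF that]])
      (simp add: w(2)[OF that square_mats_mult_col[OF x vcol[OF that]]] 1[OF that that])
  then show "mat_trace n (x * (\<Sum>i<m. mat_scale (c i) (v i * w i))) = (\<Sum>i<m. c i * l i)"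
    by (simp add: sum_distrib_left mat_trace_linear mat.scale_mult_right)
qed

lemma mat_trace_nilpotent:
  fixes x :: "'k::field cfmat"
  assumes x: "x \<in> square_mats n" and nil: "x ^ N = 0"
  shows "mat_trace n x = 0"
proof (cases "0 < n")
  case False then show ?thesis by (simp add: mat_trace_def)
next
  case n: True
  have ev: "\<forall>W. mat.subspace W \<and> W \<subset> col_vecs n \<and> (\<lambda>u. x * u) ` W \<subseteq> W \<longrightarrow>
      (\<exists>v\<in>col_vecs n - W. \<exists>c\<in>{0}. x * v - mat_scale c v \<in> W)"
  proof (intro allI impI, elim conjE)
    fix W :: "'k cfmat set" assume W: "mat.subspace W" "W \<subset> col_vecs n"
    obtain u where u: "u \<in> col_vecs n" "u \<notin> W" using W(2) by auto
    have "x ^ N * u \<in> W" using nil W(1) by (simp add: mat.subspace_0)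
    \<comment> \<open>The power just before the first one that sends \<open>u\<close> into
      \<open>W\<close> yields a vector that \<open>x\<close> kills modulo \<open>W\<close>.\<close>
    then obtain k where k: "x ^ k * u \<in> W" "\<And>j. x ^ j * u \<in> W \<Longrightarrow> k \<le> j"
      using ex_has_least_nat[of "\<lambda>k. x ^ k * u \<in> W" N "\<lambda>k. k"] by blast
    have pow: "x ^ j * u \<in> col_vecs n" for j
      by (induction j) (use u x in \<open>auto simp: mult.assoc square_mats_mult_col\<close>)
    obtain j where j: "k = Suc j" using k(1) u(2) by (cases k) auto
    have "x ^ j * u \<notin> W" using k(2)[of j] j by auto
    moreover have "x * (x ^ j * u) \<in> W" using k(1) j by (simp add: mult.assoc)
    ultimately show "\<exists>v\<in>col_vecs n - W. \<exists>c\<in>{0}. x * v - mat_scale c v \<in> W"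
      using pow[of j] by (intro bexI[of _ "x ^ j * u"] bexI[of _ 0]) auto
  qed
  obtain v :: "nat \<Rightarrow> 'k cfmat" and m :: nat and l where v:
    "mat.span (v ` {..<m}) = col_vecs n" "mat.independent (v ` {..<m})" "inj_on v {..<m}" "l `
        {..<m} \<subseteq> {0}"
    "\<And>i. i < m \<Longrightarrow> x * v i - mat_scale (l i) (v i) \<in> mat.span (v ` {j. j < i \<and> l j = l i})"
    by (rule block_triangular_mat[OF n x ev], rule that)
  obtain w \<phi> where w: "\<And>i. i < m \<Longrightarrow> w i \<in> square_mats n"
    "\<And>i u. i < m \<Longrightarrow> u \<in> col_vecs n \<Longrightarrow> w i * u = mat_scale (\<phi> i u) (unit_mat 0 0)"
    "\<And>i. i < m \<Longrightarrow> Vector_Spaces.linear mat_scale (*) (\<phi> i)"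
    "\<And>i j. i < m \<Longrightarrow> j < m \<Longrightarrow> \<phi> i (v j) = (if i = j then 1 else 0)"
    "\<And>i. unit_mat 0 0 * w i = w i" "\<And>i. i < m \<Longrightarrow> v i * unit_mat 0 0 = v i"
    "\<And>x. x \<in> square_mats n \<Longrightarrow> x * (\<Sum>i<m. v i * w i) = x"
    "\<And>x. x \<in> square_mats n \<Longrightarrow> (\<Sum>i<m. v i * w i) * x = x"
    by (rule dual_frame[OF n v(1-3)], rule that)
  have "mat_trace n (x * (\<Sum>i<m. mat_scale 1 (v i * w i))) = (\<Sum>i<m. 1 * l i)"
    by (rule mat_trace_block_triangular(2)[OF n x v(1,5) w(1-4)])
  then show ?thesis using w(7)[OF x] v(4) by (simp add: image_subset_iff)
qed

text \<open>The field is a vector space over the rationals, in which \<open>{a}\<close> extends to a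
  basis.\<close>

lemma rational_functional:
  fixes a :: "'k::field_char_0"
  assumes "a \<noteq> 0"
  obtains f :: "'k \<Rightarrow> rat" where "\<And>x y. f (x + y) = f x + f y" "\<And>q x. f (of_rat q * x) = q * f x" "f
      a = 1"
proof -
  interpret K: vector_space "\<lambda>q (x::'k). of_rat q * x"
  proof
    fix a b :: rat and x y :: 'k
    show "of_rat a * (x + y) = of_rat a * x + of_rat a * y" by (rule distrib_left)
    show "of_rat (a + b) * x = of_rat a * x + of_rat b * x" by (simp only: of_rat_add distrib_right)
    show "of_rat a * (of_rat b * x) = of_rat (a * b) * x" by (simp only: of_rat_mult mult.assoc)
    show "of_rat 1 * x = x" by simp
  qed
  interpret K: vector_space_pair "\<lambda>q (x::'k). of_rat q * x" "(*) :: rat \<Rightarrow> rat \<Rightarrow> rat"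
    by unfold_locales (simp_all add: distrib_left distrib_right)
  have "K.independent {a}" using assms by simp
  from K.linear_independent_extend[OF this, of "\<lambda>_. 1"] obtain f
    where f: "Vector_Spaces.linear (\<lambda>q (x::'k). of_rat q * x) (*) f" "f a = 1" by blast
  show ?thesis by (rule that[of f, OF K.linear_add[OF f(1)] K.linear_scale[OF f(1)] f(2)])
qed

text \<open>Applying a rational-linear \<open>f\<close> to the relation gives a vanishing sum of the
  squares \<open>f (l i) * f (l i)\<close> of rational numbers. A nonzero \<open>l i\<close> would
  admit an \<open>f\<close> whose value there is 1.\<close>

lemma rational_functionals_square_sum:
  fixes l :: "nat \<Rightarrow> 'k::field_char_0"
  assumes "\<And>f. (\<And>x y. f (x + y) = f x + f y) \<Longrightarrow> (\<Sum>i<m. of_rat (f (l i)) * l i) = 0" "i < m"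
  shows "l i = 0"
proof (rule ccontr)
  assume "l i \<noteq> 0"
  then obtain f :: "'k \<Rightarrow> rat" where f: "\<And>x y. f (x + y) = f x + f y" "\<And>q x. f (of_rat q * x) = q * f
      x" "f (l i) = 1"
    using rational_functional by blast
  have f0: "f 0 = 0" using f(1)[of 0 0] by simp
  have fsum: "f (\<Sum>i\<in>A. g i) = (\<Sum>i\<in>A. f (g i))" for g and A :: "nat set"
    by (induction A rule: infinite_finite_induct) (auto simp: f0 f(1))
  have "0 = f (\<Sum>i<m. of_rat (f (l i)) * l i)" using assms(1)[OF f(1)] f0 by simp
  also have "\<dots> = (\<Sum>i<m. f (l i) * f (l i))" unfolding fsum f(2) ..
  also have "\<dots> \<ge> f (l i) * f (l i)"
    by (rule member_le_sum) (use assms(2) in auto)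
  finally show False using f(3) by simp
qed

text \<open>
  Replacing the eigenvalues \<open>l\<close> of \<open>x\<close> by \<open>f l\<close> with \<open>f\<close> additive gives a matrix \<open>y\<close> whose
  commutator preserves every subspace stable under the commutator with \<open>x\<close>, so
  \<open>tr (x y) = 0\<close>, that is \<open>\<Sum> f l * l = 0\<close>.
\<close>

lemma trace_form_0_imp_nilpotent:
  fixes x :: "'k::{alg_closed_field,field_char_0} cfmat"
  assumes P: "P \<subseteq> square_mats n" "mat.subspace P" "P = comm_span mat_scale P P"
    and tr: "\<And>a b. a \<in> P \<Longrightarrow> b \<in> P \<Longrightarrow> mat_trace n (a * b) = 0" and xP: "x \<in> P"
  shows "\<exists>N. x ^ N = 0"
proof (cases "0 < n")
  case False
  then have "x = 0" using xP P(1) by (intro cfmat_eqI) (auto simp: square_mats_def)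
  then show ?thesis by (intro exI[of _ 1]) simp
next
  case n: True
  have x: "x \<in> square_mats n" using xP P(1) by auto
  have im: "(\<lambda>u. x * u) ` col_vecs n \<subseteq> col_vecs n" using square_mats_mult_col[OF x] by auto
  have fd: "mat.fin_dim (col_vecs n :: 'k cfmat set)"
    by (rule mat.fin_dim_subset[OF fin_dim_square_mats col_vecs_subset_square[OF n]])
  have ev: "\<forall>W. mat.subspace W \<and> W \<subset> col_vecs n \<and> (\<lambda>u. x * u) ` W \<subseteq> W \<longrightarrow>
      (\<exists>v\<in>col_vecs n - W. \<exists>c\<in>UNIV. x * v - mat_scale c v \<in> W)"
    using mat.eigenvector_modulo[of "\<lambda>u. x * u" "col_vecs n", OF distrib_left mat.scale_mult_right
        alg_closed_imp_poly_has_root fd subspace_col_vecs im] by simp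
  obtain v :: "nat \<Rightarrow> 'k cfmat" and m :: nat and l where v:
    "mat.span (v ` {..<m}) = col_vecs n" "mat.independent (v ` {..<m})" "inj_on v {..<m}" "l `
        {..<m} \<subseteq> UNIV"
    "\<And>i. i < m \<Longrightarrow> x * v i - mat_scale (l i) (v i) \<in> mat.span (v ` {j. j < i \<and> l j = l i})"
    by (rule block_triangular_mat[OF n x ev], rule that)
  have vcol: "v i \<in> col_vecs n" if "i < m" for i using v(1) that mat.span_base[of "v i" "v `
      {..<m}"] by auto
  obtain w \<phi> where w: "\<And>i. i < m \<Longrightarrow> w i \<in> square_mats n"
    "\<And>i u. i < m \<Longrightarrow> u \<in> col_vecs n \<Longrightarrow> w i * u = mat_scale (\<phi> i u) (unit_mat 0 0)"
    "\<And>i. i < m \<Longrightarrow> Vector_Spaces.linear mat_scale (*) (\<phi> i)"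
    "\<And>i j. i < m \<Longrightarrow> j < m \<Longrightarrow> \<phi> i (v j) = (if i = j then 1 else 0)"
    and E: "\<And>i. unit_mat 0 0 * w i = w i" "\<And>i. i < m \<Longrightarrow> v i * unit_mat 0 0 = v i"
    and id: "\<And>x. x \<in> square_mats n \<Longrightarrow> x * (\<Sum>i<m. v i * w i) = x"
    "\<And>x. x \<in> square_mats n \<Longrightarrow> (\<Sum>i<m. v i * w i) * x = x"
    by (rule dual_frame[OF n v(1-3)], rule that)
  have wv: "w i * v j = (if i = j then unit_mat 0 0 else 0)" if "i < m" "j < m" for i j
    using w(2)[OF that(1) vcol[OF that(2)]] w(4)[OF that] by simp
  \<comment> \<open>The dual basis is triangular for multiplication by \<open>x\<close> from the
    right, with the order of the indices reversed.\<close>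
  have row: "w j * x - mat_scale (l j) (w j) \<in> mat.span (w ` {k. j < k \<and> k < m \<and> l k = l j})" (is "_
      \<in> ?R")
    if j: "j < m" for j
  proof -
    have "w j * x = w j * (x * (\<Sum>k<m. v k * w k))" using id(1)[OF x] by simp
    also have "\<dots> = (\<Sum>k<m. w j * (x * v k) * w k)" by (simp add: sum_distrib_left mult.assoc)
    also have "\<dots> = (\<Sum>k<m. mat_scale (\<phi> j (x * v k)) (w k))"
      by (rule sum.cong) (auto simp: w(2)[OF j square_mats_mult_col[OF x vcol]] mat.scale_mult_left
          E)
    also have "\<dots> - mat_scale (l j) (w j) = (\<Sum>k<m. mat_scale (\<phi> j (x * v k) - (if k = j then l j else
        0)) (w k))"
      using j by (simp add: mat.scale_left_diff_distrib sum_subtractf if_distrib[of "\<lambda>c. mat_scale c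
          _"] cong: if_cong)
    also have "\<dots> \<in> ?R"
    proof (rule mat.span_sum)
      fix k assume "k \<in> {..<m}"
      then have k: "k < m" by simp
      show "mat_scale (\<phi> j (x * v k) - (if k = j then l j else 0)) (w k) \<in> ?R"
      proof (cases "j < k \<and> l j = l k")
        case True
        then show ?thesis using k by (intro mat.span_scale mat.span_base) auto
      next
        case False
        have "\<phi> j (x * v k) = (if j = k then l k else 0)"
          by (rule mat_trace_block_triangular(1)[OF n x v(1,5) w(1-4) j k False])
        then show ?thesis by (auto simp: mat.span_zero)
      qed
    qed
    finally show ?thesis .
  qed
  define T where "T = (\<lambda>u. x * u - u * x)"
  have T: "T (a + b) = T a + T b" "T (mat_scale c a) = mat_scale c (T a)" for a b c
    by (auto simp: T_def algebra_simps mat.scale_mult_left mat.scale_mult_right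
        mat.scale_right_diff_distrib)
  let ?G = "mat.gen_eigenspace T"
  note subG = mat.subspace_gen_eigenspace[of T, OF T]
  \<comment> \<open>Triangularity of \<open>v\<close> lowers \<open>i\<close> and that of
    \<open>w\<close> raises \<open>j\<close>, so the induction is on
    \<open>i + (m - j)\<close>.\<close>
  have G: "v i * w j \<in> ?G (l i - l j)" if "i < m" "j < m" for i j
    using that
  proof (induction "i + (m - j)" arbitrary: i j rule: less_induct)
    case less
    have "(x * v i - mat_scale (l i) (v i)) * w j \<in> ?G (l i - l j)"
    proof (rule mat.mult_right_span[OF _ subG v(5)[OF less.prems(1)]])
      fix u assume "u \<in> v ` {k. k < i \<and> l k = l i}"
      then obtain k where "k < i" "l k = l i" "u = v k" by auto
      then show "u * w j \<in> ?G (l i - l j)" using less.hyps[of k j] less.prems by simp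
    qed
    moreover have "v i * (w j * x - mat_scale (l j) (w j)) \<in> ?G (l i - l j)"
    proof (rule mat.mult_left_span[OF _ subG row[OF less.prems(2)]])
      fix u assume "u \<in> w ` {k. j < k \<and> k < m \<and> l k = l j}"
      then obtain k where "j < k" "k < m" "l k = l j" "u = w k" by auto
      then show "v i * u \<in> ?G (l i - l j)" using less.hyps[of i k] less.prems by simp
    qed
    ultimately have "(x * v i - mat_scale (l i) (v i)) * w j - v i * (w j * x - mat_scale (l j) (w
        j)) \<in> ?G (l i - l j)"
      by (rule mat.subspace_diff[OF subG])
    also have "(x * v i - mat_scale (l i) (v i)) * w j - v i * (w j * x - mat_scale (l j) (w j)) =
      T (v i * w j) - mat_scale (l i - l j) (v i * w j)"
      by (simp add: T_def algebra_simps mat.scale_mult_left mat.scale_mult_right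
          mat.scale_left_diff_distrib)
    finally show ?case by (rule mat.gen_eigenspaceI[of T, OF T])
  qed
  have l0: "l i = 0" if "i < m" for i
  proof (rule rational_functionals_square_sum[OF _ that])
    fix f0 :: "'k \<Rightarrow> rat" assume f0: "\<And>a b. f0 (a + b) = f0 a + f0 b"
    define f where "f a = (of_rat (f0 a) :: 'k)" for a
    have f: "f (a - b) = f a - f b" for a b
      using f0[of "a - b" b] by (simp add: f_def of_rat_add)
    define y where "y = (\<Sum>i<m. mat_scale (f (l i)) (v i * w i))"
    have yv: "y * v i = mat_scale (f (l i)) (v i)" if i: "i < m" for i
    proof -
      have "y * v i = (\<Sum>j<m. if j = i then mat_scale (f (l i)) (v i) else 0)" unfolding y_def
          sum_distrib_right
        by (rule sum.cong) (use i in \<open>auto simp: mat.scale_mult_left mult.assoc wv E\<close>)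
      then show ?thesis using i by simp
    qed
    have wy: "w i * y = mat_scale (f (l i)) (w i)" if i: "i < m" for i
    proof -
      have "w i * y = (\<Sum>j<m. if j = i then mat_scale (f (l i)) (w i) else 0)" unfolding y_def
          sum_distrib_left
        by (rule sum.cong) (use i in \<open>auto simp: mat.scale_mult_right mult.assoc[symmetric] wv E\<close>)
      then show ?thesis using i by simp
    qed
    \<comment> \<open>\<open>u\<close> is decomposed into the parts \<open>U d\<close> belonging to
      the generalised eigenvalues \<open>d\<close> of the commutator with \<open>x\<close>. They lie
      in \<open>P\<close> because \<open>P\<close> is stable under that commutator. The commutator
      with \<open>y\<close> multiplies \<open>U d\<close> by \<open>f d\<close>, since
      \<open>f (l i) - f (l j) = f d\<close> by additivity, and hence preserves
      \<open>P\<close>.\<close>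
    have stab: "y * u - u * y \<in> P" if uP: "u \<in> P" for u
    proof -
      have u: "u \<in> square_mats n" using uP P(1) by auto
      define c where "c i j = \<phi> i (u * v j)" for i j
      define D where "D = (\<lambda>(i, j). l i - l j) ` ({..<m} \<times> {..<m})"
      define S where "S d = {p \<in> {..<m} \<times> {..<m}. (\<lambda>(i, j). l i - l j) p = d}" for d
      define U where "U d = (\<Sum>(i, j)\<in>S d. mat_scale (c i j) (v i * w j))" for d
      have finD: "finite D" by (simp add: D_def)
      have "u = (\<Sum>i<m. v i * w i) * u * (\<Sum>j<m. v j * w j)" using id u by simp
      also have "\<dots> = (\<Sum>i<m. \<Sum>j<m. v i * (w i * (u * v j)) * w j)"
        unfolding sum_distrib_right unfolding sum_distrib_left mult.assoc ..
      also have "\<dots> = (\<Sum>i<m. \<Sum>j<m. mat_scale (c i j) (v i * w j))"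
        by (intro sum.cong refl)
          (auto simp: c_def w(2)[OF _ square_mats_mult_col[OF u vcol]] mat.scale_mult_right
              mat.scale_mult_left E)
      also have "\<dots> = (\<Sum>(i, j)\<in>{..<m} \<times> {..<m}. mat_scale (c i j) (v i * w j))"
        by (simp add: sum.cartesian_product)
      also have "\<dots> = (\<Sum>d\<in>D. U d)"
        unfolding U_def S_def D_def by (rule sum.image_gen) simp
      finally have usum: "u = (\<Sum>d\<in>D. U d)" .
      have UG: "U d \<in> ?G d" for d unfolding U_def
      proof (rule mat.subspace_sum[OF subG])
        fix p assume "p \<in> S d"
        then show "(case p of (i, j) \<Rightarrow> mat_scale (c i j) (v i * w j)) \<in> ?G d"
          using G by (auto simp: S_def intro!: mat.subspace_scale[OF subG])
      qed
      have TP: "T a \<in> P" if "a \<in> P" for a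
        using mat.comm_spanI[OF xP that] P(3) unfolding T_def by simp
      have UP: "U d \<in> P" if "d \<in> D" for d
        by (rule mat.gen_eigenspace_components[of T, OF T P(2) TP finD UG _ that])
          (use usum uP in auto)
      have yU: "y * U d - U d * y = mat_scale (f d) (U d)" for d
      proof -
        have "y * U d = (\<Sum>p\<in>S d. mat_scale (f (l (fst p))) (mat_scale (c (fst p) (snd p)) (v (fst p)
            * w (snd p))))"
          unfolding U_def sum_distrib_left
          by (rule sum.cong) (auto simp: S_def mat.scale_mult_right mult.assoc[symmetric] yv
              mat.scale_mult_left mat.scale_left_commute)
        moreover have "U d * y = (\<Sum>p\<in>S d. mat_scale (f (l (snd p))) (mat_scale (c (fst p) (snd p))
            (v (fst p) * w (snd p))))"
          unfolding U_def sum_distrib_right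
          by (rule sum.cong) (auto simp: S_def mat.scale_mult_right mult.assoc wy
              mat.scale_mult_left mat.scale_left_commute)
        moreover have "f (l (fst p)) - f (l (snd p)) = f d" if "p \<in> S d" for p
          using that by (auto simp: S_def f)
        ultimately have "y * U d - U d * y = (\<Sum>p\<in>S d. mat_scale (f d) (mat_scale (c (fst p) (snd p))
            (v (fst p) * w (snd p))))"
          by (simp only: sum_subtractf[symmetric] mat.scale_left_diff_distrib[symmetric] cong:
              sum.cong)
        then show ?thesis by (simp add: U_def mat.scale_sum_right case_prod_beta)
      qed
      have "y * u - u * y = (\<Sum>d\<in>D. y * U d - U d * y)"
        by (subst (1 2) usum) (simp add: sum_distrib_left sum_distrib_right sum_subtractf)
      also have "\<dots> \<in> P" unfolding yU by (intro mat.subspace_sum mat.subspace_scale P(2) UP)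
      finally show ?thesis .
    qed
    have ysq: "y \<in> square_mats n" unfolding y_def
      by (intro mat.subspace_sum mat.subspace_scale subspace_square_mats square_mats_mult)
        (use w(1) vcol col_vecs_subset_square[OF n] in auto)
    \<comment> \<open>\<open>x\<close> is a combination of commutators, and
      \<open>tr ([a, b] y) = - tr (a [y, b])\<close> is a value of the trace form on
      \<open>P\<close>.\<close>
    have "x \<in> mat.span {a * b - b * a |a b. a \<in> P \<and> b \<in> P}"
      using xP P(3) unfolding comm_span_def by simp
    then have "mat_trace n (x * y) = 0"
    proof (induction rule: mat.span_induct_alt)
      case base then show ?case by (simp add: mat_trace_linear)
    next
      case (step d z z')
      then obtain a b where ab: "a \<in> P" "b \<in> P" "z = a * b - b * a" by auto
      then have sq: "a \<in> square_mats n" "b \<in> square_mats n" using P(1) by auto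
      have "mat_trace n (b * a * y) = mat_trace n (a * (y * b))"
        using mat_trace_comm[of b n "a * y"] sq ysq by (simp add: square_mats_mult mult.assoc)
      then have "mat_trace n (z * y) = - mat_trace n (a * (y * b - b * y))"
        unfolding ab by (simp add: left_diff_distrib right_diff_distrib mat_trace_linear mult.assoc)
      then have "mat_trace n (z * y) = 0" using tr[OF ab(1) stab[OF ab(2)]] by simp
      then show ?case using step by (simp add: distrib_right mat.scale_mult_left mat_trace_linear)
    qed
    then show "(\<Sum>i<m. of_rat (f0 (l i)) * l i) = 0"
      using mat_trace_block_triangular(2)[OF n x v(1,5) w(1-4), of "\<lambda>i. f (l i)"]
      unfolding y_def f_def by simp
  qed
  \<comment> \<open>All eigenvalues are 0, so \<open>x\<close> sends \<open>v i\<close> into the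
    span of strictly earlier vectors.\<close>
  have nil: "x ^ Suc i * v i = 0" if "i < m" for i
    using that
  proof (induction i rule: less_induct)
    case (less i)
    have "x * v i \<in> mat.span (v ` {j. j < i \<and> l j = l i})" using v(5)[OF less.prems] l0[OF
        less.prems] by simp
    then have "x ^ i * (x * v i) \<in> {0}"
    proof (rule mat.mult_left_span[rotated 2])
      fix u assume "u \<in> v ` {j. j < i \<and> l j = l i}"
      then obtain j where j: "j < i" "u = v j" by auto
      have "x ^ i * u = x ^ (i - Suc j) * (x ^ Suc j * v j)"
        unfolding mult.assoc[symmetric] power_add[symmetric] using j by simp
      then show "x ^ i * u \<in> {0}" using less j by simp
    qed simp
    then show ?case by (simp only: power_Suc2 mult.assoc) simp
  qed
  have "x ^ m * v i = 0" if "i < m" for i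
  proof -
    have "x ^ m * v i = x ^ (m - Suc i) * (x ^ Suc i * v i)"
      unfolding mult.assoc[symmetric] power_add[symmetric] using that by simp
    then show ?thesis using nil[OF that] by simp
  qed
  \<comment> \<open>\<open>x ^ m\<close> vanishes on all \<open>n \<times> n\<close> matrices, but
    the unit of the ring is not one of them; multiplying by \<open>x\<close> itself costs one more
    power.\<close>
  then have "x ^ m * (\<Sum>i<m. v i * w i) = 0" by (simp add: sum_distrib_left mult.assoc[symmetric])
  then have "x ^ m * ((\<Sum>i<m. v i * w i) * x) = 0" by (simp add: mult.assoc[symmetric])
  then have "x ^ Suc m = 0" unfolding id(2)[OF x] by (simp only: power_Suc2)
  then show ?thesis by blast
qed

text \<open>Every element is nilpotent, so long words vanish by Engel's theorem, while
  \<open>P = [P, P]\<close> consists of combinations of arbitrarily long words.\<close>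

lemma perfect_trace_form_0_alg_closed:
  fixes P :: "'k::{alg_closed_field,field_char_0} cfmat set"
  assumes P: "P \<subseteq> square_mats n" "mat.subspace P" "P = comm_span mat_scale P P"
    and tr: "\<And>a b. a \<in> P \<Longrightarrow> b \<in> P \<Longrightarrow> mat_trace n (a * b) = 0"
  shows "P = {0}"
proof -
  have "\<exists>N. mat.nilpotent_words N P"
  proof (rule mat.engel[OF P(2)])
    show "mat.fin_dim P" using P(1) fin_dim_square_mats mat.fin_dim_subset by blast
    show "x * y - y * x \<in> P" if "x \<in> P" "y \<in> P" for x y
      using mat.comm_spanI[OF that] P(3) by simp
  qed (rule trace_form_0_imp_nilpotent[OF P tr])
  then show ?thesis using mat.perfect_nilpotent_words_eq_0[OF _ P(2)] P(3) by blast
qed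

section \<open>Passage from the algebraic closure to the base field\<close>

lift_definition mat_to_ac :: "'k::field cfmat \<Rightarrow> 'k alg_closure cfmat" is "\<lambda>f i j. to_ac (f i j)"
  by simp

lemma entry_mat_to_ac [simp]: "entry (mat_to_ac x) i j = to_ac (entry x i j)"
  by transfer simp

lemma mat_to_ac_simps: "mat_to_ac (x + y) = mat_to_ac x + mat_to_ac y" "mat_to_ac 0 = 0"
  "mat_to_ac (x - y) = mat_to_ac x - mat_to_ac y"
  "mat_to_ac (mat_scale c x) = mat_scale (to_ac c) (mat_to_ac x)"
  by (auto intro!: cfmat_eqI)

lemma mat_to_ac_mult: "mat_to_ac (x * y) = mat_to_ac x * mat_to_ac y"
proof (rule cfmat_eqI)
  fix i j
  have "entry (mat_to_ac x * mat_to_ac y) i j = (\<Sum>k | entry y k j \<noteq> 0. entry (mat_to_ac x) i k *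
      entry (mat_to_ac y) k j)"
    by (rule entry_mult_eq) (auto simp: finite_entry)
  moreover have "entry (x * y) i j = (\<Sum>k | entry y k j \<noteq> 0. entry x i k * entry y k j)"
    by (rule entry_mult_eq) (auto simp: finite_entry)
  ultimately show "entry (mat_to_ac (x * y)) i j = entry (mat_to_ac x * mat_to_ac y) i j"
    by (simp add: to_ac_sum)
qed

text \<open>The hypotheses pass by bilinearity to the span of \<open>P\<close> over the algebraic
  closure, and \<open>to_ac\<close> is injective on entries.\<close>

theorem perfect_trace_form_0:
  fixes P :: "'k::field_char_0 cfmat set"
  assumes P: "P \<subseteq> square_mats n" "mat.subspace P" "P = comm_span mat_scale P P"
    and tr: "\<And>a b. a \<in> P \<Longrightarrow> b \<in> P \<Longrightarrow> mat_trace n (a * b) = 0"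
  shows "P = {0}"
proof -
  let ?Q = "mat.span (mat_to_ac ` P)"
  have "?Q = {0}"
  proof (rule perfect_trace_form_0_alg_closed[of _ n])
    show "?Q \<subseteq> square_mats n"
      by (rule mat.span_minimal[OF _ subspace_square_mats]) (use P(1) in \<open>auto simp:
          square_mats_def\<close>)
    show "?Q = comm_span mat_scale ?Q ?Q"
    proof
      have "mat_to_ac x \<in> comm_span mat_scale ?Q ?Q" if "x \<in> mat.span {a * b - b * a |a b. a \<in> P \<and> b
          \<in> P}" for x
        using that
      proof (induction rule: mat.span_induct_alt)
        case base then show ?case by (simp add: mat_to_ac_simps mat.subspace_0)
      next
        case (step c z y)
        then obtain a b where ab: "a \<in> P" "b \<in> P" "z = a * b - b * a" by auto
        have "mat_to_ac z = mat_to_ac a * mat_to_ac b - mat_to_ac b * mat_to_ac a"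
          unfolding ab by (simp add: mat_to_ac_simps mat_to_ac_mult)
        then have "mat_to_ac z \<in> comm_span mat_scale ?Q ?Q"
          using ab by (auto intro!: mat.comm_spanI mat.span_base)
        then show ?case using step by (simp add: mat_to_ac_simps mat.subspace_add
            mat.subspace_scale)
      qed
      then have "mat_to_ac ` P \<subseteq> comm_span mat_scale ?Q ?Q" using P(3) unfolding comm_span_def by
          auto
      then show "?Q \<subseteq> comm_span mat_scale ?Q ?Q" by (rule mat.span_minimal) simp
      have "x * y - y * x \<in> ?Q" if "x \<in> mat_to_ac ` P" "y \<in> mat_to_ac ` P" for x y
      proof -
        from that obtain a b where "x = mat_to_ac a" "y = mat_to_ac b" "a \<in> P" "b \<in> P" by blast
        then have "x * y - y * x = mat_to_ac (a * b - b * a)" "a * b - b * a \<in> P"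
          using mat.comm_spanI[of a P b P] P(3) by (simp_all add: mat_to_ac_simps mat_to_ac_mult)
        then show ?thesis by (auto intro: mat.span_base)
      qed
      from mat.commutator_span[OF this mat.subspace_span]
      show "comm_span mat_scale ?Q ?Q \<subseteq> ?Q" by (intro mat.comm_span_subset) auto
    qed
    show "mat_trace n (x * y) = 0" if "x \<in> ?Q" "y \<in> ?Q" for x y
    proof -
      have "x * y \<in> {z. mat_trace n z = 0}"
      proof (rule mat.mult_span[OF _ _ that])
        show "mat.subspace {z. mat_trace n z = 0}" by (auto simp: mat.subspace_def mat_trace_linear)
        fix x y assume "x \<in> mat_to_ac ` P" "y \<in> mat_to_ac ` P"
        then obtain a b where ab: "x = mat_to_ac a" "y = mat_to_ac b" "a \<in> P" "b \<in> P" by auto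
        have "mat_trace n (mat_to_ac z) = to_ac (mat_trace n z)" for z :: "'k cfmat"
          by (simp add: mat_trace_def to_ac_sum)
        then show "x * y \<in> {z. mat_trace n z = 0}" using tr[OF ab(3,4)] ab
          by (simp add: mat_to_ac_mult[symmetric])
      qed
      then show ?thesis by simp
    qed
  qed simp
  then have "mat_to_ac x = 0" if "x \<in> P" for x using that mat.span_base[of "mat_to_ac x" "mat_to_ac
      ` P"] by auto
  then have "x = 0" if "x \<in> P" for x
    using that by (intro cfmat_eqI) (metis entry_mat_to_ac entry_simps(1) to_ac_eq_0_iff)
  then show ?thesis using mat.subspace_0[OF P(2)] by auto
qed

section \<open>Dual bases and matrix representations\<close>

text \<open>The images of the powers of \<open>G\<close> stabilise, so
  \<open>G^k w = G^k (G u)\<close> for some \<open>u\<close>, and injectivity cancels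
  \<open>G^k\<close>.\<close>

lemma injective_square_mat_surj:
  assumes G: "G \<in> square_mats m" and inj: "\<And>u. u \<in> col_vecs m \<Longrightarrow> G * u = 0 \<Longrightarrow> u = 0"
    and w: "w \<in> col_vecs m"
  shows "\<exists>u\<in>col_vecs m. G * u = w"
proof (cases "0 < m")
  case False
  then have "w = 0" using w by (intro cfmat_eqI) (auto simp: col_vecs_def)
  then show ?thesis using w by (intro bexI[of _ 0]) auto
next
  case True
  have pow: "G ^ k * u \<in> col_vecs m" if "u \<in> col_vecs m" for k u
    using that by (induction k) (auto simp: mult.assoc square_mats_mult_col[OF G])
  define U where "U k = (\<lambda>u. G ^ k * u) ` col_vecs m" for k
  obtain k where k: "U (Suc k) = U k"
  proof (rule mat.decreasing_subspaces_stabilise[of U])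
    show "mat.fin_dim (U 0)" using col_vecs_subset_square[OF True]
      by (intro mat.fin_dim_subset[OF fin_dim_square_mats[of m]]) (auto simp: U_def)
    show "mat.subspace (U n)" for n
      unfolding mat.subspace_def
    proof (intro conjI ballI allI)
      show "0 \<in> U n" unfolding U_def using mat.subspace_0[OF subspace_col_vecs] by (intro
          image_eqI[of _ _ 0]) auto
    next
      fix x y assume "x \<in> U n" "y \<in> U n"
      then obtain a b where "x = G ^ n * a" "y = G ^ n * b" "a \<in> col_vecs m" "b \<in> col_vecs m"
        unfolding U_def by blast
      then show "x + y \<in> U n" unfolding U_def
        by (intro image_eqI[of _ _ "a + b"]) (auto simp: distrib_left mat.subspace_add[OF
            subspace_col_vecs])
    next
      fix c x assume "x \<in> U n"
      then obtain a where "x = G ^ n * a" "a \<in> col_vecs m" unfolding U_def by blast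
      then show "mat_scale c x \<in> U n" unfolding U_def
        by (intro image_eqI[of _ _ "mat_scale c a"])
          (auto simp: mat.scale_mult_right mat.subspace_scale[OF subspace_col_vecs])
    qed
    show "U (Suc n) \<subseteq> U n" for n
      unfolding U_def by (auto simp only: power_Suc2 mult.assoc intro!: imageI
          square_mats_mult_col[OF G])
  qed
  have cancel: "a = 0" if "a \<in> col_vecs m" "G ^ k * a = 0" for a k
    using that
  proof (induction k)
    case (Suc k)
    then have "G * (G ^ k * a) = 0" by (simp add: mult.assoc)
    then have "G ^ k * a = 0" using inj pow Suc.prems(1) by blast
    then show ?case using Suc by blast
  qed simp
  have "G ^ k * w \<in> U (Suc k)" using w unfolding k by (auto simp: U_def)
  then obtain u where u: "u \<in> col_vecs m" "G ^ k * w = G ^ k * (G * u)"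
    unfolding U_def by (auto simp only: power_Suc2 mult.assoc)
  then have "G ^ k * (w - G * u) = 0" by (simp add: right_diff_distrib)
  then have "w - G * u = 0"
    by (rule cancel[rotated]) (use w u square_mats_mult_col[OF G] mat.subspace_diff[OF
        subspace_col_vecs] in auto)
  then show ?thesis using u(1) by auto
qed

context k_algebra
begin

text \<open>Nondegeneracy makes the Gram matrix of a basis injective, hence surjective; the
  preimages of the unit vectors are the coordinates of the dual basis. Bilinearity is asked for on
  \<open>U\<close> alone because the trace form is shown to be bilinear only on the Lie
  algebra.\<close>

lemma dual_bases:
  assumes U: "fin_dim U" "subspace U"
    and B: "\<And>x y z. x \<in> U \<Longrightarrow> y \<in> U \<Longrightarrow> z \<in> U \<Longrightarrow> B (x + y) z = B x z + B y z"
      "\<And>c x y. x \<in> U \<Longrightarrow> y \<in> U \<Longrightarrow> B (scale c x) y = c * B x y"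
      "\<And>x y z. x \<in> U \<Longrightarrow> y \<in> U \<Longrightarrow> z \<in> U \<Longrightarrow> B x (y + z) = B x y + B x z"
      "\<And>c x y. x \<in> U \<Longrightarrow> y \<in> U \<Longrightarrow> B x (scale c y) = c * B x y"
    and nondeg: "\<And>y. y \<in> U \<Longrightarrow> (\<And>x. x \<in> U \<Longrightarrow> B x y = 0) \<Longrightarrow> y = 0"
  obtains m :: nat and e e' where
    "\<And>i. i < m \<Longrightarrow> e i \<in> U" "\<And>i. i < m \<Longrightarrow> e' i \<in> U"
    "\<And>i j. i < m \<Longrightarrow> j < m \<Longrightarrow> B (e i) (e' j) = (if i = j then 1 else 0)"
    "\<And>x. x \<in> U \<Longrightarrow> x = (\<Sum>i<m. scale (B x (e' i)) (e i))"
    "\<And>x. x \<in> U \<Longrightarrow> x = (\<Sum>i<m. scale (B (e i) x) (e' i))"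
proof -
  obtain S where S: "finite S" "S \<subseteq> U" "independent S" "span S = U"
    using fin_dim_basis[OF U] by metis
  define m where "m = card S"
  obtain e where e: "bij_betw e {..<m} S"
    using ex_bij_betw_nat_finite[OF S(1)] unfolding m_def lessThan_atLeast0 by blast
  have eU: "e i \<in> U" if "i < m" for i using e that S(2) by (auto simp: bij_betw_def)
  have B0: "B 0 y = 0" "B y 0 = 0" if "y \<in> U" for y
    using B(2)[OF that that, of 0] B(4)[OF that that, of 0] by simp_all
  have Bsum1: "B (\<Sum>i\<in>A. scale (c i) (f i)) y = (\<Sum>i\<in>A. c i * B (f i) y)"
    if "\<And>i. i \<in> A \<Longrightarrow> f i \<in> U" "y \<in> U" for A :: "nat set" and c f y
    using that
  proof (induction A rule: infinite_finite_induct)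
    case (insert i A)
    have "f i \<in> U" "scale (c i) (f i) \<in> U" "(\<Sum>i\<in>A. scale (c i) (f i)) \<in> U"
      using insert.prems by (auto intro!: subspace_sum[OF U(2)] subspace_scale[OF U(2)])
    then show ?case using insert by (simp add: B(1)[of "scale (c i) (f i)"] B(2))
  qed (simp_all add: B0)
  have Bsum2: "B y (\<Sum>i\<in>A. scale (c i) (f i)) = (\<Sum>i\<in>A. c i * B y (f i))"
    if "\<And>i. i \<in> A \<Longrightarrow> f i \<in> U" "y \<in> U" for A :: "nat set" and c f y
    using that
  proof (induction A rule: infinite_finite_induct)
    case (insert i A)
    have "f i \<in> U" "scale (c i) (f i) \<in> U" "(\<Sum>i\<in>A. scale (c i) (f i)) \<in> U"
      using insert.prems by (auto intro!: subspace_sum[OF U(2)] subspace_scale[OF U(2)])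
    then show ?case using insert by (simp add: B(3)[of y "scale (c i) (f i)"] B(4))
  qed (simp_all add: B0)
  have expand: "\<exists>c. x = (\<Sum>i<m. scale (c i) (e i))" if "x \<in> U" for x
  proof -
    have "x = (\<Sum>b\<in>S. scale (representation S x b) b)"
      using sum_representation_eq[OF S(3) _ S(1)] that S(4) by simp
    also have "\<dots> = (\<Sum>i<m. scale (representation S x (e i)) (e i))"
      by (rule sum.reindex_bij_betw[OF e, symmetric])
    finally show ?thesis by (rule exI[of _ "\<lambda>i. representation S x (e i)"])
  qed
  have indep: "c i = 0" if "(\<Sum>i<m. scale (c i) (e i)) = 0" "i < m" for c i
  proof -
    let ?c = "\<lambda>b. c (the_inv_into {..<m} e b)"
    have inv: "the_inv_into {..<m} e (e i) = i" if "i < m" for i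
      using e that by (auto simp: bij_betw_def intro: the_inv_into_f_f)
    have "(\<Sum>b\<in>S. scale (?c b) b) = (\<Sum>i<m. scale (?c (e i)) (e i))"
      by (rule sum.reindex_bij_betw[OF e, symmetric])
    also have "\<dots> = 0" using that(1) inv by simp
    finally have "\<forall>b\<in>S. ?c b = 0" using S(1,3) by (auto simp: dependent_finite)
    moreover have "e i \<in> S" using e that(2) by (auto simp: bij_betw_def)
    ultimately show ?thesis using inv[OF that(2)] by metis
  qed
  define G :: "'k cfmat" where "G = (\<Sum>i<m. \<Sum>j<m. mat_scale (B (e i) (e j)) (unit_mat i j))"
  have Gsq: "G \<in> square_mats m" unfolding G_def
    by (intro mat.subspace_sum mat.subspace_scale subspace_square_mats unit_mat_in(1)) auto
  have Gent: "entry G i j = B (e i) (e j)" if "i < m" "j < m" for i j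
  proof -
    have "entry G i j = (\<Sum>a<m. \<Sum>b<m. if i = a \<and> j = b then B (e a) (e b) else 0)"
      unfolding G_def entry_sum by (simp add: if_distrib cong: if_cong)
    also have "\<dots> = (\<Sum>a<m. if i = a then B (e a) (e j) else 0)"
      by (rule sum.cong) (use that in auto)
    finally show ?thesis using that by simp
  qed
  have Gu: "entry (G * u) i 0 = B (e i) (\<Sum>j<m. scale (entry u j 0) (e j))" if "i < m" for i u
    unfolding entry_mult_square[OF Gsq] using that eU
    by (subst Bsum2) (auto simp: Gent mult.commute intro!: sum.cong)
  have zero: "y = 0" if "y \<in> U" "\<And>i. i < m \<Longrightarrow> B (e i) y = 0" for y
  proof (rule nondeg[OF that(1)])
    fix x assume "x \<in> U"
    then obtain c where "x = (\<Sum>i<m. scale (c i) (e i))" using expand by blast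
    then show "B x y = 0" using Bsum1[of "{..<m}" e y c] eU that by simp
  qed
  have Ginj: "u = 0" if u: "u \<in> col_vecs m" "G * u = 0" for u
  proof -
    have "(\<Sum>j<m. scale (entry u j 0) (e j)) = 0"
      by (rule zero) (use Gu[of _ u] u(2) eU in \<open>auto intro!: subspace_sum[OF U(2)]
          subspace_scale[OF U(2)]\<close>)
    then have "entry u j 0 = 0" if "j < m" for j using indep[of "\<lambda>j. entry u j 0"] that by simp
    then show ?thesis using u(1) by (intro cfmat_eqI) (auto simp: col_vecs_def)
  qed
  have "\<exists>y\<in>U. \<forall>i<m. B (e i) y = (if i = j then 1 else 0)" if j: "j < m" for j
  proof -
    obtain u where u: "u \<in> col_vecs m" "G * u = unit_mat j 0"
      using injective_square_mat_surj[OF Gsq Ginj unit_mat_in(2)[OF j]] by auto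
    then show ?thesis using Gu[of _ u] eU
      by (intro bexI[of _ "\<Sum>j<m. scale (entry u j 0) (e j)"])
        (auto intro!: subspace_sum[OF U(2)] subspace_scale[OF U(2)])
  qed
  then obtain e' where e': "\<And>j. j < m \<Longrightarrow> e' j \<in> U" "\<And>i j. i < m \<Longrightarrow> j < m \<Longrightarrow> B (e i) (e' j) = (if i = j
      then 1 else 0)"
    by metis
  have x1: "x = (\<Sum>i<m. scale (B x (e' i)) (e i))" if "x \<in> U" for x
  proof -
    obtain c where c: "x = (\<Sum>i<m. scale (c i) (e i))" using expand[OF \<open>x \<in> U\<close>] by blast
    have "B x (e' j) = c j" if j: "j < m" for j
    proof -
      have "B x (e' j) = (\<Sum>i<m. c i * B (e i) (e' j))"
        unfolding c by (rule Bsum1) (use eU e'(1) j in auto)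
      also have "\<dots> = (\<Sum>i<m. if i = j then c j else 0)"
        by (rule sum.cong) (use e'(2) j in auto)
      finally show ?thesis using j by simp
    qed
    then show ?thesis using c by simp
  qed
  have x2: "x = (\<Sum>i<m. scale (B (e i) x) (e' i))" if "x \<in> U" for x
  proof -
    let ?y = "\<Sum>i<m. scale (B (e i) x) (e' i)"
    have yU: "?y \<in> U" using e' by (auto intro!: subspace_sum[OF U(2)] subspace_scale[OF U(2)])
    \<comment> \<open>The difference is written with the scalar -1 because the hypotheses on
      \<open>B\<close> speak of sums and scalar multiples.\<close>
    have "B (e i) (x + scale (-1) ?y) = 0" if i: "i < m" for i
    proof -
      have "B (e i) ?y = (\<Sum>j<m. B (e j) x * B (e i) (e' j))"
        by (rule Bsum2) (use eU e'(1) i in auto)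
      also have "\<dots> = (\<Sum>j<m. if j = i then B (e i) x else 0)"
        by (rule sum.cong) (use e'(2) i in auto)
      finally have "B (e i) ?y = B (e i) x" using i by simp
      then show ?thesis
        using B(3)[OF eU[OF i] \<open>x \<in> U\<close> subspace_scale[OF U(2) yU], of "-1"] B(4)[OF eU[OF i] yU, of
            "-1"]
        by simp
    qed
    then have "x + scale (-1) ?y = 0"
      by (intro zero subspace_add[OF U(2) \<open>x \<in> U\<close> subspace_scale[OF U(2) yU]])
    then show ?thesis by simp
  qed
  show ?thesis by (rule that[of m e e', OF eU e' x1 x2])
qed

definition endo_on :: "'b set \<Rightarrow> ('b \<Rightarrow> 'b) \<Rightarrow> bool" where
  "endo_on V T \<longleftrightarrow> (\<forall>v\<in>V. T v \<in> V) \<and> (\<forall>u\<in>V. \<forall>v\<in>V. T (u + v) = T u + T v) \<and>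
     (\<forall>c. \<forall>v\<in>V. T (scale c v) = scale c (T v))"

text \<open>The matrices of the endomorphisms of \<open>V\<close> in some basis, described by the
  properties used later so that the basis can be forgotten. The congruence clause expresses that
  only values on \<open>V\<close> count.\<close>

definition matrix_rep :: "'b set \<Rightarrow> nat \<Rightarrow> (('b \<Rightarrow> 'b) \<Rightarrow> 'k cfmat) \<Rightarrow> bool" where
  "matrix_rep V n M \<longleftrightarrow> (\<forall>T. M T \<in> square_mats n) \<and>
    (\<forall>T S. endo_on V T \<and> endo_on V S \<longrightarrow> M (\<lambda>v. T v + S v) = M T + M S) \<and>
    (\<forall>c T. endo_on V T \<longrightarrow> M (\<lambda>v. scale c (T v)) = mat_scale c (M T)) \<and>
    (\<forall>T S. endo_on V T \<and> endo_on V S \<longrightarrow> M (\<lambda>v. T (S v)) = M T * M S) \<and>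
    (\<forall>T S. (\<forall>v\<in>V. T v = S v) \<longrightarrow> M T = M S) \<and>
    (\<forall>T. endo_on V T \<and> M T = 0 \<longrightarrow> (\<forall>v\<in>V. T v = 0))"

lemma matrix_rep_exists:
  assumes V: "fin_dim V" "subspace V"
  shows "\<exists>n M. matrix_rep V n M"
proof -
  obtain S where S: "finite S" "S \<subseteq> V" "independent S" "span S = V"
    using fin_dim_basis[OF V] by metis
  define n where "n = card S"
  obtain e where e: "bij_betw e {..<n} S"
    using ex_bij_betw_nat_finite[OF S(1)] unfolding n_def lessThan_atLeast0 by blast
  have eV: "e i \<in> V" if "i < n" for i using e that S(2) by (auto simp: bij_betw_def)
  define r where "r v i = representation S v (e i)" for v i
  have radd: "r (u + v) i = r u i + r v i" if "u \<in> V" "v \<in> V" for u v i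
    unfolding r_def using that S(3,4) by (simp add: representation_add)
  have rscale: "r (scale c v) i = c * r v i" if "v \<in> V" for c v i
    unfolding r_def using that S(3,4) by (simp add: representation_scale)
  have r0: "r 0 i = 0" for i unfolding r_def by (simp add: representation_zero)
  have expand: "v = (\<Sum>i<n. scale (r v i) (e i))" if "v \<in> V" for v
  proof -
    have "v = (\<Sum>b\<in>S. scale (representation S v b) b)"
      using sum_representation_eq[OF S(3) _ S(1)] that S(4) by simp
    also have "\<dots> = (\<Sum>i<n. scale (r v i) (e i))" unfolding r_def
      by (rule sum.reindex_bij_betw[OF e, symmetric])
    finally show ?thesis .
  qed
  define M :: "('b \<Rightarrow> 'b) \<Rightarrow> 'k cfmat" where "M T = (\<Sum>i<n. \<Sum>j<n. mat_scale (r (T (e j)) i) (unit_mat i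
      j))" for T
  have Msq: "M T \<in> square_mats n" for T unfolding M_def
    by (intro mat.subspace_sum mat.subspace_scale subspace_square_mats unit_mat_in(1)) auto
  have Ment: "entry (M T) i j = r (T (e j)) i" if "i < n" "j < n" for i j T
  proof -
    have "entry (M T) i j = (\<Sum>a<n. \<Sum>b<n. if i = a \<and> j = b then r (T (e b)) a else 0)"
      unfolding M_def entry_sum by (simp add: if_distrib cong: if_cong)
    also have "\<dots> = (\<Sum>a<n. if i = a then r (T (e j)) a else 0)"
      by (rule sum.cong) (use that in auto)
    finally show ?thesis using that by simp
  qed
  have eqI: "x = y" if "x \<in> square_mats n" "y \<in> square_mats n" "\<And>i j. i < n \<Longrightarrow> j < n \<Longrightarrow> entry x i j =
      entry y i j" for x y :: "'k cfmat"
  proof (rule cfmat_eqI)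
    fix i j show "entry x i j = entry y i j"
      using that entry_square_mats[OF that(1), of i j] entry_square_mats[OF that(2), of i j] by
          (cases "i < n \<and> j < n") auto
  qed
  have Tsum: "T (\<Sum>i\<in>A. scale (c i) (f i)) = (\<Sum>i\<in>A. scale (c i) (T (f i)))"
    if T: "endo_on V T" and f: "\<And>i. i \<in> A \<Longrightarrow> f i \<in> V" for T c f and A :: "nat set"
  proof -
    have "T 0 = 0" using T subspace_0[OF V(2)] unfolding endo_on_def by (metis scale_zero_left)
    then show ?thesis using f
    proof (induction A rule: infinite_finite_induct)
      case (insert i A)
      have "(\<Sum>i\<in>A. scale (c i) (f i)) \<in> V" "scale (c i) (f i) \<in> V" "f i \<in> V"
        using insert.prems(2) by (auto intro!: subspace_sum[OF V(2)] subspace_scale[OF V(2)])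
      then show ?case using insert T unfolding endo_on_def by auto
    qed auto
  qed
  have rsum: "r (\<Sum>i\<in>A. scale (c i) (f i)) k = (\<Sum>i\<in>A. c i * r (f i) k)"
    if f: "\<And>i. i \<in> A \<Longrightarrow> f i \<in> V" for c f k and A :: "nat set"
    using f
  proof (induction A rule: infinite_finite_induct)
    case (insert i A)
    have "(\<Sum>i\<in>A. scale (c i) (f i)) \<in> V" "scale (c i) (f i) \<in> V" "f i \<in> V"
      using insert.prems by (auto intro!: subspace_sum[OF V(2)] subspace_scale[OF V(2)])
    then show ?case using insert by (simp add: radd rscale)
  qed (auto simp: r0)
  have "matrix_rep V n M" unfolding matrix_rep_def
  proof (intro conjI allI impI ballI; (elim conjE)?)
    fix T S assume TS: "endo_on V T" "endo_on V S"
    then have V': "T (e j) \<in> V" "S (e j) \<in> V" if "j < n" for j using eV[OF that] by (auto simp: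
        endo_on_def)
    show "M (\<lambda>v. T v + S v) = M T + M S"
      by (rule eqI[OF Msq mat.subspace_add[OF subspace_square_mats Msq Msq]]) (use V' in \<open>simp add:
          Ment radd\<close>)
    show "M (\<lambda>v. T (S v)) = M T * M S"
    proof (rule eqI[OF Msq square_mats_mult[OF Msq Msq]])
      fix i j assume ij: "i < n" "j < n"
      have "T (S (e j)) = T (\<Sum>k<n. scale (r (S (e j)) k) (e k))" using expand[OF V'(2)[OF ij(2)]] by
          simp
      also have "\<dots> = (\<Sum>k<n. scale (r (S (e j)) k) (T (e k)))" by (rule Tsum[OF TS(1)]) (use eV in
          auto)
      finally have "r (T (S (e j))) i = (\<Sum>k<n. r (S (e j)) k * r (T (e k)) i)"
        using rsum[of "{..<n}" "\<lambda>k. T (e k)"] V'(1) by simp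
      then show "entry (M (\<lambda>v. T (S v))) i j = entry (M T * M S) i j"
        using ij by (simp add: entry_mult_square[OF Msq] Ment mult.commute)
    qed
  next
    fix c T assume T: "endo_on V T"
    then have V': "T (e j) \<in> V" if "j < n" for j using eV[OF that] by (auto simp: endo_on_def)
    show "M (\<lambda>v. scale c (T v)) = mat_scale c (M T)"
      by (rule eqI[OF Msq mat.subspace_scale[OF subspace_square_mats Msq]]) (use V' in \<open>simp add:
          Ment rscale\<close>)
  next
    fix T S :: "'b \<Rightarrow> 'b" assume "\<forall>v\<in>V. T v = S v"
    then show "M T = M S" unfolding M_def using eV by simp
  next
    fix T v assume T: "endo_on V T" "M T = 0" and v: "v \<in> V"
    have V': "T (e j) \<in> V" if "j < n" for j using eV[OF that] T(1) by (auto simp: endo_on_def)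
    have "r (T (e j)) i = 0" if "i < n" "j < n" for i j using Ment[OF that, of T] T(2) by simp
    then have "T (e j) = 0" if "j < n" for j using expand[OF V'[OF that]] that by simp
    moreover have "T v = (\<Sum>k<n. scale (r v k) (T (e k)))"
      by (subst expand[OF v], rule Tsum[OF T(1)]) (use eV in auto)
    ultimately show "T v = 0" by simp
  qed (rule Msq)
  then show ?thesis by blast
qed

end

section \<open>Modules over semisimple Lie algebras\<close>

definition ad :: "'a::ring \<Rightarrow> 'a \<Rightarrow> 'a" where
  "ad x v = x * v - v * x"

text \<open>For a matrix representation of \<open>g\<close> itself this is the Killing form.\<close>

definition trace_form :: "nat \<Rightarrow> (('a::ring \<Rightarrow> 'a) \<Rightarrow> 'k::field cfmat) \<Rightarrow> 'a \<Rightarrow> 'a \<Rightarrow> 'k" where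
  "trace_form n M x y = mat_trace n (M (ad x) * M (ad y))"

locale char_0_k_algebra = k_algebra scale
  for scale :: "'k::field_char_0 \<Rightarrow> 'b::ring \<Rightarrow> 'b"
begin

definition lie_subalgebra :: "'b set \<Rightarrow> bool" where
  "lie_subalgebra g \<longleftrightarrow> subspace g \<and> (\<forall>x\<in>g. \<forall>y\<in>g. ad x y \<in> g)"

definition ad_module :: "'b set \<Rightarrow> 'b set \<Rightarrow> bool" where
  "ad_module g V \<longleftrightarrow> subspace V \<and> fin_dim V \<and> (\<forall>x\<in>g. \<forall>v\<in>V. ad x v \<in> V)"

lemma lie_ideal_alt: "lie_ideal scale g h \<longleftrightarrow> subspace h \<and> h \<subseteq> g \<and> (\<forall>x\<in>g. \<forall>y\<in>h. ad x y \<in> h)"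
  unfolding lie_ideal_def ad_def using comm_spanI comm_span_subset[of g h h] by blast

lemma ad_scale: "ad (scale c x) y = scale c (ad x y)" "ad x (scale c y) = scale c (ad x y)"
  by (simp_all add: ad_def scale_mult_left scale_mult_right scale_right_diff_distrib)

lemma ad_add: "ad (x + y) z = ad x z + ad y z" "ad x (y + z) = ad x y + ad x z"
  by (simp_all add: ad_def algebra_simps)

lemma ad_0: "ad x 0 = 0" "ad 0 x = 0"
  by (simp_all add: ad_def)

lemma ad_minus: "ad (- x) y = - ad x y" "ad x (- y) = - ad x y" "ad y x = - ad x y"
  by (simp_all add: ad_def)

lemma comm_span_ad: "comm_span scale S T = span {ad x y |x y. x \<in> S \<and> y \<in> T}"
  by (simp add: comm_span_def ad_def)

lemma comm_span_adI: "x \<in> S \<Longrightarrow> y \<in> T \<Longrightarrow> ad x y \<in> comm_span scale S T"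
  unfolding ad_def by (rule comm_spanI)

lemma comm_span_ad_subset:
  "(\<And>x y. x \<in> S \<Longrightarrow> y \<in> T \<Longrightarrow> ad x y \<in> U) \<Longrightarrow> subspace U \<Longrightarrow> comm_span scale S T \<subseteq> U"
  unfolding ad_def by (rule comm_span_subset)

lemma ad_sum: "ad (sum f A) z = (\<Sum>a\<in>A. ad (f a) z)" "ad z (sum f A) = (\<Sum>a\<in>A. ad z (f a))"
  by (simp_all add: ad_def sum_distrib_left sum_distrib_right sum_subtractf)

lemma ad_ad: "ad (ad x y) v = ad x (ad y v) - ad y (ad x v)"
  by (simp add: ad_def algebra_simps)

context
  fixes g V :: "'b set" and n :: nat and M :: "('b \<Rightarrow> 'b) \<Rightarrow> 'k cfmat"
  assumes g: "lie_subalgebra g" and V: "ad_module g V" and M: "matrix_rep V n M"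
begin

lemma endo_ad: "x \<in> g \<Longrightarrow> endo_on V (ad x)"
  using V unfolding ad_module_def endo_on_def by (auto simp: ad_scale ad_add)

lemma matrix_rep_square: "M T \<in> square_mats n"
  using M unfolding matrix_rep_def by blast

lemma matrix_rep_ad:
  assumes "x \<in> g" "y \<in> g"
  shows "M (ad (x + y)) = M (ad x) + M (ad y)" "M (ad (scale c x)) = mat_scale c (M (ad x))"
    "M (ad (ad x y)) = M (ad x) * M (ad y) - M (ad y) * M (ad x)"
proof -
  have "ad (x + y) = (\<lambda>v. ad x v + ad y v)" by (rule ext) (rule ad_add)
  then show "M (ad (x + y)) = M (ad x) + M (ad y)"
    using M endo_ad[OF assms(1)] endo_ad[OF assms(2)] unfolding matrix_rep_def by simp
  have "ad (scale c x) = (\<lambda>v. scale c (ad x v))" for c x by (rule ext) (rule ad_scale)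
  then show "M (ad (scale c x)) = mat_scale c (M (ad x))"
    using M endo_ad[OF assms(1)] unfolding matrix_rep_def by simp
  have sg: "subspace V" using V by (simp add: ad_module_def)
  \<comment> \<open>\<open>matrix_rep\<close> has clauses for sums and scalar multiples, so the
    difference in \<open>ad_ad\<close> is written as a sum with the scalar -1.\<close>
  let ?T = "\<lambda>v. ad x (ad y v)" and ?S = "\<lambda>v. scale (-1) (ad y (ad x v))"
  have comp: "M (\<lambda>v. ad x (ad y v)) = M (ad x) * M (ad y)" if "x \<in> g" "y \<in> g" for x y
    using M endo_ad[OF that(1)] endo_ad[OF that(2)] unfolding matrix_rep_def by blast
  have endo: "endo_on V (\<lambda>v. ad x (ad y v))" if "x \<in> g" "y \<in> g" for x y
    using endo_ad[OF that(1)] endo_ad[OF that(2)] unfolding endo_on_def by simp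
  have endo': "endo_on V ?S"
    using endo[OF assms(2,1)] subspace_neg[OF sg] unfolding endo_on_def
    by (auto simp: scale_right_distrib scale_left_commute)
  have "M ?S = mat_scale (-1) (M (\<lambda>v. ad y (ad x v)))"
    using M endo[OF assms(2,1)] unfolding matrix_rep_def by blast
  moreover have "ad (ad x y) = (\<lambda>v. ?T v + ?S v)"
    by (rule ext) (simp add: ad_ad)
  moreover have "M (\<lambda>v. ?T v + ?S v) = M ?T + M ?S"
    using M endo[OF assms] endo' unfolding matrix_rep_def by blast
  ultimately show "M (ad (ad x y)) = M (ad x) * M (ad y) - M (ad y) * M (ad x)"
    using comp[OF assms] comp[OF assms(2,1)] by simp
qed

lemma trace_form_bilinear:
  assumes "x \<in> g" "y \<in> g" "z \<in> g"
  shows "trace_form n M (x + y) z = trace_form n M x z + trace_form n M y z"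
    "trace_form n M z (x + y) = trace_form n M z x + trace_form n M z y"
    "trace_form n M (scale c x) z = c * trace_form n M x z"
    "trace_form n M z (scale c x) = c * trace_form n M z x"
  unfolding trace_form_def using assms
  by (simp_all add: matrix_rep_ad distrib_left distrib_right mat_trace_linear
    mat.scale_mult_left mat.scale_mult_right)

lemma trace_form_sym: "trace_form n M x y = trace_form n M y x"
  unfolding trace_form_def by (rule mat_trace_comm[OF matrix_rep_square matrix_rep_square])

text \<open>By cyclicity \<open>tr (Y X Z) = tr (X Z Y)\<close>, which turns
  \<open>tr ([X, Y] Z)\<close> into \<open>tr (X [Y, Z])\<close>.\<close>

lemma trace_form_invariant:
  assumes "x \<in> g" "y \<in> g" "z \<in> g"
  shows "trace_form n M (ad x y) z = trace_form n M x (ad y z)"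
proof -
  have "mat_trace n (M (ad y) * M (ad x) * M (ad z)) = mat_trace n (M (ad x) * M (ad z) * M (ad y))"
    using mat_trace_comm[of "M (ad y)" n "M (ad x) * M (ad z)"]
    by (simp add: matrix_rep_square square_mats_mult mult.assoc)
  then show ?thesis unfolding trace_form_def using assms
    by (simp add: matrix_rep_ad left_diff_distrib right_diff_distrib mat_trace_linear mult.assoc)
qed

text \<open>By invariance \<open>B([a, x], y) = - B(x, [a, y])\<close>, and \<open>[a, y]\<close> is
  again in \<open>J\<close>.\<close>

lemma orthogonal_lie_ideal:
  assumes I: "lie_ideal scale g I" and J: "lie_ideal scale g J"
  shows "lie_ideal scale g {x\<in>I. \<forall>y\<in>J. trace_form n M x y = 0}"
  unfolding lie_ideal_alt
proof (intro conjI ballI)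
  have sub: "I \<subseteq> g" "J \<subseteq> g" "subspace I" using I J by (auto simp: lie_ideal_alt)
  then have 0: "0 \<in> g" using subspace_0 by blast
  show "subspace {x\<in>I. \<forall>y\<in>J. trace_form n M x y = 0}"
    unfolding subspace_def
  proof (intro conjI ballI allI)
    show "0 \<in> {x\<in>I. \<forall>y\<in>J. trace_form n M x y = 0}"
      using sub trace_form_bilinear(3)[OF 0 0, of _ 0] by (auto simp: subspace_0)
  qed (use sub in \<open>auto simp: trace_form_bilinear subspace_add subspace_scale subset_iff\<close>)
  show "{x\<in>I. \<forall>y\<in>J. trace_form n M x y = 0} \<subseteq> g" using sub by auto
  fix a x assume a: "a \<in> g" and x: "x \<in> {x\<in>I. \<forall>y\<in>J. trace_form n M x y = 0}"
  have "trace_form n M (ad a x) y = 0" if "y \<in> J" for y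
  proof -
    have "trace_form n M (ad a x) y = - trace_form n M (ad x a) y"
    proof -
      have ax: "ad x a = scale (-1) (ad a x)" by (simp add: ad_def)
      have "ad a x \<in> g" using a x sub g unfolding lie_subalgebra_def by blast
      then show ?thesis unfolding ax using trace_form_bilinear(3)[of "ad a x" y y "-1"] that sub by
          auto
    qed
    also have "\<dots> = - trace_form n M x (ad a y)" using trace_form_invariant[of x a y] a x sub that by
        auto
    also have "\<dots> = 0" using x J a that by (auto simp: lie_ideal_alt)
    finally show ?thesis .
  qed
  then show "ad a x \<in> {x\<in>I. \<forall>y\<in>J. trace_form n M x y = 0}" using x I a by (auto simp: lie_ideal_alt)
qed

text \<open>Where the derived series becomes stationary its term equals its own commutator span, so
  \<open>perfect_trace_form_0\<close> applies to the matrices of that term. The conclusion is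
  trivial action on \<open>V\<close> because the matrices do not see elements that act
  trivially.\<close>

theorem cartan_criterion:
  assumes I: "subspace I" "I \<subseteq> g" "\<And>x y. x \<in> I \<Longrightarrow> y \<in> I \<Longrightarrow> ad x y \<in> I" and fd: "fin_dim g"
    and 0: "\<And>x y. x \<in> I \<Longrightarrow> y \<in> I \<Longrightarrow> trace_form n M x y = 0"
  shows "\<exists>k. \<forall>x\<in>derived_series scale I k. \<forall>v\<in>V. ad x v = 0"
proof -
  let ?D = "derived_series scale I"
  have sub: "subspace (?D k)" for k by (cases k) (use I(1) in simp_all)
  have dec: "?D (Suc k) \<subseteq> ?D k" for k
  proof (induction k)
    case 0 show ?case using I comm_span_ad_subset[of I I I] by simp
  next
    case (Suc k) then show ?case using comm_span_mono by simp
  qed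
  obtain k where k: "?D (Suc k) = ?D k"
    by (rule decreasing_subspaces_stabilise[of ?D]) (use sub dec fin_dim_subset[OF fd] I(2) in auto)
  let ?P = "?D k"
  have PI: "?P \<subseteq> I" by (induction k) (use dec in auto)
  then have Pg: "?P \<subseteq> g" using I(2) by blast
  have P: "?P = comm_span scale ?P ?P" using k by simp
  let ?Q = "(\<lambda>x. M (ad x)) ` ?P"
  have Q: "mat.subspace ?Q"
    unfolding mat.subspace_def
  proof (intro conjI ballI allI)
    have "M (ad (scale 0 0)) = mat_scale 0 (M (ad 0))"
      using subspace_0[OF sub[of k]] Pg by (intro matrix_rep_ad) auto
    then show "0 \<in> ?Q" using subspace_0[OF sub[of k]] by (intro image_eqI[of _ _ 0]) auto
  next
    fix x y assume "x \<in> ?Q" "y \<in> ?Q"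
    then obtain a b where "x = M (ad a)" "y = M (ad b)" "a \<in> ?P" "b \<in> ?P" by blast
    moreover from this have "a \<in> g" "b \<in> g" using Pg by auto
    ultimately show "x + y \<in> ?Q" using matrix_rep_ad(1)[of a b] subspace_add[OF sub[of k], of a b]
      by (intro image_eqI[of _ _ "a + b"]) simp_all
  next
    fix c x assume "x \<in> ?Q"
    then obtain a where "x = M (ad a)" "a \<in> ?P" by blast
    moreover from this have "a \<in> g" using Pg by auto
    ultimately show "mat_scale c x \<in> ?Q" using matrix_rep_ad(2)[of a a c] subspace_scale[OF sub[of
        k], of a c]
      by (intro image_eqI[of _ _ "scale c a"]) simp_all
  qed
  have "?Q = {0}"
  proof (rule perfect_trace_form_0[of _ n])
    show "?Q \<subseteq> square_mats n" using matrix_rep_square by auto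
    show "mat.subspace ?Q" by (rule Q)
    show "?Q = comm_span mat_scale ?Q ?Q"
    proof
      \<comment> \<open>Membership in \<open>g\<close> is carried through the induction because
        \<open>matrix_rep_ad\<close> requires it.\<close>
      have "x \<in> g \<and> M (ad x) \<in> comm_span mat_scale ?Q ?Q" if "x \<in> span {ad a b |a b. a \<in> ?P \<and> b \<in>
          ?P}" for x
        using that
      proof (induction rule: span_induct_alt)
        case base
        have "M (ad (scale 0 0)) = mat_scale 0 (M (ad 0))"
          using subspace_0[OF sub[of k]] Pg by (intro matrix_rep_ad) auto
        then show ?case using subspace_0[OF sub[of k]] Pg mat.subspace_0[OF mat.subspace_comm_span]
            by auto
      next
        case (step c x y)
        then obtain a b where ab: "a \<in> ?P" "b \<in> ?P" "x = ad a b" by blast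
        then have ab': "a \<in> g" "b \<in> g" using Pg by auto
        have xg: "x \<in> g" using ab ab' g unfolding lie_subalgebra_def by blast
        have "M (ad x) = M (ad a) * M (ad b) - M (ad b) * M (ad a)"
          unfolding ab(3) by (rule matrix_rep_ad(3)[OF ab'])
        also have "\<dots> \<in> comm_span mat_scale ?Q ?Q" using ab by (intro mat.comm_spanI) auto
        finally have 1: "M (ad x) \<in> comm_span mat_scale ?Q ?Q" .
        have sgg: "subspace g" using g unfolding lie_subalgebra_def by blast
        have cx: "scale c x \<in> g" by (rule subspace_scale[OF sgg xg])
        have "M (ad (scale c x + y)) = mat_scale c (M (ad x)) + M (ad y)"
          using matrix_rep_ad(1)[OF cx, of y] matrix_rep_ad(2)[OF xg xg, of c] step(2) by simp
        then show ?case using 1 step(2) subspace_add[OF sgg cx, of y]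
          by (simp add: mat.subspace_add[OF mat.subspace_comm_span] mat.subspace_scale[OF
              mat.subspace_comm_span])
      qed
      then show "?Q \<subseteq> comm_span mat_scale ?Q ?Q" using P unfolding comm_span_ad by auto
      show "comm_span mat_scale ?Q ?Q \<subseteq> ?Q"
      proof (rule mat.comm_span_subset[OF _ Q])
        fix x y assume "x \<in> ?Q" "y \<in> ?Q"
        then obtain a b where ab: "x = M (ad a)" "y = M (ad b)" "a \<in> ?P" "b \<in> ?P" by blast
        moreover from this have "a \<in> g" "b \<in> g" using Pg by auto
        ultimately have "x * y - y * x = M (ad (ad a b))" using matrix_rep_ad(3)[of a b] by simp
        moreover have "ad a b \<in> ?P" using comm_span_adI[OF ab(3,4)] P by simp
        ultimately show "x * y - y * x \<in> ?Q" by blast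
      qed
    qed
    show "mat_trace n (x * y) = 0" if "x \<in> ?Q" "y \<in> ?Q" for x y
    proof -
      from that obtain a b where "x = M (ad a)" "y = M (ad b)" "a \<in> ?P" "b \<in> ?P" by blast
      then show ?thesis using 0[of a b] PI unfolding trace_form_def by auto
    qed
  qed
  then have "M (ad x) = 0" if "x \<in> ?P" for x using that by blast
  then have "\<forall>v\<in>V. ad x v = 0" if "x \<in> ?P" for x
    using M endo_ad[of x] that Pg unfolding matrix_rep_def by blast
  then show ?thesis by blast
qed

end

section \<open>Semisimple Lie algebras and the Casimir operator\<close>

context
  fixes g :: "'b set"
  assumes g: "lie_subalgebra g" and fd: "fin_dim g"
    and ss: "\<And>h. lie_ideal scale g h \<Longrightarrow> solvable_lie scale h \<Longrightarrow> h = {0}"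
begin

lemma ad_module_self: "ad_module g g"
  using g fd unfolding lie_subalgebra_def ad_module_def by blast

lemma derived_series_subset:
  assumes "lie_ideal scale g I"
  shows "subspace (derived_series scale I k)" "derived_series scale I k \<subseteq> I"
proof -
  show "subspace (derived_series scale I k)" by (cases k) (use assms lie_ideal_alt in simp_all)
  have cl: "comm_span scale I I \<subseteq> I"
    using assms by (intro comm_span_ad_subset) (auto simp: lie_ideal_alt)
  show "derived_series scale I k \<subseteq> I"
    by (induction k) (use cl comm_span_mono[of _ I _ I] in \<open>simp_all, blast\<close>)
qed

text \<open>By Cartan's criterion some derived term of \<open>I\<close> acts trivially on
  \<open>g\<close>; its commutators are then 0, so \<open>I\<close> is solvable.\<close>

lemma killing_null_ideal_eq_0:
  assumes I: "lie_ideal scale g I" and M: "matrix_rep g n M"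
    and 0: "\<And>x y. x \<in> I \<Longrightarrow> y \<in> I \<Longrightarrow> trace_form n M x y = 0"
  shows "I = {0}"
proof (rule ss[OF I])
  have I': "subspace I" "I \<subseteq> g" "\<And>x y. x \<in> I \<Longrightarrow> y \<in> I \<Longrightarrow> ad x y \<in> I"
    using I by (auto simp: lie_ideal_alt)
  obtain k where k: "\<forall>x\<in>derived_series scale I k. \<forall>v\<in>g. ad x v = 0"
    using cartan_criterion[OF g ad_module_self M I' fd 0] by auto
  have "derived_series scale I (Suc k) \<subseteq> {0}"
    unfolding derived_series.simps
    by (rule comm_span_ad_subset) (use k derived_series_subset(2)[OF I, of k] I'(2) in auto)
  then have "derived_series scale I (Suc k) = {0}"
    using subspace_0[OF derived_series_subset(1)[OF I]] by blast
  then show "solvable_lie scale I" unfolding solvable_lie_def by blast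
qed

text \<open>The complement is the orthogonal space for the Killing form. The intersection is an
  ideal on which the form vanishes, hence 0, so the form is nondegenerate on \<open>K\<close> and
  dual bases of \<open>K\<close> exist.\<close>

lemma lie_ideal_complement:
  assumes K: "lie_ideal scale g K"
  obtains J where "lie_ideal scale g J" "K \<inter> J = {0}" "\<And>x. x \<in> g \<Longrightarrow> \<exists>y\<in>K. \<exists>z\<in>J. x = y + z"
proof -
  have sg: "subspace g" using g by (simp add: lie_subalgebra_def)
  obtain n M where M: "matrix_rep g n M" using matrix_rep_exists[OF fd sg] by blast
  let ?B = "trace_form n M"
  note bil = trace_form_bilinear[OF g ad_module_self M]
  define J where "J = {x\<in>g. \<forall>y\<in>K. ?B x y = 0}"
  have gI: "lie_ideal scale g g" using g by (auto simp: lie_ideal_alt lie_subalgebra_def)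
  have J: "lie_ideal scale g J" unfolding J_def
    by (rule orthogonal_lie_ideal[OF g ad_module_self M gI K])
  have K': "K \<subseteq> g" "subspace K" using K by (auto simp: lie_ideal_alt)
  have KJ: "lie_ideal scale g {x\<in>K. \<forall>y\<in>K. ?B x y = 0}"
    by (rule orthogonal_lie_ideal[OF g ad_module_self M K K])
  have KJ0: "{x\<in>K. \<forall>y\<in>K. ?B x y = 0} = {0}"
    by (rule killing_null_ideal_eq_0[OF KJ M]) auto
  moreover have "K \<inter> J = {x\<in>K. \<forall>y\<in>K. ?B x y = 0}" using K' by (auto simp: J_def)
  ultimately have int: "K \<inter> J = {0}" by simp
  obtain m :: nat and e e' where e: "\<And>i. i < m \<Longrightarrow> e i \<in> K" "\<And>i. i < m \<Longrightarrow> e' i \<in> K"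
    and exp: "\<And>x. x \<in> K \<Longrightarrow> x = (\<Sum>i<m. scale (?B (e i) x) (e' i))"
  proof (rule dual_bases[of K ?B, OF fin_dim_subset[OF fd K'(1)] K'(2)])
    fix x y z c assume "x \<in> K" "y \<in> K"
    then have xy: "x \<in> g" "y \<in> g" using K'(1) by auto
    show "?B (scale c x) y = c * ?B x y" "?B x (scale c y) = c * ?B x y"
      using bil(3)[OF xy(1) xy(1) xy(2)] bil(4)[OF xy(2) xy(2) xy(1)] by auto
    assume "z \<in> K"
    then have z: "z \<in> g" using K'(1) by auto
    show "?B (x + y) z = ?B x z + ?B y z" "?B x (y + z) = ?B x y + ?B x z"
      using bil(1)[OF xy z] bil(2)[OF xy(2) z xy(1)] by auto
  next
    fix y assume y: "y \<in> K" "\<And>x. x \<in> K \<Longrightarrow> ?B x y = 0"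
    then have "y \<in> {x\<in>K. \<forall>y\<in>K. ?B x y = 0}"
      using trace_form_sym[OF g ad_module_self M] by auto
    then show "y = 0" using KJ0 by auto
  qed (rule that)
  have 0: "0 \<in> g" using subspace_0[OF sg] .
  have Bsum: "?B (\<Sum>i\<in>A. scale (c i) (f i)) y = (\<Sum>i\<in>A. c i * ?B (f i) y)"
    "?B y (\<Sum>i\<in>A. scale (c i) (f i)) = (\<Sum>i\<in>A. c i * ?B y (f i))"
    if "\<And>i. i \<in> A \<Longrightarrow> f i \<in> g" "y \<in> g" for A :: "nat set" and c f y
  proof -
    have "(?B (\<Sum>i\<in>A. scale (c i) (f i)) y = (\<Sum>i\<in>A. c i * ?B (f i) y)) \<and>
      (?B y (\<Sum>i\<in>A. scale (c i) (f i)) = (\<Sum>i\<in>A. c i * ?B y (f i)))"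
      using that
    proof (induction A rule: infinite_finite_induct)
      case (insert i A)
      have "f i \<in> g" "scale (c i) (f i) \<in> g" "(\<Sum>i\<in>A. scale (c i) (f i)) \<in> g"
        using insert.prems by (auto intro!: subspace_sum[OF sg] subspace_scale[OF sg])
      then show ?case using insert by (simp add: bil(1,2)[of "scale (c i) (f i)"] bil(3,4)[of _ y
          y])
    qed (use bil(3,4)[OF 0 0, of _ 0] in simp_all)
    then show "?B (\<Sum>i\<in>A. scale (c i) (f i)) y = (\<Sum>i\<in>A. c i * ?B (f i) y)"
      "?B y (\<Sum>i\<in>A. scale (c i) (f i)) = (\<Sum>i\<in>A. c i * ?B y (f i))" by blast+
  qed
  show ?thesis
  proof (rule that[OF J int])
    fix x assume x: "x \<in> g"
    \<comment> \<open>The orthogonal projection of \<open>x\<close> to \<open>K\<close>.\<close>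
    let ?y = "\<Sum>i<m. scale (?B x (e' i)) (e i)"
    have yK: "?y \<in> K" using e by (auto intro!: subspace_sum[OF K'(2)] subspace_scale[OF K'(2)])
    have "?B (x + scale (-1) ?y) k = 0" if k: "k \<in> K" for k
    proof -
      have kg: "k \<in> g" using k K' by auto
      have "?B ?y k = (\<Sum>i<m. ?B x (e' i) * ?B (e i) k)" by (rule Bsum(1)) (use e K' kg in auto)
      also have "\<dots> = (\<Sum>i<m. ?B (e i) k * ?B x (e' i))" by (simp add: mult.commute)
      also have "\<dots> = ?B x (\<Sum>i<m. scale (?B (e i) k) (e' i))"
        by (rule Bsum(2)[symmetric]) (use e K' x in auto)
      also have "\<dots> = ?B x k" using exp[OF k] by simp
      finally have "?B ?y k = ?B x k" .
      then show ?thesis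
        using bil(1)[OF x subspace_scale[OF sg] kg, of ?y "-1"] bil(3)[OF _ kg kg, of ?y "-1"] yK K'
            by auto
    qed
    then have "x - ?y \<in> J" unfolding J_def using subspace_diff[OF sg x, of ?y] yK K' by auto
    then show "\<exists>y\<in>K. \<exists>z\<in>J. x = y + z" using yK by (intro bexI[of _ ?y] bexI[of _ "x - ?y"]) auto
  qed
qed

lemma lie_ideal_annihilator:
  assumes V: "ad_module g V"
  shows "lie_ideal scale g {x\<in>g. \<forall>v\<in>V. ad x v = 0}"
proof -
  have sg: "subspace g" using g by (simp add: lie_subalgebra_def)
  have "ad (ad x y) v = 0" if "x \<in> g" "\<forall>v\<in>V. ad y v = 0" "v \<in> V" for x y v
    using that V unfolding ad_ad ad_module_def by (simp add: ad_0)
  then show ?thesis using g unfolding lie_ideal_alt lie_subalgebra_def subspace_def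
    by (auto simp: ad_add ad_scale ad_0)
qed

text \<open>
  The Casimir element of the complement \<open>J\<close> of the annihilator of \<open>V\<close>, with respect to the trace
  form of \<open>V\<close>, acts on \<open>V\<close> as an endomorphism \<open>C\<close> of trace \<open>dim J\<close>, so it is not nilpotent unless
  \<open>V\<close> is trivial; the kernel of a high power of \<open>C\<close> has smaller dimension and complements an image
  contained in \<open>[g, V]\<close>.
\<close>

theorem module_eq_brackets_plus_invariants:
  assumes "ad_module g V" "v \<in> V"
  shows "\<exists>a\<in>comm_span scale g V. \<exists>b\<in>V. (\<forall>x\<in>g. ad x b = 0) \<and> v = a + b"
  using assms
proof (induction "dim V" arbitrary: V v rule: less_induct)
  case less
  note V = less.prems(1)
  have sV: "subspace V" "fin_dim V" "\<And>x v. x \<in> g \<Longrightarrow> v \<in> V \<Longrightarrow> ad x v \<in> V"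
    using V by (auto simp: ad_module_def)
  have sg: "subspace g" using g by (simp add: lie_subalgebra_def)
  obtain n M where M: "matrix_rep V n M" using matrix_rep_exists[OF sV(2,1)] by blast
  let ?B = "trace_form n M"
  note bil = trace_form_bilinear[OF g V M]
  define K where "K = {x\<in>g. \<forall>v\<in>V. ad x v = 0}"
  have K: "lie_ideal scale g K" unfolding K_def by (rule lie_ideal_annihilator[OF V])
  obtain J where J: "lie_ideal scale g J" "K \<inter> J = {0}" "\<And>x. x \<in> g \<Longrightarrow> \<exists>y\<in>K. \<exists>z\<in>J. x = y + z"
    using lie_ideal_complement[OF K] by blast
  have J': "subspace J" "J \<subseteq> g" "\<And>x y. x \<in> g \<Longrightarrow> y \<in> J \<Longrightarrow> ad x y \<in> J" using J(1) by (auto simp: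
      lie_ideal_alt)
  \<comment> \<open>The radical of the trace form on \<open>J\<close>. By Cartan's criterion one of
    its derived terms acts trivially on \<open>V\<close>, so it lies in
    \<open>K \<inter> J = {0}\<close> and the radical is solvable.\<close>
  let ?N = "{x\<in>J. \<forall>y\<in>J. ?B x y = 0}"
  have N: "lie_ideal scale g ?N" by (rule orthogonal_lie_ideal[OF g V M J(1) J(1)])
  have "?N = {0}"
  proof (rule ss[OF N])
    have N': "subspace ?N" "?N \<subseteq> g" "\<And>x y. x \<in> ?N \<Longrightarrow> y \<in> ?N \<Longrightarrow> ad x y \<in> ?N"
      using N unfolding lie_ideal_alt by blast+
    have N0: "?B x y = 0" if "x \<in> ?N" "y \<in> ?N" for x y using that by blast
    obtain k where k: "\<forall>x\<in>derived_series scale ?N k. \<forall>v\<in>V. ad x v = 0"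
      using cartan_criterion[OF g V M N' fd N0] by blast
    have "derived_series scale ?N k \<subseteq> K \<inter> J"
      using k derived_series_subset(2)[OF N, of k] N'(2) unfolding K_def by blast
    then have "derived_series scale ?N k = {0}"
      using subspace_0[OF derived_series_subset(1)[OF N, of k]] J(2) by blast
    then show "solvable_lie scale ?N" unfolding solvable_lie_def by blast
  qed
  then have nondeg: "y = 0" if "y \<in> J" "\<And>x. x \<in> J \<Longrightarrow> ?B x y = 0" for y
    using that trace_form_sym[OF g V M] by auto
  obtain m :: nat and e e' where e: "\<And>i. i < m \<Longrightarrow> e i \<in> J" "\<And>i. i < m \<Longrightarrow> e' i \<in> J"
    and dual: "\<And>i j. i < m \<Longrightarrow> j < m \<Longrightarrow> ?B (e i) (e' j) = (if i = j then 1 else 0)"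
    and exp: "\<And>x. x \<in> J \<Longrightarrow> x = (\<Sum>i<m. scale (?B x (e' i)) (e i))"
    and exp': "\<And>x. x \<in> J \<Longrightarrow> x = (\<Sum>i<m. scale (?B (e i) x) (e' i))"
  proof (rule dual_bases[of J ?B, OF fin_dim_subset[OF fd J'(2)] J'(1)])
    fix x y z c assume "x \<in> J" "y \<in> J"
    then have xy: "x \<in> g" "y \<in> g" using J'(2) by auto
    show "?B (scale c x) y = c * ?B x y" "?B x (scale c y) = c * ?B x y"
      using bil(3)[OF xy(1) xy(1) xy(2)] bil(4)[OF xy(2) xy(2) xy(1)] by auto
    assume "z \<in> J"
    then have z: "z \<in> g" using J'(2) by auto
    show "?B (x + y) z = ?B x z + ?B y z" "?B x (y + z) = ?B x y + ?B x z"
      using bil(1)[OF xy z] bil(2)[OF xy(2) z xy(1)] by auto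
  qed (assumption | rule nondeg | rule that)+
  have eg: "e i \<in> g" "e' i \<in> g" if "i < m" for i using e that J'(2) by auto
  define C where "C v = (\<Sum>i<m. ad (e i) (ad (e' i) v))" for v
  have Cin: "C u \<in> comm_span scale g V" if "u \<in> V" for u unfolding C_def
    by (rule subspace_sum[OF subspace_comm_span]) (use eg sV that in \<open>auto intro!: comm_span_adI\<close>)
  have comm_V: "comm_span scale g V \<subseteq> V"
    by (rule comm_span_ad_subset) (use sV in auto)
  have Cadd: "C (u + v) = C u + C v" "C (scale c u) = scale c (C u)" for u v c
    unfolding C_def by (simp_all add: ad_add ad_scale sum.distrib scale_sum_right)
  have C_comm: "C (ad x v) = ad x (C v)" if x: "x \<in> g" for x v
  proof -
    \<comment> \<open>By invariance the matrices of \<open>ad x\<close> in the bases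
      \<open>e\<close> and \<open>e'\<close> are negative transposes of each other, so the two
      double sums below cancel.\<close>
    have inv: "?B (ad x (e i)) (e' j) = - ?B (e i) (ad x (e' j))" if "i < m" "j < m" for i j
    proof -
      have "?B (ad (e i) x) (e' j) = ?B (e i) (ad x (e' j))"
        by (rule trace_form_invariant[OF g V M]) (use eg that x in auto)
      moreover have "ad x (e i) = scale (-1) (ad (e i) x)" using ad_minus(3)[of x "e i"] by simp
      moreover have "ad (e i) x \<in> g" using eg[OF that(1)] x g unfolding lie_subalgebra_def by blast
      ultimately show ?thesis using bil(3)[of "ad (e i) x" x "e' j" "-1"] x eg that by auto
    qed
    have 1: "ad (ad x (e i)) w = (\<Sum>j<m. scale (?B (ad x (e i)) (e' j)) (ad (e j) w))" if "i < m" for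
        i w
      by (subst exp[OF J'(3)[OF x e(1)[OF that]]]) (simp add: ad_sum ad_scale)
    have 2: "ad (ad x (e' i)) w = (\<Sum>j<m. scale (?B (e j) (ad x (e' i))) (ad (e' j) w))" if "i < m"
        for i w
      by (subst exp'[OF J'(3)[OF x e(2)[OF that]]]) (simp add: ad_sum ad_scale)
    have "ad x (C v) - C (ad x v) =
      (\<Sum>i<m. ad (ad x (e i)) (ad (e' i) v)) + (\<Sum>i<m. ad (e i) (ad (ad x (e' i)) v))"
      unfolding C_def ad_sum sum_subtractf[symmetric] sum.distrib[symmetric]
      by (rule sum.cong) (simp_all add: ad_def algebra_simps)
    also have "(\<Sum>i<m. ad (ad x (e i)) (ad (e' i) v)) =
      (\<Sum>i<m. \<Sum>j<m. scale (- ?B (e i) (ad x (e' j))) (ad (e j) (ad (e' i) v)))"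
      by (rule sum.cong) (auto simp: 1 inv intro!: sum.cong)
    also have "\<dots> = (\<Sum>j<m. \<Sum>i<m. scale (- ?B (e i) (ad x (e' j))) (ad (e j) (ad (e' i) v)))"
      by (rule sum.swap)
    also have "(\<Sum>i<m. ad (e i) (ad (ad x (e' i)) v)) =
      (\<Sum>j<m. \<Sum>i<m. scale (?B (e i) (ad x (e' j))) (ad (e j) (ad (e' i) v)))"
      by (rule sum.cong) (auto simp: 2 ad_sum ad_scale)
    finally show ?thesis by (simp add: sum_negf)
  qed
  have sub_comm: "comm_span scale g W \<subseteq> comm_span scale g V" if "W \<subseteq> V" for W
    using that by (intro comm_span_mono) auto
  show ?case
  \<comment> \<open>For \<open>m = 0\<close> the complement \<open>J\<close> is 0 and all of
    \<open>g\<close> acts trivially; otherwise the trace of \<open>C\<close> is a nonzero integer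
    and stays nonzero in characteristic 0.\<close>
  proof (cases "m = 0")
    case True
    then have J0: "J = {0}" using exp subspace_0[OF J'(1)] by auto
    have "ad x v = 0" if xg: "x \<in> g" for x
    proof -
      obtain y z where "y \<in> K" "z \<in> J" "x = y + z" using J(3)[OF xg] by blast
      then show ?thesis using J0 less.prems(2) unfolding K_def by (auto simp: ad_0)
    qed
    then show ?thesis using less.prems(2) by (intro bexI[of _ 0] bexI[of _ v]) (auto simp:
        subspace_0 ad_0)
  next
    case False
    have CV: "C u \<in> V" if "u \<in> V" for u using Cin[OF that] comm_V by auto
    have endoC: "endo_on V C" unfolding endo_on_def using CV Cadd by auto
    have Cpow: "endo_on V (C ^^ k)" for k
      by (induction k) (use endoC in \<open>auto simp: endo_on_def\<close>)
    have MC: "M C = (\<Sum>i<m. M (ad (e i)) * M (ad (e' i)))"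
    proof -
      have endo: "endo_on V (\<lambda>v. ad (e i) (ad (e' i) v))" if "i < m" for i
        using eg[OF that] sV unfolding endo_on_def by (auto simp: ad_add ad_scale)
      have "k \<le> m \<Longrightarrow> endo_on V (\<lambda>v. \<Sum>i<k. ad (e i) (ad (e' i) v)) \<and>
        M (\<lambda>v. \<Sum>i<k. ad (e i) (ad (e' i) v)) = (\<Sum>i<k. M (ad (e i)) * M (ad (e' i)))" for k
      proof (induction k)
        case 0
        have "endo_on V (\<lambda>v. 0)" using subspace_0[OF sV(1)] by (simp add: endo_on_def)
        then have "M (\<lambda>v. scale 0 0) = mat_scale 0 (M (\<lambda>v. 0))" using M unfolding matrix_rep_def by
            blast
        then show ?case using \<open>endo_on V (\<lambda>v. 0)\<close> by simp
      next
        case (Suc k)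
        let ?S = "\<lambda>v. \<Sum>i<k. ad (e i) (ad (e' i) v)"
        have IH: "endo_on V ?S" "M ?S = (\<Sum>i<k. M (ad (e i)) * M (ad (e' i)))" using Suc by auto
        have ek: "endo_on V (\<lambda>v. ad (e k) (ad (e' k) v))" using endo Suc.prems by simp
        have "M (\<lambda>v. ?S v + ad (e k) (ad (e' k) v)) = M ?S + M (\<lambda>v. ad (e k) (ad (e' k) v))"
          using M IH(1) ek unfolding matrix_rep_def by blast
        moreover have "M (\<lambda>v. ad (e k) (ad (e' k) v)) = M (ad (e k)) * M (ad (e' k))"
          using M endo_ad[OF g V M eg(1), of k] endo_ad[OF g V M eg(2), of k] Suc.prems unfolding
              matrix_rep_def by auto
        moreover have "endo_on V (\<lambda>v. ?S v + ad (e k) (ad (e' k) v))"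
          using IH(1) ek subspace_add[OF sV(1)] unfolding endo_on_def by (auto simp:
              scale_right_distrib)
        ultimately show ?case using IH(2) by simp
      qed
      from this[of m] show ?thesis unfolding C_def by simp
    qed
    have tr: "mat_trace n (M C) = of_nat m"
    proof -
      have "mat_trace n (M C) = (\<Sum>i<m. ?B (e i) (e' i))" unfolding MC mat_trace_linear
          trace_form_def ..
      also have "\<dots> = (\<Sum>i<m. 1)" by (rule sum.cong) (use dual in auto)
      finally show ?thesis by simp
    qed
    \<comment> \<open>The exponents start at 1 because \<open>M\<close> sends the identity map to a
      matrix in \<open>square_mats n\<close>, which the unit of the ring is not.\<close>
    have MCpow: "M (C ^^ Suc k) = M C ^ Suc k" for k
    proof (induction k)
      case (Suc k)
      have "M (\<lambda>v. C ((C ^^ Suc k) v)) = M C * M (C ^^ Suc k)"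
        using M endoC Cpow unfolding matrix_rep_def by blast
      then show ?case using Suc by (simp add: comp_def)
    qed (simp add: comp_def)
    have nonnil: "\<exists>u\<in>V. (C ^^ k) u \<noteq> 0" for k
    proof (rule ccontr)
      assume "\<not> ?thesis"
      then have "\<forall>u\<in>V. (C ^^ Suc k) u = 0" using Cadd(2)[of 0 0] by auto
      moreover have "(\<forall>v\<in>V. T v = S v) \<longrightarrow> M T = M S" for T S
        using M unfolding matrix_rep_def by blast
      from this[of "C ^^ Suc k" "\<lambda>_. 0"] have "(\<forall>u\<in>V. (C ^^ Suc k) u = 0) \<longrightarrow> M (C ^^ Suc k) = M (\<lambda>_.
          0)" .
      ultimately have eq: "M (C ^^ Suc k) = M (\<lambda>_. 0)" by blast
      have "endo_on V (\<lambda>v. 0)" using subspace_0[OF sV(1)] by (simp add: endo_on_def)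
      then have "M (\<lambda>v. scale 0 0) = mat_scale 0 (M (\<lambda>v. 0))" using M unfolding matrix_rep_def by
          blast
      then have "M C ^ Suc k = 0" using eq MCpow by simp
      then have "mat_trace n (M C) = 0"
        using mat_trace_nilpotent matrix_rep_square[OF g V M] by blast
      then show False using tr False by simp
    qed
    define U where "U k = (C ^^ k) ` V" for k
    obtain k where k: "U (Suc k) = U k"
    proof (rule decreasing_subspaces_stabilise[of U])
      show "fin_dim (U 0)" using sV(2) by (simp add: U_def)
      show "subspace (U i)" for i
        unfolding subspace_def
      proof (intro conjI ballI allI)
        have "(C ^^ i) (scale 0 0) = scale 0 ((C ^^ i) 0)"
          using Cpow[of i] subspace_0[OF sV(1)] unfolding endo_on_def by blast
        then show "0 \<in> U i" unfolding U_def using subspace_0[OF sV(1)] by (intro image_eqI[of _ _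
            0]) auto
      next
        fix x y assume "x \<in> U i" "y \<in> U i"
        then obtain a b where "x = (C ^^ i) a" "y = (C ^^ i) b" "a \<in> V" "b \<in> V" unfolding U_def by
            blast
        then show "x + y \<in> U i" unfolding U_def using Cpow[of i] subspace_add[OF sV(1)]
          by (intro image_eqI[of _ _ "a + b"]) (auto simp: endo_on_def)
      next
        fix c x assume "x \<in> U i"
        then obtain a where "x = (C ^^ i) a" "a \<in> V" unfolding U_def by blast
        then show "scale c x \<in> U i" unfolding U_def using Cpow[of i] subspace_scale[OF sV(1)]
          by (intro image_eqI[of _ _ "scale c a"]) (auto simp: endo_on_def)
      qed
      show "U (Suc i) \<subseteq> U i" for i
        unfolding U_def by (auto simp only: funpow_Suc_right comp_apply intro!: imageI CV)
    qed
    define V0 where "V0 = {u\<in>V. (C ^^ k) u = 0}"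
    have C0: "(C ^^ k) 0 = 0" using Cpow[of k] subspace_0[OF sV(1)] unfolding endo_on_def by (metis
        scale_zero_left)
    have sV0: "subspace V0"
      unfolding subspace_def
    proof (intro conjI ballI allI)
      show "0 \<in> V0" using subspace_0[OF sV(1)] C0 by (simp add: V0_def)
    qed (use Cpow[of k] subspace_add[OF sV(1)] subspace_scale[OF sV(1)] in \<open>auto simp: V0_def
        endo_on_def\<close>)
    have Cad: "(C ^^ i) (ad x u) = ad x ((C ^^ i) u)" if "x \<in> g" for x u i
      by (induction i) (simp_all add: C_comm[OF that])
    have V0: "ad_module g V0"
      unfolding ad_module_def using sV0 fin_dim_subset[OF sV(2), of V0] sV(3)
      by (auto simp: V0_def Cad ad_0)
    have "V0 \<subset> V" using nonnil[of k] by (auto simp: V0_def)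
    then have "dim V0 < dim V" by (intro dim_less_fd sV sV0)
    note IH = less.hyps[OF this V0]
    \<comment> \<open>Fitting's argument: \<open>v - C u\<close> lies in the kernel
      \<open>V0\<close> of \<open>C ^^ k\<close>, to which the induction hypothesis applies, and
      \<open>C u\<close> is already a sum of brackets.\<close>
    have "(C ^^ k) v \<in> U (Suc k)" using less.prems(2) unfolding k by (simp add: U_def)
    then obtain u where u: "u \<in> V" "(C ^^ k) v = (C ^^ k) (C u)"
      unfolding U_def by (auto simp only: funpow_Suc_right comp_apply)
    have "(C ^^ k) (v + scale (-1) (C u)) = (C ^^ k) v + scale (-1) ((C ^^ k) (C u))"
      using Cpow[of k] less.prems(2) CV[OF u(1)] subspace_scale[OF sV(1)] unfolding endo_on_def by
          metis
    then have "v - C u \<in> V0" using u less.prems(2) CV subspace_diff[OF sV(1)] by (simp add: V0_def)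
    then obtain a b where ab: "a \<in> comm_span scale g V0" "b \<in> V0" "\<forall>x\<in>g. ad x b = 0" "v - C u = a +
        b"
      using IH by blast
    have "a + C u \<in> comm_span scale g V"
      using ab(1) sub_comm[of V0] Cin[OF u(1)] by (intro subspace_add) (auto simp: V0_def)
    moreover have "b \<in> V" using ab(2) by (simp add: V0_def)
    ultimately show ?thesis using ab by (intro bexI[of _ "a + C u"] bexI[of _ b]) (auto simp:
        algebra_simps)
  qed
qed

text \<open>The invariants of the adjoint module form the centre, an abelian ideal, which is 0 by
  semisimplicity; what remains of \<open>module_eq_brackets_plus_invariants\<close> is the
  claim.\<close>

theorem semisimple_perfect: "comm_span scale g g = g"
proof
  show "comm_span scale g g \<subseteq> g"
    by (rule comm_span_ad_subset) (use g in \<open>auto simp: lie_subalgebra_def\<close>)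
  let ?Z = "{b\<in>g. \<forall>x\<in>g. ad b x = 0}"
  have Z: "lie_ideal scale g ?Z" by (rule lie_ideal_annihilator[OF ad_module_self])
  have "derived_series scale ?Z (Suc 0) \<subseteq> {0}"
    unfolding derived_series.simps by (rule comm_span_ad_subset) auto
  then have "derived_series scale ?Z (Suc 0) = {0}"
    using subspace_0[OF derived_series_subset(1)[OF Z]] by blast
  then have Z0: "?Z = {0}" using ss[OF Z] unfolding solvable_lie_def by blast
  show "g \<subseteq> comm_span scale g g"
  proof
    fix v assume "v \<in> g"
    then obtain a b where ab: "a \<in> comm_span scale g g" "b \<in> g" "\<forall>x\<in>g. ad x b = 0" "v = a + b"
      using module_eq_brackets_plus_invariants[OF ad_module_self] by blast
    then have "b \<in> ?Z" by (simp add: ad_minus(3)[of b])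
    then show "v \<in> comm_span scale g g" using ab Z0 by simp
  qed
qed

end

end

section \<open>Perfect pairs\<close>

locale char_0_unital_k_algebra = char_0_k_algebra scale + unital_k_algebra scale
  for scale :: "'k::field_char_0 \<Rightarrow> 'a::{ring,monoid_mult} \<Rightarrow> 'a"
begin

lemma subspace_gpow: "subspace (gpow scale g k)"
  by (simp add: gpow_def)

lemma prod_list_in_gpow: "set xs \<subseteq> g \<Longrightarrow> prod_list xs \<in> gpow scale g (length xs)"
  unfolding gpow_def by (rule span_base) auto

lemma gpow_induct:
  assumes "\<And>xs. length xs = k \<Longrightarrow> set xs \<subseteq> g \<Longrightarrow> prod_list xs \<in> U" "subspace U"
  shows "gpow scale g k \<subseteq> U"
  unfolding gpow_def by (rule span_minimal) (use assms in auto)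

lemma mult_gpow_left:
  assumes "x \<in> g" "w \<in> gpow scale g k" shows "x * w \<in> gpow scale g (Suc k)"
proof (rule mult_left_span[OF _ subspace_gpow assms(2)[unfolded gpow_def]])
  fix w assume "w \<in> {prod_list xs |xs. length xs = k \<and> set xs \<subseteq> g}"
  then obtain xs where "w = prod_list xs" "length xs = k" "set xs \<subseteq> g" by blast
  then show "x * w \<in> gpow scale g (Suc k)" using prod_list_in_gpow[of "x # xs" g] assms(1) by simp
qed

lemma mult_gpow_right:
  assumes "x \<in> g" "w \<in> gpow scale g k" shows "w * x \<in> gpow scale g (Suc k)"
proof (rule mult_right_span[OF _ subspace_gpow assms(2)[unfolded gpow_def]])
  fix w assume "w \<in> {prod_list xs |xs. length xs = k \<and> set xs \<subseteq> g}"
  then obtain xs where "w = prod_list xs" "length xs = k" "set xs \<subseteq> g" by blast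
  then show "w * x \<in> gpow scale g (Suc k)" using prod_list_in_gpow[of "xs @ [x]" g] assms(1) by simp
qed

lemma gpow_1: "subspace g \<Longrightarrow> gpow scale g 1 = g"
proof -
  assume "subspace g"
  moreover have "{prod_list xs |xs. length xs = 1 \<and> set xs \<subseteq> g} = g"
    by (auto simp: length_Suc_conv intro!: exI[of _ "[_]"])
  ultimately show ?thesis unfolding gpow_def by (simp add: span_eq_iff)
qed

lemma ad_mult: "ad y (a * b) = ad y a * b + a * ad y b"
  by (simp add: ad_def algebra_simps)

lemma ad_prod_list: "ad y (prod_list zs) =
  (\<Sum>i<length zs. prod_list (take i zs @ ad y (zs ! i) # drop (Suc i) zs))"
proof (induction zs)
  case Nil
  show ?case by (simp add: ad_def)
next
  case (Cons z zs)
  show ?case unfolding list.size add_0_right add_Suc_right sum.lessThan_Suc_shift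
    by (simp add: ad_mult Cons sum_distrib_left mult.assoc)
qed

context
  fixes g :: "'a set"
  assumes g: "lie_subalgebra g"
begin

lemma ad_gpow:
  assumes y: "y \<in> g" and w: "w \<in> gpow scale g k" shows "ad y w \<in> gpow scale g k"
proof -
  have "ad y (prod_list xs) \<in> gpow scale g (length xs)" if "set xs \<subseteq> g" for xs
    unfolding ad_prod_list
  proof (rule subspace_sum[OF subspace_gpow])
    fix i assume i: "i \<in> {..<length xs}"
    then have "xs ! i \<in> g" using that by auto
    then have "ad y (xs ! i) \<in> g" using y g unfolding lie_subalgebra_def by blast
    then have "set (take i xs @ ad y (xs ! i) # drop (Suc i) xs) \<subseteq> g"
      using that set_take_subset[of i xs] set_drop_subset[of "Suc i" xs] by auto
    moreover have "length (take i xs @ ad y (xs ! i) # drop (Suc i) xs) = length xs" using i by simp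
    ultimately show "prod_list (take i xs @ ad y (xs ! i) # drop (Suc i) xs) \<in> gpow scale g (length
        xs)"
      using prod_list_in_gpow by metis
  qed
  then have "ad y x \<in> gpow scale g k" if "x \<in> {prod_list xs |xs. length xs = k \<and> set xs \<subseteq> g}" for x
    using that by auto
  then show ?thesis unfolding ad_def
    by (rule commutator_left_span[OF _ subspace_gpow w[unfolded gpow_def]])
qed

lemma comm_span_gpow_subset: "comm_span scale g (gpow scale g k) \<subseteq> gpow scale g k"
  by (rule comm_span_ad_subset[OF ad_gpow subspace_gpow])

text \<open>Exchanging the neighbours \<open>b\<close> and \<open>z\<close> changes the word by one
  in which they are replaced by the single letter \<open>[b, z]\<close>. This word of length
  \<open>k\<close> is also a difference of words of length \<open>k + 1\<close>, hence lies in both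
  powers.\<close>

lemma move_letter_to_end:
  assumes "set (as @ z # bs) \<subseteq> g" "length as + length bs = k"
  shows "prod_list (as @ bs @ [z]) - prod_list (as @ z # bs) \<in> gpow scale g k \<inter> gpow scale g (Suc
      k)"
  using assms
proof (induction bs arbitrary: as)
  case Nil
  then show ?case by (simp add: subspace_0[OF subspace_gpow])
next
  case (Cons b bs)
  have IH: "prod_list ((as @ [b]) @ bs @ [z]) - prod_list ((as @ [b]) @ z # bs)
      \<in> gpow scale g k \<inter> gpow scale g (Suc k)"
    using Cons.prems by (intro Cons.IH) auto
  have "prod_list (as @ b # z # bs) - prod_list (as @ z # b # bs) = prod_list (as @ ad b z # bs)"
    by (simp add: ad_def algebra_simps)
  moreover have "prod_list (as @ ad b z # bs) \<in> gpow scale g k"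
  proof -
    have "ad b z \<in> g" using g Cons.prems unfolding lie_subalgebra_def by auto
    then show ?thesis using prod_list_in_gpow[of "as @ ad b z # bs" g] Cons.prems by simp
  qed
  moreover have "prod_list (as @ b # z # bs) \<in> gpow scale g (Suc k)" "prod_list (as @ z # b # bs) \<in>
      gpow scale g (Suc k)"
    using prod_list_in_gpow[of "as @ b # z # bs" g] prod_list_in_gpow[of "as @ z # b # bs" g]
        Cons.prems by simp_all
  ultimately have "prod_list (as @ b # z # bs) - prod_list (as @ z # b # bs) \<in> gpow scale g k \<inter> gpow
      scale g (Suc k)"
    using subspace_diff[OF subspace_gpow] by (metis IntI)
  with IH have "(prod_list ((as @ [b]) @ bs @ [z]) - prod_list ((as @ [b]) @ z # bs)) +
     (prod_list (as @ b # z # bs) - prod_list (as @ z # b # bs)) \<in> gpow scale g k \<inter> gpow scale g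
         (Suc k)"
    using subspace_add[OF subspace_inter[OF subspace_gpow subspace_gpow]] by blast
  then show ?case by simp
qed

text \<open>
  Modulo the left-hand side of the perfectness condition, words of length \<open>k + 1\<close> are symmetric.
  With \<open>T\<^sub>i\<close> the word \<open>zs\<close> with \<open>[y, -]\<close> applied to its \<open>i\<close>-th letter, moving that letter to
  the end gives \<open>\<Sum>\<^sub>j T\<^sub>j = T\<^sub>i\<close> for every \<open>i\<close>, hence \<open>k \<Sum>\<^sub>j T\<^sub>j = 0\<close>.
\<close>

theorem perfect_pair_if_perfect:
  assumes gg: "comm_span scale g g = g"
  shows "perfect_pair scale g"
  unfolding perfect_pair_def
proof (intro allI impI)
  fix k :: nat assume k: "2 \<le> k"
  let ?X = "prod_span scale (comm_span scale g (gpow scale g k)) g \<union> (gpow scale g k \<inter> gpow scale g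
      (k + 1))"
  let ?W = "span ?X"
  have sg: "subspace g" using g by (simp add: lie_subalgebra_def)
  have W1: "a * b \<in> ?W" if "a \<in> comm_span scale g (gpow scale g k)" "b \<in> g" for a b
    by (rule span_base) (use prod_spanI[OF that] in auto)
  have W2: "a \<in> ?W" if "a \<in> gpow scale g k \<inter> gpow scale g (Suc k)" for a
    by (rule span_base) (use that in auto)
  \<comment> \<open>With \<open>z\<close> moved to the end,
    \<open>[y, P z] = [y, P] z + P [y, z]\<close>, and the first term lies in
    \<open>[g, g^k] g\<close>. Moving \<open>z\<close> and \<open>[y, z]\<close> between the end and
    their old place changes nothing modulo \<open>?W\<close>.\<close>
  have split: "ad y (prod_list (as @ z # bs)) - prod_list (as @ ad y z # bs) \<in> ?W"
    if y: "y \<in> g" and zs: "set (as @ z # bs) \<subseteq> g" "length as + length bs = k" for y z as bs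
  proof -
    let ?P = "prod_list (as @ bs)"
    have yz: "ad y z \<in> g" using g y zs unfolding lie_subalgebra_def by auto
    have "ad y ?P \<in> comm_span scale g (gpow scale g k)"
      using prod_list_in_gpow[of "as @ bs" g] zs y by (intro comm_span_adI) auto
    then have 1: "ad y ?P * z \<in> ?W" using zs by (intro W1) auto
    have 2: "ad y (prod_list (as @ bs @ [z]) - prod_list (as @ z # bs)) \<in> ?W"
      using move_letter_to_end[OF zs] ad_gpow[OF y] by (intro W2) auto
    have 3: "prod_list (as @ bs @ [ad y z]) - prod_list (as @ ad y z # bs) \<in> ?W"
      by (intro W2 move_letter_to_end) (use zs yz in auto)
    have "ad y ?P * z - ad y (prod_list (as @ bs @ [z]) - prod_list (as @ z # bs)) +
      (prod_list (as @ bs @ [ad y z]) - prod_list (as @ ad y z # bs)) \<in> ?W"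
      by (rule span_add[OF span_diff[OF 1 2] 3])
    moreover have "ad y ?P * z - ad y (prod_list (as @ bs @ [z]) - prod_list (as @ z # bs)) +
      (prod_list (as @ bs @ [ad y z]) - prod_list (as @ ad y z # bs)) =
      ad y (prod_list (as @ z # bs)) - prod_list (as @ ad y z # bs)"
      by (simp add: ad_def algebra_simps)
    ultimately show ?thesis by (simp only:)
  qed
  have adW: "prod_list (ad y z # xs) \<in> ?W" if yz: "y \<in> g" "z \<in> g" and xs: "set xs \<subseteq> g" "length xs =
      k" for y z xs
  proof -
    let ?zs = "z # xs" and ?S = "ad y (prod_list (z # xs))"
    let ?T = "\<lambda>i. prod_list (take i ?zs @ ad y (?zs ! i) # drop (Suc i) ?zs)"
    have T: "?S - ?T i \<in> ?W" if i: "i < Suc k" for i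
    proof -
      have eq: "take i ?zs @ ?zs ! i # drop (Suc i) ?zs = ?zs"
        using i xs by (intro id_take_nth_drop[symmetric]) simp
      have "set (take i ?zs @ ?zs ! i # drop (Suc i) ?zs) \<subseteq> g" unfolding eq using yz xs by simp
      from split[OF yz(1) this] i xs show ?thesis unfolding eq by simp
    qed
    have "(\<Sum>i<Suc k. ?S - ?T i) \<in> ?W" by (rule span_sum) (use T in auto)
    moreover have "(\<Sum>i<Suc k. ?T i) = ?S" using ad_prod_list[of y ?zs] xs by simp
    moreover have "(\<Sum>i<Suc k. ?S) = scale (of_nat (Suc k)) ?S"
      using scale_sum_left[of "\<lambda>_. 1" "{..<Suc k}" ?S] by simp
    ultimately have "scale (of_nat (Suc k)) ?S - ?S \<in> ?W" by (simp add: sum_subtractf del: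
        sum.lessThan_Suc of_nat_Suc)
    then have "scale (of_nat k) ?S \<in> ?W" by (simp add: scale_left_distrib)
    then have "scale (inverse (of_nat k)) (scale (of_nat k) ?S) \<in> ?W" by (rule span_scale)
    then have "?S \<in> ?W" using k by simp
    from span_diff[OF this T[of 0]] show ?thesis by simp
  qed
  show "?W = gpow scale g (k + 1)"
  proof
    have "prod_span scale (comm_span scale g (gpow scale g k)) g \<subseteq> gpow scale g (Suc k)"
      using comm_span_gpow_subset[of k] mult_gpow_right by (intro prod_span_subset subspace_gpow)
          auto
    then show "?W \<subseteq> gpow scale g (k + 1)" by (intro span_minimal subspace_gpow) auto
    have "prod_list zs \<in> ?W" if zs: "length zs = Suc k" "set zs \<subseteq> g" for zs
    proof -
      obtain x xs where x: "zs = x # xs" "x \<in> g" "set xs \<subseteq> g" "length xs = k"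
        using zs by (cases zs) auto
      \<comment> \<open>By \<open>gg\<close> the first letter is a combination of brackets, and
        \<open>adW\<close> treats words that begin with a bracket.\<close>
      have "x * prod_list xs \<in> ?W"
      proof (rule mult_right_span[OF _ subspace_span])
        show "x \<in> span {ad a b |a b. a \<in> g \<and> b \<in> g}" using x(2) gg comm_span_ad by auto
      qed (use adW x in auto)
      then show ?thesis using x by simp
    qed
    then show "gpow scale g (k + 1) \<subseteq> ?W" by (intro gpow_induct) auto
  qed
qed

end

end

section \<open>Functionals and strongly graded Lie algebras\<close>

context k_algebra
begin

interpretation functionals: vector_space_pair scale "(*) :: 'k \<Rightarrow> 'k \<Rightarrow> 'k"
  by unfold_locales (simp_all add: algebra_simps)

lemma separating_functional:
  assumes D: "subspace D" and x: "x \<notin> D"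
  obtains f :: "'b \<Rightarrow> 'k" where "\<And>a b. f (a + b) = f a + f b" "\<And>c a. f (scale c a) = c * f a"
    "\<And>a. a \<in> D \<Longrightarrow> f a = 0" "f x = 1"
proof -
  obtain B where B: "B \<subseteq> D" "independent B" "D \<subseteq> span B"
    using maximal_independent_subset by blast
  have spB: "span B = D" using B D by (simp add: span_subspace)
  have "independent (insert x B)" using B x spB by (intro independent_insertI) auto
  from functionals.linear_independent_extend[OF this, of "\<lambda>b. if b = x then 1 else 0"]
  obtain f where f: "Vector_Spaces.linear scale (*) f" "\<forall>b\<in>insert x B. f b = (if b = x then 1 else
      0)" by blast
  have f0: "f a = 0" if "a \<in> D" for a
  proof -
    have "a \<in> span B" using that spB by simp
    then show ?thesis
    proof (induction rule: span_induct_alt)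
      case (step c u w)
      moreover have "u \<noteq> x" using step(1) B(1) x by auto
      ultimately show ?case using f(2)
        by (simp add: functionals.linear_add[OF f(1)] functionals.linear_scale[OF f(1)])
    qed (rule functionals.linear_0[OF f(1)])
  qed
  show ?thesis
    by (rule that[of f, OF functionals.linear_add[OF f(1)] functionals.linear_scale[OF f(1)] f0])
        (use f(2) in auto)
qed

end

text \<open>The scalar extension of \<open>f\<close> to the algebraic closure, defined on the free
  vector space; it descends to the tensor product because it vanishes on the bilinearity relations
  when \<open>f\<close> is linear.\<close>

definition closure_functional :: "('a \<Rightarrow> 'k::field) \<Rightarrow> ('k alg_closure \<times> 'a \<Rightarrow>\<^sub>0 'k) \<Rightarrow> 'k alg_closure"
    where
  "closure_functional f p = (\<Sum>(d, x)\<in>Poly_Mapping.keys p. to_ac (Poly_Mapping.lookup p (d, x)) * d *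
      to_ac (f x))"

lemma closure_functional_eq:
  assumes "finite S" "Poly_Mapping.keys p \<subseteq> S"
  shows "closure_functional f p = (\<Sum>(d, x)\<in>S. to_ac (Poly_Mapping.lookup p (d, x)) * d * to_ac (f
      x))"
  unfolding closure_functional_def
  by (rule sum.mono_neutral_left) (use assms in \<open>auto simp: in_keys_iff\<close>)

lemma closure_functional_simps:
  "closure_functional f (p + q) = closure_functional f p + closure_functional f q"
  "closure_functional f (free_scale c p) = to_ac c * closure_functional f p"
  "closure_functional f 0 = 0"
  "closure_functional f (Poly_Mapping.single (d, x) c) = to_ac c * d * to_ac (f x)"
proof -
  let ?S = "Poly_Mapping.keys p \<union> Poly_Mapping.keys q"
  have "closure_functional f (p + q) = (\<Sum>(d, x)\<in>?S. to_ac (Poly_Mapping.lookup (p + q) (d, x)) * d *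
      to_ac (f x))"
    using Poly_Mapping.keys_add[of p q] by (intro closure_functional_eq) auto
  also have "\<dots> = (\<Sum>(d, x)\<in>?S. to_ac (Poly_Mapping.lookup p (d, x)) * d * to_ac (f x)) +
    (\<Sum>(d, x)\<in>?S. to_ac (Poly_Mapping.lookup q (d, x)) * d * to_ac (f x))"
    unfolding sum.distrib[symmetric] by (rule sum.cong) (auto simp: lookup_add distrib_right)
  also have "\<dots> = closure_functional f p + closure_functional f q"
    by (simp add: closure_functional_eq[of ?S])
  finally show "closure_functional f (p + q) = closure_functional f p + closure_functional f q" .
  have "closure_functional f (free_scale c p) =
    (\<Sum>(d, x)\<in>Poly_Mapping.keys p. to_ac (Poly_Mapping.lookup (free_scale c p) (d, x)) * d * to_ac (f
        x))"
    by (rule closure_functional_eq) (auto simp: in_keys_iff lookup_free_scale)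
  then show "closure_functional f (free_scale c p) = to_ac c * closure_functional f p"
    unfolding closure_functional_def sum_distrib_left lookup_free_scale
    by (simp only: split_def to_ac_mult mult.assoc)
  show "closure_functional f 0 = 0" by (simp add: closure_functional_def)
  have "closure_functional f (Poly_Mapping.single (d, x) c) =
    (\<Sum>(d', x')\<in>{(d, x)}. to_ac (Poly_Mapping.lookup (Poly_Mapping.single (d, x) c) (d', x')) * d' *
        to_ac (f x'))"
    by (rule closure_functional_eq) auto
  then show "closure_functional f (Poly_Mapping.single (d, x) c) = to_ac c * d * to_ac (f x)" by
      simp
qed

lemma closure_functional_diff:
  "closure_functional f (p - q) = closure_functional f p - closure_functional f q"
  using closure_functional_simps(1)[of f "p - q" q] by simp

lemma closure_functional_sum: "closure_functional f (sum h A) = (\<Sum>a\<in>A. closure_functional f (h a))"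
  by (induction A rule: infinite_finite_induct) (simp_all add: closure_functional_simps)

context char_0_k_algebra
begin

text \<open>The extension of a functional that kills \<open>[g, g]\<close> kills all brackets. It
  kills an eigenspace with \<open>c \<noteq> 0\<close> because there \<open>c U = [h0, U]\<close>,
  and the zero eigenspace because that is spanned by brackets. These spaces span everything, yet the
  functional takes the value 1 at \<open>x0\<close>.\<close>

theorem strongly_graded_imp_perfect:
  assumes g: "lie_subalgebra g" and sgr: "strongly_graded (closure_lie scale g)"
  shows "comm_span scale g g = g"
proof (rule ccontr)
  assume "comm_span scale g g \<noteq> g"
  moreover have "comm_span scale g g \<subseteq> g"
    by (rule comm_span_ad_subset) (use g in \<open>auto simp: lie_subalgebra_def\<close>)
  ultimately obtain x0 where x0: "x0 \<in> g" "x0 \<notin> comm_span scale g g" by auto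
  obtain f :: "'b \<Rightarrow> 'k" where f: "\<And>a b. f (a + b) = f a + f b" "\<And>c a. f (scale c a) = c * f a"
    "\<And>a. a \<in> comm_span scale g g \<Longrightarrow> f a = 0" "f x0 = 1"
    using separating_functional[OF subspace_comm_span x0(2)] by blast
  let ?\<Phi> = "closure_functional f"
  let ?L = "closure_lie scale g"
  let ?R = "tensor_rel (\<lambda>c d. to_ac c * d) UNIV scale g :: ('k alg_closure \<times> 'b \<Rightarrow>\<^sub>0 'k) set"
  let ?sc = "\<lambda>c p. \<Sum>(d, x)\<in>Poly_Mapping.keys p. Poly_Mapping.single (c * d, x) (Poly_Mapping.lookup
      p (d, x))"
  let ?br = "free_bilin (*) (\<lambda>x x'. x * x' - x' * x)"
  have sg: "subspace g" using g by (simp add: lie_subalgebra_def)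
  have R\<Phi>: "?\<Phi> r = 0" if "r \<in> ?R" for r
  proof -
    have sub: "free_vs.subspace {p. ?\<Phi> p = 0}"
      unfolding free_vs.subspace_def by (auto simp: closure_functional_simps)
    let ?s = "\<lambda>d x. Poly_Mapping.single (d, x) 1 :: 'k alg_closure \<times> 'b \<Rightarrow>\<^sub>0 'k"
    have gens: "?\<Phi> (?s (d + d') x - ?s d x - ?s d' x) = 0" "?\<Phi> (?s d (x + x') - ?s d x - ?s d x') =
        0"
      "?\<Phi> (?s (to_ac c * d) x - free_scale c (?s d x)) = 0"
      "?\<Phi> (?s d (scale c x) - free_scale c (?s d x)) = 0" for d d' x x' c
      unfolding closure_functional_diff closure_functional_simps f(1,2) to_ac_add to_ac_mult
      by (simp_all add: distrib_left distrib_right)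
    have "?R \<subseteq> {p. ?\<Phi> p = 0}" unfolding tensor_rel_def
      by (rule free_vs.span_minimal[OF _ sub]) (use gens in blast)
    then show ?thesis using that by blast
  qed
  \<comment> \<open>\<open>f\<close> is known to vanish on commutators of elements of
    \<open>g\<close> only, so all representatives of a coset must be supported on
    \<open>UNIV \<times> g\<close>.\<close>
  have Rkeys: "Poly_Mapping.keys r \<subseteq> UNIV \<times> g" if "r \<in> ?R" for r
  proof -
    have dif: "Poly_Mapping.keys (p - q) \<subseteq> UNIV \<times> g" if "Poly_Mapping.keys p \<subseteq> UNIV \<times> g"
        "Poly_Mapping.keys q \<subseteq> UNIV \<times> g"
      for p q :: "'k alg_closure \<times> 'b \<Rightarrow>\<^sub>0 'k"
      using keys_diff[of p q] that by blast
    have scal: "Poly_Mapping.keys (free_scale c p) \<subseteq> UNIV \<times> g" if "Poly_Mapping.keys p \<subseteq> UNIV \<times> g"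
      for c and p :: "'k alg_closure \<times> 'b \<Rightarrow>\<^sub>0 'k"
      using that by (auto simp: in_keys_iff lookup_free_scale subset_iff)
    have sub: "free_vs.subspace {p :: 'k alg_closure \<times> 'b \<Rightarrow>\<^sub>0 'k. Poly_Mapping.keys p \<subseteq> UNIV \<times> g}"
      unfolding free_vs.subspace_def using scal Poly_Mapping.keys_add by fastforce
    let ?s = "\<lambda>d x. Poly_Mapping.single (d, x) 1 :: 'k alg_closure \<times> 'b \<Rightarrow>\<^sub>0 'k"
    have single: "Poly_Mapping.keys (?s d x) \<subseteq> UNIV \<times> g" if "x \<in> g" for d x using that by auto
    have gens: "Poly_Mapping.keys (?s (d + d') x - ?s d x - ?s d' x) \<subseteq> UNIV \<times> g"
      "x' \<in> g \<Longrightarrow> Poly_Mapping.keys (?s d (x + x') - ?s d x - ?s d x') \<subseteq> UNIV \<times> g"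
      "Poly_Mapping.keys (?s (to_ac c * d) x - free_scale c (?s d x)) \<subseteq> UNIV \<times> g"
      "Poly_Mapping.keys (?s d (scale c x) - free_scale c (?s d x)) \<subseteq> UNIV \<times> g"
      if "x \<in> g" for d d' x x' c
      by (intro dif scal single that subspace_add[OF sg] subspace_scale[OF sg]; assumption)+
    have "?R \<subseteq> {p. Poly_Mapping.keys p \<subseteq> UNIV \<times> g}" unfolding tensor_rel_def
    proof (rule free_vs.span_minimal[OF _ sub], intro Un_least subsetI; elim CollectE exE conjE;
        intro CollectI; hypsubst)
    qed (rule gens; assumption)+
    then show ?thesis using that by blast
  qed
  have sc\<Phi>: "?\<Phi> (?sc c p) = c * ?\<Phi> p" for c p
  proof -
    have "?\<Phi> (?sc c p) = (\<Sum>(d, x)\<in>Poly_Mapping.keys p. to_ac (Poly_Mapping.lookup p (d, x)) * (c *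
        d) * to_ac (f x))"
      unfolding closure_functional_sum split_def closure_functional_simps ..
    also have "\<dots> = c * ?\<Phi> p" unfolding closure_functional_def sum_distrib_left split_def
      by (rule sum.cong[OF refl]) (simp only: mult.assoc mult.left_commute)
    finally show ?thesis .
  qed
  have br\<Phi>: "?\<Phi> (?br p q) = 0" if "Poly_Mapping.keys p \<subseteq> UNIV \<times> g" "Poly_Mapping.keys q \<subseteq> UNIV \<times> g"
      for p q
    unfolding free_bilin_def closure_functional_sum
  proof (rule sum.neutral, rule ballI)
    fix a assume a: "a \<in> Poly_Mapping.keys p"
    from a that(1) obtain d x where dx: "a = (d, x)" "x \<in> g" by auto
    have "?\<Phi> (Poly_Mapping.single (d * d', x * x' - x' * x) c) = 0" if "x' \<in> g" for d' x' c
      using f(3)[OF comm_spanI[OF dx(2) that]] by (simp add: closure_functional_simps)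
    then have "(\<Sum>(d', x')\<in>Poly_Mapping.keys q. ?\<Phi> (Poly_Mapping.single (d * d', x * x' - x' * x)
        (Poly_Mapping.lookup p (d, x) * Poly_Mapping.lookup q (d', x')))) = 0"
      using that(2) by (intro sum.neutral) auto
    then show "?\<Phi> (case a of (x, y) \<Rightarrow> \<Sum>(x', y')\<in>Poly_Mapping.keys q.
        Poly_Mapping.single (x * x', y * y' - y' * y) (Poly_Mapping.lookup p (x, y) *
            Poly_Mapping.lookup q (x', y'))) = 0"
      unfolding dx closure_functional_sum by (simp add: case_prod_beta closure_functional_sum)
  qed
  have R0: "0 \<in> ?R" unfolding tensor_rel_def by (rule free_vs.span_zero)
  have span\<Phi>: "\<forall>u\<in>U. ?\<Phi> u = 0" if "U \<in> lie_span ?L S" "\<And>U. U \<in> S \<Longrightarrow> \<forall>u\<in>U. ?\<Phi> u = 0" for U S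
    using that(1)
  proof (induction rule: lie_span.induct)
    case zero
    then show ?case using R\<Phi> by (simp add: closure_lie_def quotient_lie_def)
  next
    case (base x)
    then show ?case using that(2) by blast
  next
    case (add x y)
    then show ?case using R\<Phi> by (auto simp: closure_lie_def quotient_lie_def
        closure_functional_simps)
  next
    case (smult x c)
    then show ?case using R\<Phi> by (auto simp: closure_lie_def quotient_lie_def
        closure_functional_simps sc\<Phi>)
  qed
  have carr: "\<exists>p. U = (+) p ` ?R \<and> Poly_Mapping.keys p \<subseteq> UNIV \<times> g" if "U \<in> carrier ?L" for U
    using that by (auto simp: closure_lie_def quotient_lie_def)
  have carr_keys: "Poly_Mapping.keys u \<subseteq> UNIV \<times> g" if "U \<in> carrier ?L" "u \<in> U" for U u
    using carr[OF that(1)] that(2) Rkeys Poly_Mapping.keys_add by fastforce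
  have brack: "\<forall>u\<in>lbracket ?L V W. ?\<Phi> u = 0" if "V \<in> carrier ?L" "W \<in> carrier ?L" for V W
    using carr_keys[OF that(1)] carr_keys[OF that(2)] br\<Phi> R\<Phi>
    by (auto simp: closure_lie_def quotient_lie_def closure_functional_simps)
  obtain h0 where h0: "h0 \<in> carrier ?L" "carrier ?L = lie_span ?L (\<Union>c. ad_eigenspace ?L h0 c)"
    "ad_eigenspace ?L h0 0 = lie_span ?L (\<Union>c\<in>UNIV - {0}.
       lie_span ?L {lbracket ?L x y |x y. x \<in> ad_eigenspace ?L h0 c \<and> y \<in> ad_eigenspace ?L h0 (-
           c)})"
    using sgr unfolding strongly_graded_def by blast
  have "\<forall>u\<in>U. ?\<Phi> u = 0" if U: "U \<in> ad_eigenspace ?L h0 c" for U c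
  proof (cases "c = 0")
    case False
    have Uc: "U \<in> carrier ?L" "lbracket ?L h0 U = lsmult ?L c U" using U by (auto simp:
        ad_eigenspace_def)
    show ?thesis
    proof
      fix u assume u: "u \<in> U"
      \<comment> \<open>The summand 0 is the element of \<open>?R\<close> that exhibits the
        membership in the coset.\<close>
      have "?sc c u + 0 \<in> lsmult ?L c U"
        unfolding closure_lie_def quotient_lie_def lie_struct.simps using u R0 by blast
      then have "?\<Phi> (?sc c u + 0) = 0" using brack[OF h0(1) Uc(1)] Uc(2) by blast
      then show "?\<Phi> u = 0" using False by (simp add: sc\<Phi>)
    qed
  next
    case True
    show ?thesis
    proof (rule span\<Phi>[OF U[unfolded True h0(3)]])
      fix U assume "U \<in> (\<Union>c\<in>UNIV - {0}. lie_span ?L {lbracket ?L x y |x y.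
        x \<in> ad_eigenspace ?L h0 c \<and> y \<in> ad_eigenspace ?L h0 (- c)})"
      then obtain c where "U \<in> lie_span ?L {lbracket ?L x y |x y.
        x \<in> ad_eigenspace ?L h0 c \<and> y \<in> ad_eigenspace ?L h0 (- c)}" by blast
      then show "\<forall>u\<in>U. ?\<Phi> u = 0"
        by (rule span\<Phi>) (use brack in \<open>auto simp: ad_eigenspace_def\<close>)
    qed
  qed
  then have all: "\<forall>u\<in>U. ?\<Phi> u = 0" if "U \<in> carrier ?L" for U
    using span\<Phi>[OF that[unfolded h0(2)]] by blast
  let ?p = "Poly_Mapping.single (1, x0) 1 :: 'k alg_closure \<times> 'b \<Rightarrow>\<^sub>0 'k"
  have "(+) ?p ` ?R \<in> carrier ?L" using x0(1) by (auto simp: closure_lie_def quotient_lie_def)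
  moreover have "?p + 0 \<in> (+) ?p ` ?R" using R0 by blast
  ultimately have "?\<Phi> (?p + 0) = 0" using all by blast
  then show False using f(4) by (simp add: closure_functional_simps)
qed

end

section \<open>The Lie algebra generated by \<open>F \<cdot> g\<close>\<close>

context k_algebra
begin

abbreviation lc :: "nat \<Rightarrow> 'b set" where "lc \<equiv> lower_central scale"
abbreviation I :: "nat \<Rightarrow> 'b set" where "I \<equiv> I_ideal scale"
abbreviation FI :: "nat \<Rightarrow> 'b set" where "FI k \<equiv> comm_span scale UNIV (I k)"

lemma subspace_lower_central: "subspace (lc m)"
  by (cases m) simp_all

lemma subspace_I_ideal: "subspace (I k)"
  by (simp add: I_ideal_def)

lemma prod_spans_subset_I_ideal: "ms \<noteq> [] \<Longrightarrow> prod_spans scale (map lc ms) \<subseteq> I (sum_list ms)"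
proof -
  assume "ms \<noteq> []"
  then have "length ms \<in> {1..}" by (simp add: Suc_le_eq)
  have "prod_spans scale (map lc ms) \<subseteq> (\<Union>ms'\<in>{ms'. length ms' = length ms \<and> sum_list ms' = sum_list
      ms}.
      prod_spans scale (map lc ms'))" by blast
  also have "\<dots> \<subseteq> I_len scale (sum_list ms) (length ms)" unfolding I_len_def by (rule span_superset)
  also have "\<dots> \<subseteq> (\<Union>l\<in>{1..}. I_len scale (sum_list ms) l)" using \<open>length ms \<in> {1..}\<close> by blast
  also have "\<dots> \<subseteq> I (sum_list ms)" unfolding I_ideal_def by (rule span_superset)
  finally show ?thesis .
qed

lemma I_ideal_subset:
  assumes "\<And>ms. ms \<noteq> [] \<Longrightarrow> sum_list ms = k \<Longrightarrow> prod_spans scale (map lc ms) \<subseteq> U" "subspace U"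
  shows "I k \<subseteq> U"
  unfolding I_ideal_def
proof (rule span_minimal[OF UN_least assms(2)])
  fix l :: nat assume l: "l \<in> {1..}"
  show "I_len scale k l \<subseteq> U" unfolding I_len_def
  proof (rule span_minimal[OF UN_least assms(2)])
    fix ms assume "ms \<in> {ms. length ms = l \<and> sum_list ms = k}"
    moreover from this have "ms \<noteq> []" using l by auto
    ultimately show "prod_spans scale (map lc ms) \<subseteq> U" using assms(1)[of ms] by simp
  qed
qed

lemma prod_spans_append:
  assumes "x \<in> prod_spans scale (map lc ms)" "y \<in> prod_spans scale (map lc ns)" "ms \<noteq> []" "ns \<noteq> []"
  shows "x * y \<in> prod_spans scale (map lc (ms @ ns))"
  using assms(1,3)
proof (induction ms arbitrary: x)
  case (Cons m ms)
  show ?case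
  proof (cases ms)
    case Nil
    obtain n ns' where "ns = n # ns'" using assms(4) by (cases ns) auto
    then show ?thesis using Cons.prems(1) assms(2) Nil by (auto intro: prod_spanI)
  next
    case ms: (Cons m' ms')
    have "x \<in> span {a * b |a b. a \<in> lc m \<and> b \<in> prod_spans scale (map lc ms)}"
      using Cons.prems(1) unfolding ms by (simp add: prod_span_def)
    then show ?thesis
    proof (rule mult_right_span[rotated 2])
      fix x assume "x \<in> {a * b |a b. a \<in> lc m \<and> b \<in> prod_spans scale (map lc ms)}"
      then obtain a b where ab: "x = a * b" "a \<in> lc m" "b \<in> prod_spans scale (map lc ms)" by blast
      have "b * y \<in> prod_spans scale (map lc (ms @ ns))" using Cons.IH[OF ab(3)] ms by simp
      then show "x * y \<in> prod_spans scale (map lc ((m # ms) @ ns))"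
        using ab ms by (auto simp: mult.assoc intro: prod_spanI)
    qed (use ms in simp)
  qed
qed simp

lemma lower_central_subset_I_ideal: "lc m \<subseteq> I m"
  using prod_spans_subset_I_ideal[of "[m]"] by simp

lemma I_ideal_mult:
  assumes "x \<in> I j" "y \<in> I k" shows "x * y \<in> I (j + k)"
proof -
  have 1: "x * y \<in> I (j + k)" if x: "x \<in> prod_spans scale (map lc ms)" "ms \<noteq> []" "sum_list ms = j"
      and y: "y \<in> I k" for x y ms
  proof -
    have sub: "subspace {y. x * y \<in> I (j + k)}"
      using subspace_I_ideal[of "j + k"] unfolding subspace_def by (auto simp: distrib_left
          scale_mult_right)
    have "I k \<subseteq> {y. x * y \<in> I (j + k)}"
    proof (rule I_ideal_subset[OF _ sub], clarify)
      fix ns y assume "ns \<noteq> []" "k = sum_list ns" "y \<in> prod_spans scale (map lc ns)"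
      then show "x * y \<in> I (j + sum_list ns)"
        using prod_spans_append[OF x(1) _ x(2)] prod_spans_subset_I_ideal[of "ms @ ns"] x(2,3) by
            auto
    qed
    then show ?thesis using y by blast
  qed
  have sub: "subspace {x. x * y \<in> I (j + k)}"
    using subspace_I_ideal[of "j + k"] unfolding subspace_def by (auto simp: distrib_right
        scale_mult_left)
  have "I j \<subseteq> {x. x * y \<in> I (j + k)}"
    by (rule I_ideal_subset[OF _ sub]) (use 1 assms(2) in auto)
  then show ?thesis using assms(1) by blast
qed

lemma I_ideal_0: "I 0 = UNIV"
  using lower_central_subset_I_ideal[of 0] by auto

lemma I_ideal_left: "i \<in> I k \<Longrightarrow> f * i \<in> I k" and I_ideal_right: "i \<in> I k \<Longrightarrow> i * f \<in> I k"
  using I_ideal_mult[of f 0 i k] I_ideal_mult[of i k f 0] I_ideal_0 by auto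

lemma FI_subset_same: "FI k \<subseteq> I k"
  by (rule comm_span_subset[OF _ subspace_I_ideal])
    (rule subspace_diff[OF subspace_I_ideal I_ideal_left I_ideal_right])

text \<open>\<open>[f, -]\<close> is a derivation, and on each factor it raises the index of the
  lower central series by 1.\<close>

lemma FI_subset: "FI k \<subseteq> I (Suc k)"
proof (rule comm_span_subset[OF _ subspace_I_ideal])
  fix f u assume u: "u \<in> I k"
  have sub: "subspace {u. f * u - u * f \<in> I (Suc k)}"
    using subspace_I_ideal[of "Suc k"] unfolding subspace_def
  proof (safe)
    fix x y assume *: "f * x - x * f \<in> I (Suc k)" "f * y - y * f \<in> I (Suc k)"
      and "\<forall>x\<in>I (Suc k). \<forall>y\<in>I (Suc k). x + y \<in> I (Suc k)"
    moreover have "f * (x + y) - (x + y) * f = (f * x - x * f) + (f * y - y * f)" by (simp add: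
        algebra_simps)
    ultimately show "f * (x + y) - (x + y) * f \<in> I (Suc k)" by simp
  next
    fix c x assume "f * x - x * f \<in> I (Suc k)" "\<forall>c. \<forall>x\<in>I (Suc k). scale c x \<in> I (Suc k)"
    moreover have "f * scale c x - scale c x * f = scale c (f * x - x * f)"
      by (simp add: scale_mult_left scale_mult_right scale_right_diff_distrib)
    ultimately show "f * scale c x - scale c x * f \<in> I (Suc k)" by simp
  qed simp
  have "f * u - u * f \<in> I (Suc (sum_list ms))" if "ms \<noteq> []" "u \<in> prod_spans scale (map lc ms)" for
      ms u
    using that
  proof (induction ms arbitrary: u)
    case (Cons m ms)
    show ?case
    proof (cases ms)
      case Nil
      then have "f * u - u * f \<in> lc (Suc m)" using Cons.prems by (auto intro: comm_spanI)
      then show ?thesis using lower_central_subset_I_ideal[of "Suc m"] Nil by auto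
    next
      case ms: (Cons m' ms')
      have "u \<in> span {a * b |a b. a \<in> lc m \<and> b \<in> prod_spans scale (map lc ms)}"
        using Cons.prems unfolding ms by (simp add: prod_span_def)
      then show ?thesis
      proof (rule commutator_left_span[OF _ subspace_I_ideal, rotated])
        fix u assume "u \<in> {a * b |a b. a \<in> lc m \<and> b \<in> prod_spans scale (map lc ms)}"
        then obtain a b where ab: "u = a * b" "a \<in> lc m" "b \<in> prod_spans scale (map lc ms)" by blast
        have "f * b - b * f \<in> I (Suc (sum_list ms))" using Cons.IH ab ms by simp
        then have "a * (f * b - b * f) \<in> I (m + Suc (sum_list ms))"
          using ab lower_central_subset_I_ideal by (intro I_ideal_mult) auto
        moreover have "f * a - a * f \<in> lc (Suc m)" using ab by (auto intro: comm_spanI)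
        then have "(f * a - a * f) * b \<in> I (Suc m + sum_list ms)"
          using ab lower_central_subset_I_ideal[of "Suc m"] prod_spans_subset_I_ideal[of ms] ms
          by (intro I_ideal_mult) auto
        ultimately have "(f * a - a * f) * b + a * (f * b - b * f) \<in> I (Suc (sum_list (m # ms)))"
          using subspace_add[OF subspace_I_ideal] by simp
        then show "f * u - u * f \<in> I (Suc (sum_list (m # ms)))" unfolding ab by (simp add:
            algebra_simps)
      qed
    qed
  qed simp
  then have "I k \<subseteq> {u. f * u - u * f \<in> I (Suc k)}" by (intro I_ideal_subset[OF _ sub]) auto
  then show "f * u - u * f \<in> I (Suc k)" using u by blast
qed

text \<open>The two-sided ideal generated by \<open>FI k\<close>. The right multiples alone need not
  contain \<open>FI k\<close> when the algebra has no unit, so it is added.\<close>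

definition FI_ideal :: "nat \<Rightarrow> 'b set" where
  "FI_ideal k = span (FI k \<union> {x * f |x f. x \<in> FI k})"

lemma FI_subset_FI_ideal: "FI k \<subseteq> FI_ideal k"
  unfolding FI_ideal_def using span_superset by blast

text \<open>Left multiples reduce to right multiples by \<open>f y = [f, y] + y f\<close>, where
  \<open>[f, y]\<close> is in \<open>FI k\<close> because \<open>y\<close> is in
  \<open>I k\<close>.\<close>

lemma FI_ideal_left: "x \<in> FI_ideal k \<Longrightarrow> f * x \<in> FI_ideal k"
  unfolding FI_ideal_def
proof (rule mult_left_span[rotated 2], assumption)
  fix x assume x: "x \<in> FI k \<union> {x * f |x f. x \<in> FI k}"
  have comm: "f * y - y * f \<in> FI k" if "y \<in> FI k" for y
    using FI_subset_same that by (intro comm_spanI) auto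
  have y: "f * y * h \<in> span (FI k \<union> {x * f |x f. x \<in> FI k})" if "y \<in> FI k" for y h
  proof -
    have "(f * y - y * f) * h \<in> span (FI k \<union> {x * f |x f. x \<in> FI k})" 
      "y * (f * h) \<in> span (FI k \<union> {x * f |x f. x \<in> FI k})"
      using comm[OF that] that by (auto intro!: span_base)
    from span_add[OF this] show ?thesis by (simp add: algebra_simps)
  qed
  have y': "f * y \<in> span (FI k \<union> {x * f |x f. x \<in> FI k})" if "y \<in> FI k" for y
  proof -
    have "f * y - y * f \<in> span (FI k \<union> {x * f |x f. x \<in> FI k})" 
      "y * f \<in> span (FI k \<union> {x * f |x f. x \<in> FI k})"
      using comm[OF that] that by (auto intro!: span_base)
    from span_add[OF this] show ?thesis by simp
  qed
  show "f * x \<in> span (FI k \<union> {x * f |x f. x \<in> FI k})"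
    using x y y' by (auto simp: mult.assoc)
qed simp

text \<open>The identity \<open>[a, b] v = [a, b v] - b [a, v]\<close> moves one unit of weight from
  the left factor to \<open>v\<close>. Its first term lies in \<open>FI k\<close>, the second is
  covered by the induction on \<open>m\<close>.\<close>

lemma lower_central_mult_FI:
  assumes "x \<in> lc m" "v \<in> FI j" "m + j = k"
  shows "x * v \<in> FI_ideal k"
  using assms
proof (induction m arbitrary: x v j)
  case 0
  then show ?case using FI_ideal_left[of v k x] FI_subset_FI_ideal[of k] by auto
next
  case (Suc m)
  have sub: "subspace (FI_ideal k)" by (simp add: FI_ideal_def)
  have "x \<in> span {a * b - b * a |a b. a \<in> UNIV \<and> b \<in> lc m}" using Suc.prems(1) by (simp add:
      comm_span_def)
  then show ?case
  proof (rule mult_right_span[OF _ sub, rotated])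
    fix x assume "x \<in> {a * b - b * a |a b. a \<in> UNIV \<and> b \<in> lc m}"
    then obtain a b where ab: "x = a * b - b * a" "b \<in> lc m" by blast
    have v: "v \<in> I (Suc j)" using FI_subset Suc.prems(2) by blast
    have "b * v \<in> I (m + Suc j)" using ab lower_central_subset_I_ideal v by (intro I_ideal_mult)
        auto
    then have "b * v \<in> I k" using Suc.prems(3) by simp
    then have "a * (b * v) - b * v * a \<in> FI_ideal k" using FI_subset_FI_ideal by (auto intro:
        comm_spanI)
    moreover have "a * v - v * a \<in> FI (Suc j)" using v by (auto intro: comm_spanI)
    then have "b * (a * v - v * a) \<in> FI_ideal k" by (rule Suc.IH[OF ab(2)]) (use Suc.prems(3) in
        simp)
    ultimately have "a * (b * v) - b * v * a - b * (a * v - v * a) \<in> FI_ideal k" by (rule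
        subspace_diff[OF sub])
    then show "x * v \<in> FI_ideal k" unfolding ab by (simp add: algebra_simps)
  qed
qed

text \<open>The converse of \<open>FI_subset\<close> up to right multiples. A first factor of weight
  0 is absorbed by \<open>FI_ideal_left\<close>; one of positive weight is a combination of
  commutators \<open>[a, b]\<close>, and the identity \<open>[a, b] u = [a, b u] - b [a, u]\<close>
  applies again.\<close>

lemma I_ideal_Suc_subset: "I (Suc k) \<subseteq> FI_ideal k"
proof (rule I_ideal_subset)
  show sub: "subspace (FI_ideal k)" by (simp add: FI_ideal_def)
  fix ms assume "ms \<noteq> []" "sum_list ms = Suc k"
  then show "prod_spans scale (map lc ms) \<subseteq> FI_ideal k"
  proof (induction ms)
    case (Cons m ms)
    show ?case
    proof (cases ms)
      case Nil
      then have "m = Suc k" using Cons.prems by simp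
      moreover have "lc (Suc k) \<subseteq> FI k" using lower_central_subset_I_ideal by (simp add:
          comm_span_mono)
      ultimately show ?thesis using Nil FI_subset_FI_ideal by auto
    next
      case ms: (Cons m' ms')
      have "prod_span scale (lc m) (prod_spans scale (map lc ms)) \<subseteq> FI_ideal k"
      proof (rule prod_span_subset[OF _ sub])
        fix x u assume x: "x \<in> lc m" and u: "u \<in> prod_spans scale (map lc ms)"
        show "x * u \<in> FI_ideal k"
        proof (cases m)
          case 0
          then show ?thesis using Cons u ms by (auto intro!: FI_ideal_left)
        next
          case (Suc m0)
          have uI: "u \<in> I (sum_list ms)" using prod_spans_subset_I_ideal[of ms] ms u by auto
          have "x \<in> span {a * b - b * a |a b. a \<in> UNIV \<and> b \<in> lc m0}" using x Suc by (simp add: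
              comm_span_def)
          then show ?thesis
          proof (rule mult_right_span[OF _ sub, rotated])
            fix x assume "x \<in> {a * b - b * a |a b. a \<in> UNIV \<and> b \<in> lc m0}"
            then obtain a b where ab: "x = a * b - b * a" "b \<in> lc m0" by blast
            have "b * u \<in> I (m0 + sum_list ms)" using ab lower_central_subset_I_ideal uI by (intro
                I_ideal_mult) auto
            then have "b * u \<in> I k" using Cons.prems(2) Suc by simp
            then have "a * (b * u) - b * u * a \<in> FI_ideal k" using FI_subset_FI_ideal by (auto
                intro: comm_spanI)
            moreover have "a * u - u * a \<in> FI (sum_list ms)" using uI by (auto intro: comm_spanI)
            then have "b * (a * u - u * a) \<in> FI_ideal k"
              by (rule lower_central_mult_FI[OF ab(2)]) (use Cons.prems(2) Suc in simp)
            ultimately have "a * (b * u) - b * u * a - b * (a * u - u * a) \<in> FI_ideal k" by (rule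
                subspace_diff[OF sub])
            then show "x * u \<in> FI_ideal k" unfolding ab by (simp add: algebra_simps)
          qed
        qed
      qed
      then show ?thesis using ms by simp
    qed
  qed simp
qed

lemma I_ideal_decreasing: "I (Suc k) \<subseteq> I k"
proof -
  have "FI_ideal k \<subseteq> I k" unfolding FI_ideal_def
    by (rule span_minimal[OF _ subspace_I_ideal]) (use FI_subset_same[of k] I_ideal_right[of _ k] in
        auto)
  then show ?thesis using I_ideal_Suc_subset by blast
qed

end

text \<open>An abstract setting for the bracket computations: a vector space with a bilinear bracket
  and pure tensors \<open>ten f x\<close>. It lets the argument run with ordinary vector space
  operations instead of operations on cosets. The Jacobi identity is stated as the commutator
  formula for \<open>br (br u v)\<close>, the form used for generated subalgebras.\<close>

locale tensor_bracket = F: k_algebra sF + A: char_0_unital_k_algebra sA + V: vector_space sV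
  for sF :: "'k::field_char_0 \<Rightarrow> 'f::ring \<Rightarrow> 'f" and sA :: "'k \<Rightarrow> 'a::{ring,monoid_mult} \<Rightarrow> 'a"
    and sV :: "'k \<Rightarrow> 'v::ab_group_add \<Rightarrow> 'v" +
  fixes ten :: "'f \<Rightarrow> 'a \<Rightarrow> 'v" and br :: "'v \<Rightarrow> 'v \<Rightarrow> 'v"
  assumes ten_add: "ten (f + f') x = ten f x + ten f' x" "ten f (x + x') = ten f x + ten f x'"
    and ten_scale: "ten (sF c f) x = sV c (ten f x)" "ten f (sA c x) = sV c (ten f x)"
    and br_add: "br (u + u') v = br u v + br u' v" "br u (v + v') = br u v + br u v'"
    and br_scale: "br (sV c u) v = sV c (br u v)" "br u (sV c v) = sV c (br u v)"
    and br_ten: "br (ten f x) (ten f' x') = ten (f * f') (x * x') - ten (f' * f) (x' * x)"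
    and jacobi: "br (br u v) w = br u (br v w) - br v (br u w)"
begin

definition dot :: "'f set \<Rightarrow> 'a set \<Rightarrow> 'v set" where
  "dot S T = V.span {ten x y |x y. x \<in> S \<and> y \<in> T}"

inductive_set gen :: "'v set \<Rightarrow> 'v set" for S :: "'v set" where
  zero: "0 \<in> gen S"
| base: "x \<in> S \<Longrightarrow> x \<in> gen S"
| add: "x \<in> gen S \<Longrightarrow> y \<in> gen S \<Longrightarrow> x + y \<in> gen S"
| smult: "x \<in> gen S \<Longrightarrow> sV c x \<in> gen S"
| bracket: "x \<in> gen S \<Longrightarrow> y \<in> gen S \<Longrightarrow> br x y \<in> gen S"

lemma subspace_gen: "V.subspace (gen S)"
  unfolding V.subspace_def by (auto intro: gen.intros)

lemma ten_0: "ten 0 x = 0" "ten f 0 = 0"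
  using ten_scale(1)[of 0 0 x] ten_scale(2)[of f 0 0] by simp_all

lemma ten_diff: "ten (f - f') x = ten f x - ten f' x" "ten f (x - x') = ten f x - ten f x'"
  using ten_add(1)[of "f - f'" f' x, symmetric] ten_add(2)[of f "x - x'" x', symmetric]
  unfolding eq_diff_eq by simp_all

lemma dot_subset: "(\<And>f x. f \<in> S \<Longrightarrow> x \<in> T \<Longrightarrow> ten f x \<in> U) \<Longrightarrow> V.subspace U \<Longrightarrow> dot S T \<subseteq> U"
  unfolding dot_def by (rule V.span_minimal) auto

lemma ten_span_left:
  assumes "\<And>f. f \<in> S \<Longrightarrow> ten f x \<in> U" "V.subspace U" "f \<in> F.span S"
  shows "ten f x \<in> U"
  using assms(3)
proof (induction rule: F.span_induct_alt)
  case base then show ?case using assms(2) by (simp add: ten_0 V.subspace_0)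
next
  case (step c u w)
  then show ?case using assms(1,2) by (simp add: ten_add ten_scale V.subspace_add V.subspace_scale)
qed

lemma ten_span_right:
  assumes "\<And>x. x \<in> S \<Longrightarrow> ten f x \<in> U" "V.subspace U" "x \<in> A.span S"
  shows "ten f x \<in> U"
  using assms(3)
proof (induction rule: A.span_induct_alt)
  case base then show ?case using assms(2) by (simp add: ten_0 V.subspace_0)
next
  case (step c u w)
  then show ?case using assms(1,2) by (simp add: ten_add ten_scale V.subspace_add V.subspace_scale)
qed

text \<open>The two splittings differ in the mixed term that is added and subtracted. The first
  produces words \<open>x w\<close> and serves stability and rotation; the second produces
  \<open>w x\<close> and so meets the products \<open>[g, g^k] g\<close> of the perfectness
  condition.\<close>

lemma br_ten_left: "br (ten f x) (ten i w) = ten (f * i - i * f) (x * w) + ten (i * f) (ad x w)"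
  and br_ten_right: "br (ten f x) (ten i w) = ten (f * i) (ad x w) + ten (f * i - i * f) (w * x)"
  by (simp_all add: br_ten ten_diff ad_def)

lemma br_span:
  assumes "\<And>x y. x \<in> S \<Longrightarrow> y \<in> T \<Longrightarrow> br x y \<in> U" "V.subspace U" "x \<in> V.span S" "y \<in> V.span T"
  shows "br x y \<in> U"
proof -
  have br0: "br 0 y = 0" "br y 0 = 0" for y using br_scale(1)[of 0 0 y] br_scale(2)[of y 0 0] by
      simp_all
  have 1: "br x y \<in> U" if "x \<in> S" for x
    using assms(4)
  proof (induction rule: V.span_induct_alt)
    case base then show ?case using assms(2) by (simp add: br0 V.subspace_0)
  next
    case (step c u w)
    then show ?case using assms(1)[OF that] assms(2) by (simp add: br_add br_scale V.subspace_add
        V.subspace_scale)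
  qed
  show ?thesis
    using assms(3)
  proof (induction rule: V.span_induct_alt)
    case base then show ?case using assms(2) by (simp add: br0 V.subspace_0)
  next
    case (step c u w)
    then show ?case using 1 assms(2) by (simp add: br_add br_scale V.subspace_add V.subspace_scale)
  qed
qed

context
  fixes g :: "'a set"
  assumes g: "A.lie_subalgebra g"
begin

abbreviation gp :: "nat \<Rightarrow> 'a set" where "gp k \<equiv> gpow sA g k"
abbreviation L :: "'v set" where "L \<equiv> gen (dot UNIV g)"

definition closed_form :: "'v set" where
  "closed_form = V.span (dot UNIV g \<union> (\<Union>k\<in>{1..}. dot (F.I k) (comm_span sA g (gp (k + 1))) \<union>
     dot (F.FI (k - 1)) (gp (k + 1))))"

lemma subspace_closed_form: "V.subspace closed_form"
  by (simp add: closed_form_def)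

lemma closed_form_intros:
  "x \<in> g \<Longrightarrow> ten f x \<in> closed_form"
  "k \<ge> 1 \<Longrightarrow> i \<in> F.I k \<Longrightarrow> w \<in> comm_span sA g (gp (k + 1)) \<Longrightarrow> ten i w \<in> closed_form"
  "i \<in> F.FI k \<Longrightarrow> w \<in> gp (k + 2) \<Longrightarrow> ten i w \<in> closed_form"
proof -
  have dotI: "x \<in> S \<Longrightarrow> y \<in> T \<Longrightarrow> ten x y \<in> dot S T" for x y S T
    unfolding dot_def by (rule V.span_base) auto
  have sup: "dot UNIV g \<union> (\<Union>k\<in>{1..}. dot (F.I k) (comm_span sA g (gp (k + 1))) \<union> dot (F.FI (k - 1))
      (gp (k + 1))) \<subseteq> closed_form"
    unfolding closed_form_def by (rule V.span_superset)
  show "x \<in> g \<Longrightarrow> ten f x \<in> closed_form" using dotI[of f UNIV x g] sup by auto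
  show "k \<ge> 1 \<Longrightarrow> i \<in> F.I k \<Longrightarrow> w \<in> comm_span sA g (gp (k + 1)) \<Longrightarrow> ten i w \<in> closed_form"
    using dotI[of i "F.I k" w "comm_span sA g (gp (k + 1))"] sup by (auto simp: subset_iff)
  show "i \<in> F.FI k \<Longrightarrow> w \<in> gp (k + 2) \<Longrightarrow> ten i w \<in> closed_form"
    using dotI[of i "F.FI k" w "gp (k + 2)"] sup UN_I[of "Suc k" "{1..}" "ten i w" "\<lambda>k. dot (F.I k)
        (comm_span sA g (gp (k + 1))) \<union> dot (F.FI (k - 1)) (gp (k + 1))"]
    by auto
qed

lemma gp_1: "gp 1 = g"
  using A.gpow_1 g by (simp add: A.lie_subalgebra_def)

lemma br_closed_form:
  assumes "u \<in> dot UNIV g" "z \<in> closed_form"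
  shows "br u z \<in> closed_form"
proof (rule br_span[OF _ subspace_closed_form assms(1)[unfolded dot_def] assms(2)[unfolded
    closed_form_def]])
  fix u z assume "u \<in> {ten x y |x y. x \<in> UNIV \<and> y \<in> g}"
    and z: "z \<in> dot UNIV g \<union> (\<Union>k\<in>{1..}. dot (F.I k) (comm_span sA g (gp (k + 1))) \<union> dot (F.FI (k -
        1)) (gp (k + 1)))"
  then obtain f x where u: "u = ten f x" "x \<in> g" by blast
  have reduce: "br u z \<in> closed_form" if "z \<in> dot S T" "\<And>i w. i \<in> S \<Longrightarrow> w \<in> T \<Longrightarrow> br u (ten i w) \<in>
      closed_form" for S T
    by (rule br_span[of "{u}" "{ten x y |x y. x \<in> S \<and> y \<in> T}"])
      (use that subspace_closed_form in \<open>auto simp: dot_def intro: V.span_base\<close>)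
  from z consider "z \<in> dot UNIV g" | k where "k \<ge> 1" "z \<in> dot (F.I k) (comm_span sA g (gp (k + 1)))"
    | k where "k \<ge> 1" "z \<in> dot (F.FI (k - 1)) (gp (k + 1))" by auto
  then show "br u z \<in> closed_form"
  proof cases
    case 1
    then show ?thesis
    proof (rule reduce)
      fix i w assume w: "w \<in> g"
      have "f * i - i * f \<in> F.FI 0" by (rule F.comm_spanI) (auto simp: F.I_ideal_0)
      moreover have "x * w \<in> gp (0 + 2)" using A.mult_gpow_left[OF u(2), of w 1] w gp_1 by (simp
          add: numeral_2_eq_2)
      moreover have "ad x w \<in> g" using g u(2) w by (simp add: A.lie_subalgebra_def)
      ultimately show "br u (ten i w) \<in> closed_form" unfolding u br_ten_left
        by (intro V.subspace_add[OF subspace_closed_form] closed_form_intros(1)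
            closed_form_intros(3)[of _ 0])
    qed
  next
    case (2 k)
    show ?thesis
    proof (rule reduce[OF 2(2)])
      fix i w assume i: "i \<in> F.I k" and w: "w \<in> comm_span sA g (gp (k + 1))"
      have wg: "w \<in> gp (k + 1)" using w A.comm_span_gpow_subset[OF g] by blast
      have "f * i - i * f \<in> F.FI k" by (rule F.comm_spanI) (use i in auto)
      moreover have "x * w \<in> gp (k + 2)" using A.mult_gpow_left[OF u(2) wg] by simp
      moreover have "ad x w \<in> comm_span sA g (gp (k + 1))" by (rule A.comm_span_adI[OF u(2) wg])
      ultimately show "br u (ten i w) \<in> closed_form" unfolding u br_ten_left
        by (intro V.subspace_add[OF subspace_closed_form] closed_form_intros(2)[OF 2(1)]
            closed_form_intros(3)[of _ k]
            F.I_ideal_right i)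
    qed
  next
    case (3 k)
    show ?thesis
    proof (rule reduce[OF 3(2)])
      fix i w assume i: "i \<in> F.FI (k - 1)" and w: "w \<in> gp (k + 1)"
      \<comment> \<open>\<open>FI (k - 1)\<close> lies in \<open>I k\<close>, so both terms of the
        bracket are of the same kinds as in the preceding case.\<close>
      have iI: "i \<in> F.I k" using i F.FI_subset[of "k - 1"] 3(1) by auto
      have "f * i - i * f \<in> F.FI k" by (rule F.comm_spanI) (use iI in auto)
      moreover have "x * w \<in> gp (k + 2)" using A.mult_gpow_left[OF u(2) w] by simp
      moreover have "ad x w \<in> comm_span sA g (gp (k + 1))" by (rule A.comm_span_adI[OF u(2) w])
      ultimately show "br u (ten i w) \<in> closed_form" unfolding u br_ten_left
        by (intro V.subspace_add[OF subspace_closed_form] closed_form_intros(2)[OF 3(1)]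
            closed_form_intros(3)[of _ k]
            F.I_ideal_right iI)
    qed
  qed
qed

lemma gen_subset_closed_form: "L \<subseteq> closed_form"
proof
  have br0: "br 0 y = 0" for y using br_scale(1)[of 0 0 y] by simp
  fix x assume "x \<in> L"
  \<comment> \<open>The second conjunct carries the bracket case: by the Jacobi identity the
    elements whose bracket preserves \<open>closed_form\<close> are closed under brackets.\<close>
  then have "x \<in> closed_form \<and> (\<forall>z\<in>closed_form. br x z \<in> closed_form)"
  proof (induction rule: gen.induct)
    case zero
    then show ?case using V.subspace_0[OF subspace_closed_form] by (simp add: br0)
  next
    case (base x)
    then show ?case using br_closed_form V.span_superset unfolding closed_form_def by blast
  next
    case (add x y)
    then show ?case by (simp add: br_add V.subspace_add[OF subspace_closed_form])
  next
    case (smult x c)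
    then show ?case by (simp add: br_scale V.subspace_scale[OF subspace_closed_form])
  next
    case (bracket x y)
    then show ?case by (simp add: jacobi V.subspace_diff[OF subspace_closed_form])
  qed
  then show "x \<in> closed_form" by blast
qed

text \<open>
  Modulo \<open>L\<close>, \<open>i f \<otimes> [x, w]\<close> is \<open>[i, f] \<otimes> x w\<close>, which is invariant under rotation of the
  word \<open>x w\<close> by the hypothesis on \<open>FI n\<close>; the commutators \<open>[x, w]\<close> of the rotations of a word
  sum to zero.
\<close>

lemma rotation_step:
  assumes B: "\<And>j w. j \<in> F.FI n \<Longrightarrow> w \<in> gp (n + 2) \<Longrightarrow> ten j w \<in> L"
    and i: "i \<in> F.I (Suc n)" and u: "u \<in> comm_span sA g (gp (n + 2))"
  shows "ten i u \<in> L"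
proof -
  note sL = subspace_gen[of "dot UNIV g"]
  have genL: "ten f x \<in> L" if "x \<in> g" for f x
    by (rule gen.base) (use that in \<open>auto simp: dot_def intro: V.span_base\<close>)
  have key: "ten (j * f) u \<in> L" if j: "j \<in> F.FI n" and u: "u \<in> comm_span sA g (gp (n + 2))" for j f
      u
  proof -
    let ?N = "{u. ten (j * f) u \<in> L}"
    have sN: "A.subspace ?N" using sL unfolding A.subspace_def V.subspace_def by (auto simp: ten_0
        ten_add ten_scale)
    have fj: "f * j - j * f \<in> F.FI n" using F.FI_subset_same j by (intro F.comm_spanI) auto
    have step: "ten (j * f) (ad x w) + ten (f * j - j * f) (x * w) \<in> L" if "x \<in> g" "w \<in> gp (n + 2)"
        for x w
      using gen.bracket[OF genL[OF that(1), of f] B[OF j that(2)]] by (simp add: br_ten_left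
          add.commute)
    let ?d = "\<lambda>zs. prod_list zs - prod_list (rotate1 zs)"
    have d: "?d (x # ws) = ad x (prod_list ws)" for x ws by (simp add: ad_def)
    have dd: "?d zs - ?d (rotate1 zs) \<in> ?N" if zs: "set zs \<subseteq> g" "length zs = n + 3" for zs
    proof -
      obtain x ws where x: "zs = x # ws" using zs by (cases zs) auto
      obtain y vs where y: "rotate1 zs = y # vs" using zs x by (cases "rotate1 zs") auto
      have yv: "set (y # vs) \<subseteq> g" "length (y # vs) = n + 3" using zs y set_rotate1[of zs]
          length_rotate1[of zs] by simp_all
      have ws: "prod_list ws \<in> gp (n + 2)" "prod_list vs \<in> gp (n + 2)"
        using A.prod_list_in_gpow[of ws g] A.prod_list_in_gpow[of vs g] zs x yv by auto
      \<comment> \<open>A word of length \<open>n + 3\<close> and its rotation differ by an element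
        of \<open>g^(n+2)\<close>, so \<open>B\<close> applies with the coefficient
        \<open>[f, j]\<close> in \<open>FI n\<close>.\<close>
      have "x * prod_list ws - y * prod_list vs \<in> gp (n + 2)"
      proof -
        have "prod_list (rotate1 zs) - prod_list zs \<in> gp (n + 2)"
          using A.move_letter_to_end[OF g, of "[]" x ws "n + 2"] zs x by auto
        then have "- (prod_list (rotate1 zs) - prod_list zs) \<in> gp (n + 2)" by (rule
            A.subspace_neg[OF A.subspace_gpow])
        moreover have "prod_list (rotate1 zs) = y * prod_list vs" "prod_list zs = x * prod_list ws"
          unfolding y using x by simp_all
        ultimately show ?thesis by simp
      qed
      then have 3: "ten (f * j - j * f) (x * prod_list ws - y * prod_list vs) \<in> L" by (rule B[OF
          fj])
      have 1: "ten (j * f) (ad x (prod_list ws)) + ten (f * j - j * f) (x * prod_list ws) \<in> L"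
        by (rule step) (use zs x ws in auto)
      have 2: "ten (j * f) (ad y (prod_list vs)) + ten (f * j - j * f) (y * prod_list vs) \<in> L"
        by (rule step) (use yv ws in auto)
      have "ten (j * f) (ad x (prod_list ws) - ad y (prod_list vs)) \<in> L"
        using V.subspace_diff[OF sL V.subspace_diff[OF sL 1 2] 3] by (simp add: ten_diff(2))
      moreover have e1: "?d zs = ad x (prod_list ws)" by (simp only: x d)
      moreover have e2: "?d (rotate1 zs) = ad y (prod_list vs)" by (simp only: y d)
      ultimately show ?thesis by (simp only: mem_Collect_eq)
    qed
    have adN: "ad x (prod_list ws) \<in> ?N" if xw: "x \<in> g" "set ws \<subseteq> g" "length ws = n + 2" for x ws
    proof -
      \<comment> \<open>The values of \<open>?d\<close> on the rotations agree modulo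
        \<open>?N\<close> and telescope to 0 over a full turn; hence \<open>n + 3\<close> times each
        of them lies in \<open>?N\<close>.\<close>
      define z where "z j = (rotate1 ^^ j) (x # ws)" for j
      have z: "set (z j) \<subseteq> g" "length (z j) = n + 3" for j
        by (induction j) (use xw in \<open>simp_all add: z_def\<close>)
      have zS: "z (Suc j) = rotate1 (z j)" for j by (simp add: z_def)
      have dz: "?d (z 0) - ?d (z j) \<in> ?N" for j
      proof (induction j)
        case 0
        then show ?case using A.subspace_0[OF sN] by simp
      next
        case (Suc j)
        have tr: "?d (z 0) - ?d (z (Suc j)) = (?d (z 0) - ?d (z j)) + (?d (z j) - ?d (z (Suc j)))"
            by simp
        have "?d (z j) - ?d (z (Suc j)) \<in> ?N" using dd[OF z] unfolding zS .
        then show ?case unfolding tr by (rule A.subspace_add[OF sN Suc])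
      qed
      have "(\<Sum>j<n + 3. ?d (z 0) - ?d (z j)) \<in> ?N" by (rule A.subspace_sum[OF sN]) (rule dz)
      moreover have "(\<Sum>j<n + 3. ?d (z j)) = 0"
      proof -
        have "(\<Sum>j<m. ?d (z j)) = prod_list (z 0) - prod_list (z m)" for m
          by (induction m) (simp_all add: zS)
        moreover have "z (n + 3) = x # ws" unfolding z_def rotate_def[symmetric]
          by (rule rotate_id) (use xw(3) in \<open>simp add: add.commute[of n]\<close>)
        then have "z (n + 3) = z 0" by (simp add: z_def)
        ultimately show ?thesis by simp
      qed
      moreover have "(\<Sum>j<n + 3. ?d (z 0)) = sA (of_nat (n + 3)) (?d (z 0))"
        using A.scale_sum_left[of "\<lambda>_. 1" "{..<n + 3}" "?d (z 0)"] by simp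
      ultimately have "sA (of_nat (n + 3)) (?d (z 0)) \<in> ?N" by (simp only: sum_subtractf diff_zero)
      from A.subspace_scale[OF sN this, of "inverse (of_nat (n + 3))"] have "?d (z 0) \<in> ?N"
        unfolding A.scale_scale by (simp del: of_nat_add of_nat_numeral)
      then show ?thesis using d[of x ws] by (simp add: z_def)
    qed
    have "comm_span sA g (gp (n + 2)) \<subseteq> ?N"
    proof (rule A.comm_span_ad_subset[OF _ sN])
      fix x w assume x: "x \<in> g" and w: "w \<in> gp (n + 2)"
      have "x * w - w * x \<in> ?N"
        by (rule A.commutator_left_span[OF _ sN w[unfolded gpow_def]]) (use adN[OF x] in \<open>auto simp:
            ad_def\<close>)
      then show "ad x w \<in> ?N" by (simp add: ad_def)
    qed
    then show ?thesis using u by blast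
  qed
  \<comment> \<open>For the summand \<open>FI n\<close> hypothesis \<open>B\<close> suffices, since
    \<open>[g, g^(n+2)]\<close> lies in \<open>g^(n+2)\<close>; the right multiples are the case
    \<open>key\<close>.\<close>
  have "i \<in> F.span (F.FI n \<union> {x * f |x f. x \<in> F.FI n})"
    using i F.I_ideal_Suc_subset unfolding F.FI_ideal_def by blast
  then show ?thesis
  proof (rule ten_span_left[OF _ sL, rotated])
    fix j assume "j \<in> F.FI n \<union> {x * f |x f. x \<in> F.FI n}"
    then show "ten j u \<in> L" using key[OF _ u] B A.comm_span_gpow_subset[OF g] u by blast
  qed
qed

lemma closed_form_subset_gen:
  assumes perf: "perfect_pair sA g"
  shows "closed_form \<subseteq> L"
proof -
  note sL = subspace_gen[of "dot UNIV g"]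
  have genL: "ten f x \<in> L" if "x \<in> g" for f x
    by (rule gen.base) (use that in \<open>auto simp: dot_def intro: V.span_base\<close>)
  \<comment> \<open>In the induction, \<open>rotation_step\<close> passes from this claim for
    \<open>n\<close> to \<open>I (Suc n)\<close> with \<open>[g, g^(n+2)]\<close>, and perfectness
    passes from there to this claim for \<open>Suc n\<close>.\<close>
  have B: "ten j w \<in> L" if "j \<in> F.FI n" "w \<in> gp (n + 2)" for n j w
    using that
  proof (induction n arbitrary: j w)
    case 0
    have "ten j w \<in> L" if w: "w \<in> {prod_list xs |xs. length xs = 2 \<and> set xs \<subseteq> g}" for w
    proof -
      from w obtain xs where xs: "w = prod_list xs" "length xs = 2" "set xs \<subseteq> g" by blast
      then obtain x y where xy: "xs = [x, y]" by (auto simp: length_Suc_conv numeral_2_eq_2)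
      have "j \<in> F.span {a * b - b * a |a b. a \<in> UNIV \<and> b \<in> F.I 0}" using 0(1) by (simp add:
          comm_span_def)
      then show ?thesis
      proof (rule ten_span_left[OF _ sL, rotated])
        fix j assume "j \<in> {a * b - b * a |a b. a \<in> UNIV \<and> b \<in> F.I 0}"
        then obtain a b where ab: "j = a * b - b * a" by blast
        have "ten (a * b - b * a) (x * y) + ten (b * a) (ad x y) \<in> L"
          unfolding br_ten_left[symmetric] by (rule gen.bracket[OF genL genL]) (use xs xy in auto)
        moreover have "ten (b * a) (ad x y) \<in> L" using g xs xy by (intro genL) (auto simp:
            A.lie_subalgebra_def)
        ultimately have "ten (a * b - b * a) (x * y) + ten (b * a) (ad x y) - ten (b * a) (ad x y) \<in>
            L"
          by (rule V.subspace_diff[OF sL])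
        then show "ten j w \<in> L" using ab xs xy by simp
      qed
    qed
    then show ?case by (rule ten_span_right[OF _ sL]) (use 0(2) in \<open>simp_all add: gpow_def
        numeral_2_eq_2\<close>)
  next
    case (Suc n)
    have An: "ten i u \<in> L" if "i \<in> F.I (Suc n)" "u \<in> comm_span sA g (gp (n + 2))" for i u
      using rotation_step[OF Suc.IH that] .
    have w: "w \<in> A.span (prod_span sA (comm_span sA g (gp (n + 2))) g \<union> (gp (n + 2) \<inter> gp (n + 3)))"
      using perf Suc.prems(2) unfolding perfect_pair_def by (auto simp: eval_nat_numeral)
    \<comment> \<open>With this the induction hypothesis settles the summand
      \<open>gp (n + 2) \<inter> gp (n + 3)\<close>.\<close>
    have jI: "j \<in> F.FI n" using Suc.prems(1) F.comm_span_mono[OF order_refl F.I_ideal_decreasing] by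
        blast
    show ?case
    proof (rule ten_span_right[OF _ sL w])
      fix w assume "w \<in> prod_span sA (comm_span sA g (gp (n + 2))) g \<union> (gp (n + 2) \<inter> gp (n + 3))"
      then show "ten j w \<in> L"
      proof
        assume "w \<in> gp (n + 2) \<inter> gp (n + 3)"
        then show ?thesis using Suc.IH[OF jI] by blast
      next
        assume "w \<in> prod_span sA (comm_span sA g (gp (n + 2))) g"
        then show ?thesis unfolding prod_span_def
        proof (rule ten_span_right[OF _ sL, rotated])
          fix w assume "w \<in> {x * y |x y. x \<in> comm_span sA g (gp (n + 2)) \<and> y \<in> g}"
          then obtain u x where ux: "w = u * x" "u \<in> comm_span sA g (gp (n + 2))" "x \<in> g" by blast
          have ug: "u \<in> gp (n + 2)" using ux(2) A.comm_span_gpow_subset[OF g] by blast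
          have "j \<in> F.span {a * b - b * a |a b. a \<in> UNIV \<and> b \<in> F.I (Suc n)}"
            using Suc.prems(1) by (simp add: comm_span_def)
          then show "ten j w \<in> L"
          proof (rule ten_span_left[OF _ sL, rotated])
            fix j assume "j \<in> {a * b - b * a |a b. a \<in> UNIV \<and> b \<in> F.I (Suc n)}"
            then obtain f i where fi: "j = f * i - i * f" "i \<in> F.I (Suc n)" by blast
            \<comment> \<open>The bracket of \<open>f \<otimes> x\<close> with
              \<open>i \<otimes> u\<close> is the wanted \<open>[f, i] \<otimes> u x\<close> plus a
              term that \<open>An\<close> already places in \<open>L\<close>.\<close>
            have "ten (f * i) (ad x u) + ten (f * i - i * f) (u * x) \<in> L"
              unfolding br_ten_right[symmetric] by (rule gen.bracket[OF genL[OF ux(3)] An[OF fi(2)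
                  ux(2)]])
            moreover have "ten (f * i) (ad x u) \<in> L"
              by (rule An[OF F.I_ideal_left[OF fi(2)] A.comm_span_adI[OF ux(3) ug]])
            ultimately have "ten (f * i) (ad x u) + ten (f * i - i * f) (u * x) - ten (f * i) (ad x
                u) \<in> L"
              by (rule V.subspace_diff[OF sL])
            then show "ten j w \<in> L" using fi ux by simp
          qed
        qed
      qed
    qed
  qed
  have A: "ten i u \<in> L" if "i \<in> F.I (Suc n)" "u \<in> comm_span sA g (gp (n + 2))" for n i u
    by (rule rotation_step[OF B that])
  show ?thesis unfolding closed_form_def
  proof (intro V.span_minimal[OF _ sL] Un_least UN_least)
    show "dot UNIV g \<subseteq> L" by (auto intro: gen.base)
    fix k :: nat assume "k \<in> {1..}"
    then obtain n where k: "k = Suc n" by (cases k) auto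
    show "dot (F.I k) (comm_span sA g (gp (k + 1))) \<subseteq> L"
      by (rule dot_subset[OF _ sL]) (use A[of _ n] k in simp)
    show "dot (F.FI (k - 1)) (gp (k + 1)) \<subseteq> L"
      by (rule dot_subset[OF _ sL]) (use B[of _ n] k in simp)
  qed
qed

theorem gen_eq_closed_form: "perfect_pair sA g \<Longrightarrow> L = closed_form"
  using gen_subset_closed_form closed_form_subset_gen by blast

end

end

section \<open>Transfer to the tensor product\<close>

context tensor_bracket
begin

definition semisimple_form :: "'a set \<Rightarrow> 'v set" where
  "semisimple_form g = V.span (dot UNIV g \<union> (\<Union>k\<in>{2..}.
     dot (F.I (k - 1)) (comm_span sA g (gpow sA g k)) \<union> dot (F.FI (k - 2)) (Z_k sA g k)))"

text \<open>In the decomposition \<open>w = a + b\<close> the part \<open>a\<close> contributes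
  nothing new: its coefficients in \<open>FI (k - 1)\<close> lie in \<open>I k\<close>, and
  \<open>I k \<cdot> [g, g^(k+1)]\<close> occurs in both forms. Only the central part
  \<open>b\<close> remains.\<close>

lemma closed_form_eq_semisimple_form:
  assumes g: "A.lie_subalgebra g" and dec: "\<And>k w. k \<ge> 2 \<Longrightarrow> w \<in> gpow sA g k \<Longrightarrow> \<exists>a\<in>comm_span sA g (gpow
      sA g k). \<exists>b\<in>Z_k sA g k. w = a + b"
  shows "closed_form g = semisimple_form g"
proof
  have up: "dot UNIV g \<subseteq> semisimple_form g"
    "\<And>k. dot (F.I (Suc k)) (comm_span sA g (gpow sA g (Suc (Suc k)))) \<subseteq> semisimple_form g"
    "\<And>k. dot (F.FI k) (Z_k sA g (Suc (Suc k))) \<subseteq> semisimple_form g"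
  proof -
    let ?X = "dot UNIV g \<union> (\<Union>k\<in>{2..}. dot (F.I (k - 1)) (comm_span sA g (gpow sA g k)) \<union> dot (F.FI
        (k - 2)) (Z_k sA g k))"
    have X: "?X \<subseteq> semisimple_form g" unfolding semisimple_form_def by (rule V.span_superset)
    show "dot UNIV g \<subseteq> semisimple_form g" using X by blast
    fix k :: nat
    have "dot (F.I (Suc (Suc k) - 1)) (comm_span sA g (gpow sA g (Suc (Suc k)))) \<union> dot (F.FI (Suc
        (Suc k) - 2)) (Z_k sA g (Suc (Suc k))) \<subseteq> ?X"
      by (rule le_supI2, rule UN_upper) simp
    from order_trans[OF this X]
    show "dot (F.I (Suc k)) (comm_span sA g (gpow sA g (Suc (Suc k)))) \<subseteq> semisimple_form g"
      "dot (F.FI k) (Z_k sA g (Suc (Suc k))) \<subseteq> semisimple_form g" by simp_all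
  qed
  have sub: "V.subspace (semisimple_form g)" by (simp add: semisimple_form_def)
  have dotI: "x \<in> S \<Longrightarrow> y \<in> T \<Longrightarrow> ten x y \<in> dot S T" for x y S T
    unfolding dot_def by (rule V.span_base) auto
  show "closed_form g \<subseteq> semisimple_form g" unfolding closed_form_def[OF g]
  proof (intro V.span_minimal[OF _ sub] Un_least UN_least)
    show "dot UNIV g \<subseteq> semisimple_form g" by (rule up)
    fix k :: nat assume "k \<in> {1..}"
    then obtain n where k: "k = Suc n" by (cases k) auto
    show "dot (F.I k) (comm_span sA g (gpow sA g (k + 1))) \<subseteq> semisimple_form g" using up(2)[of n] k
        by simp
    show "dot (F.FI (k - 1)) (gpow sA g (k + 1)) \<subseteq> semisimple_form g"
    proof (rule dot_subset[OF _ sub])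
      fix i w assume i: "i \<in> F.FI (k - 1)" and w: "w \<in> gpow sA g (k + 1)"
      obtain a b where ab: "a \<in> comm_span sA g (gpow sA g (k + 1))" "b \<in> Z_k sA g (k + 1)" "w = a +
          b"
        using dec[OF _ w] k by auto
      have "i \<in> F.I k" using i F.FI_subset[of n] k by auto
      then have "ten i a \<in> semisimple_form g" using dotI[OF _ ab(1), of i "F.I k"] up(2)[of n] k by
          auto
      moreover have "ten i b \<in> semisimple_form g" using dotI[OF i ab(2)] up(3)[of n] k by auto
      ultimately show "ten i w \<in> semisimple_form g" unfolding ab(3) ten_add by (rule
          V.subspace_add[OF sub])
    qed
  qed
  have up': "dot UNIV g \<subseteq> closed_form g"
    "\<And>k. dot (F.I (Suc k)) (comm_span sA g (gpow sA g (Suc (Suc k)))) \<subseteq> closed_form g"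
    "\<And>k. dot (F.FI k) (gpow sA g (Suc (Suc k))) \<subseteq> closed_form g"
  proof -
    let ?X = "dot UNIV g \<union> (\<Union>k\<in>{1..}. dot (F.I k) (comm_span sA g (gpow sA g (k + 1))) \<union> dot (F.FI
        (k - 1)) (gpow sA g (k + 1)))"
    have X: "?X \<subseteq> closed_form g" unfolding closed_form_def[OF g] by (rule V.span_superset)
    show "dot UNIV g \<subseteq> closed_form g" using X by blast
    fix k :: nat
    have "dot (F.I (Suc k)) (comm_span sA g (gpow sA g (Suc k + 1))) \<union> dot (F.FI (Suc k - 1)) (gpow
        sA g (Suc k + 1)) \<subseteq> ?X"
      by (rule le_supI2, rule UN_upper) simp
    from order_trans[OF this X]
    show "dot (F.I (Suc k)) (comm_span sA g (gpow sA g (Suc (Suc k)))) \<subseteq> closed_form g"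
      "dot (F.FI k) (gpow sA g (Suc (Suc k))) \<subseteq> closed_form g" by simp_all
  qed
  have sub': "V.subspace (closed_form g)" by (simp add: closed_form_def[OF g])
  show "semisimple_form g \<subseteq> closed_form g" unfolding semisimple_form_def
  proof (intro V.span_minimal[OF _ sub'] Un_least UN_least)
    show "dot UNIV g \<subseteq> closed_form g" by (rule up')
    fix k :: nat assume "k \<in> {2..}"
    then obtain n where k: "k = Suc (Suc n)" using Suc_le_D by (auto simp: numeral_2_eq_2) (metis
        Suc_le_D Suc_le_mono)
    show "dot (F.I (k - 1)) (comm_span sA g (gpow sA g k)) \<subseteq> closed_form g" using up'(2)[of n] k by
        simp
    have "dot (F.FI (k - 2)) (Z_k sA g k) \<subseteq> dot (F.FI n) (gpow sA g k)"
      unfolding dot_def k by (rule V.span_mono) (auto simp: Z_k_def)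
    then show "dot (F.FI (k - 2)) (Z_k sA g k) \<subseteq> closed_form g" using up'(3)[of n] k by auto
  qed
qed

end

section \<open>The powers of \<open>g\<close> as modules and their invariants\<close>

context char_0_unital_k_algebra
begin

lemma fin_dim_gpow:
  assumes "fin_dim g"
  shows "fin_dim (gpow scale g k)"
proof -
  obtain B where B: "finite B" "g \<subseteq> span B" using assms unfolding fin_dim_def by blast
  let ?S = "{prod_list ys |ys. length ys = k \<and> set ys \<subseteq> B}"
  have "?S = prod_list ` {ys. set ys \<subseteq> B \<and> length ys = k}" by auto
  then have "finite ?S" using finite_lists_length_eq[OF B(1), of k] by simp
  moreover have "gpow scale g k \<subseteq> span ?S"
  proof (rule gpow_induct[OF _ subspace_span])
    fix xs assume "length xs = k" "set xs \<subseteq> g"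
    then show "prod_list xs \<in> span ?S" using prod_list_span[of xs B] B(2) by auto
  qed
  ultimately show ?thesis unfolding fin_dim_def by blast
qed

text \<open>An element commuting with \<open>g\<close> commutes with every word in \<open>g\<close>.
  The bound \<open>1 \<le> k\<close> places \<open>b\<close> in \<open>gen_alg\<close>, whose sum
  starts at exponent 1.\<close>

lemma invariant_in_Z_k:
  assumes "1 \<le> k" "b \<in> gpow scale g k" "\<And>x. x \<in> g \<Longrightarrow> ad x b = 0"
  shows "b \<in> Z_k scale g k"
proof -
  have "b \<in> (\<Union>k\<in>{1..}. gpow scale g k)" using assms(1,2) by blast
  then have bg: "b \<in> gen_alg scale g" unfolding gen_alg_def by (rule span_base)
  have sub: "subspace {y. b * y = y * b}"
    unfolding subspace_def by (auto simp: distrib_left distrib_right scale_mult_left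
        scale_mult_right)
  have "prod_list xs \<in> {y. b * y = y * b}" if "set xs \<subseteq> g" for xs
    using that
  proof (induction xs)
    case (Cons x xs)
    then have "b * x = x * b" using assms(3)[of x] by (simp add: ad_def)
    then show ?case using Cons by simp (metis mult.assoc)
  qed simp
  then have "gpow scale g j \<subseteq> {y. b * y = y * b}" for j by (intro gpow_induct[OF _ sub]) auto
  then have "gen_alg scale g \<subseteq> {y. b * y = y * b}" unfolding gen_alg_def
    by (intro span_minimal[OF _ sub]) blast
  then show ?thesis using bg assms(2) unfolding Z_k_def center_of_def by auto
qed

lemma gpow_semisimple_decomposition:
  assumes g: "lie_subalgebra g" and fd: "fin_dim g"
    and ss: "\<And>h. lie_ideal scale g h \<Longrightarrow> solvable_lie scale h \<Longrightarrow> h = {0}"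
    and k: "1 \<le> k" and w: "w \<in> gpow scale g k"
  shows "\<exists>a\<in>comm_span scale g (gpow scale g k). \<exists>b\<in>Z_k scale g k. w = a + b"
proof -
  have "ad_module g (gpow scale g k)"
    unfolding ad_module_def using subspace_gpow fin_dim_gpow[OF fd] ad_gpow[OF g] by blast
  from module_eq_brackets_plus_invariants[OF g fd ss this w] obtain a b where
    "a \<in> comm_span scale g (gpow scale g k)" "b \<in> gpow scale g k" "\<forall>x\<in>g. ad x b = 0" "w = a + b" by
        blast
  then show ?thesis using invariant_in_Z_k[OF k] by blast
qed

end

section \<open>Multiplication on the free vector space and on its quotient\<close>

abbreviation mon :: "'b \<Rightarrow> 'd \<Rightarrow> ('b \<times> 'd \<Rightarrow>\<^sub>0 'k::field)" where
  "mon x y \<equiv> Poly_Mapping.single (x, y) 1"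

lemma free_induct [case_names zero step]:
  fixes p :: "('b \<times> 'd \<Rightarrow>\<^sub>0 'k::field)"
  assumes "P 0" "\<And>x y c p. P p \<Longrightarrow> P (free_scale c (mon x y) + p)"
  shows "P p"
proof -
  have "p = (\<Sum>z\<in>Poly_Mapping.keys p. free_scale (Poly_Mapping.lookup p z) (Poly_Mapping.single z
      1))"
  proof (rule poly_mapping_eqI)
    fix k
    have "Poly_Mapping.lookup (\<Sum>z\<in>Poly_Mapping.keys p. free_scale (Poly_Mapping.lookup p z)
        (Poly_Mapping.single z 1)) k =
      (\<Sum>z\<in>Poly_Mapping.keys p. if z = k then Poly_Mapping.lookup p z else 0)"
      unfolding lookup_sum by (rule sum.cong) (auto simp: lookup_free_scale lookup_single when_def)
    also have "\<dots> = Poly_Mapping.lookup p k" by (simp add: in_keys_iff)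
    finally show "Poly_Mapping.lookup p k = Poly_Mapping.lookup
      (\<Sum>z\<in>Poly_Mapping.keys p. free_scale (Poly_Mapping.lookup p z) (Poly_Mapping.single z 1)) k" by
          simp
  qed
  moreover have "P (\<Sum>z\<in>A. free_scale (c z) (Poly_Mapping.single z 1))" if "finite A" for c :: "'b \<times>
      'd \<Rightarrow> 'k" and A
    using that
  proof (induction A rule: finite_induct)
    case (insert z A)
    then show ?case using assms(2)[of _ "c z" "fst z" "snd z"] by simp
  qed (simp add: assms(1))
  ultimately show ?thesis by (metis finite_keys)
qed

definition ten_mult :: "('f::ring \<times> 'a::ring \<Rightarrow>\<^sub>0 'k::field) \<Rightarrow> ('f \<times> 'a \<Rightarrow>\<^sub>0 'k) \<Rightarrow> ('f \<times> 'a \<Rightarrow>\<^sub>0 'k)"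
    where
  "ten_mult = free_bilin (*) (*)"

lemma ten_mult_eq:
  assumes "finite S" "Poly_Mapping.keys p \<subseteq> S" "finite S'" "Poly_Mapping.keys q \<subseteq> S'"
  shows "ten_mult p q = (\<Sum>z\<in>S. \<Sum>w\<in>S'. Poly_Mapping.single (fst z * fst w, snd z * snd w)
    (Poly_Mapping.lookup p z * Poly_Mapping.lookup q w))"
proof -
  have "ten_mult p q = (\<Sum>z\<in>Poly_Mapping.keys p. \<Sum>w\<in>Poly_Mapping.keys q.
      Poly_Mapping.single (fst z * fst w, snd z * snd w) (Poly_Mapping.lookup p z *
          Poly_Mapping.lookup q w))"
    by (simp add: ten_mult_def free_bilin_def split_def)
  also have "\<dots> = (\<Sum>z\<in>Poly_Mapping.keys p. \<Sum>w\<in>S'.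
      Poly_Mapping.single (fst z * fst w, snd z * snd w) (Poly_Mapping.lookup p z *
          Poly_Mapping.lookup q w))"
    by (rule sum.cong[OF refl], rule sum.mono_neutral_left) (use assms in \<open>auto simp: in_keys_iff\<close>)
  also have "\<dots> = (\<Sum>z\<in>S. \<Sum>w\<in>S'.
      Poly_Mapping.single (fst z * fst w, snd z * snd w) (Poly_Mapping.lookup p z *
          Poly_Mapping.lookup q w))"
    by (rule sum.mono_neutral_left) (use assms in \<open>auto simp: in_keys_iff\<close>)
  finally show ?thesis .
qed

lemma ten_mult_bilinear:
  "ten_mult (p + p') q = ten_mult p q + ten_mult p' q" "ten_mult q (p + p') = ten_mult q p +
      ten_mult q p'"
  "ten_mult (free_scale c p) q = free_scale c (ten_mult p q)"
  "ten_mult q (free_scale c p) = free_scale c (ten_mult q p)"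
proof -
  let ?S = "Poly_Mapping.keys p \<union> Poly_Mapping.keys p'"
  have fin: "finite ?S" "finite (Poly_Mapping.keys q)" "finite (Poly_Mapping.keys p)" by simp_all
  have keys: "Poly_Mapping.keys (p + p') \<subseteq> ?S" by (rule Poly_Mapping.keys_add)
  have keys': "Poly_Mapping.keys (free_scale c p) \<subseteq> Poly_Mapping.keys p" by (auto simp: in_keys_iff
      lookup_free_scale)
  have sc: "Poly_Mapping.single z (c * a) = free_scale c (Poly_Mapping.single z a)" for z :: "'a \<times>
      'b" and a
    by (rule poly_mapping_eqI) (simp add: lookup_free_scale lookup_single when_def)
  note eq = ten_mult_eq[OF fin(1) _ fin(2) order_refl] ten_mult_eq[OF fin(2) order_refl fin(1)]
  note eq' = ten_mult_eq[OF fin(3) _ fin(2) order_refl] ten_mult_eq[OF fin(2) order_refl fin(3)]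
  show "ten_mult (p + p') q = ten_mult p q + ten_mult p' q"
    by (simp add: eq(1) keys lookup_add distrib_right single_add sum.distrib)
  show "ten_mult q (p + p') = ten_mult q p + ten_mult q p'"
    by (simp add: eq(2) keys lookup_add distrib_left single_add sum.distrib)
  show "ten_mult (free_scale c p) q = free_scale c (ten_mult p q)"
    unfolding eq'(1)[OF keys'] eq'(1)[OF order_refl] lookup_free_scale mult.assoc sc
        free_vs.scale_sum_right ..
  show "ten_mult q (free_scale c p) = free_scale c (ten_mult q p)"
    unfolding eq'(2)[OF keys'] eq'(2)[OF order_refl] lookup_free_scale mult.left_commute[of _ c] sc
      free_vs.scale_sum_right ..
qed

lemma ten_mult_mon: "ten_mult (mon x y) (mon x' y') = mon (x * x') (y * y')"
  by (subst ten_mult_eq[of "{(x, y)}" _ "{(x', y')}"]) simp_all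

lemma ten_mult_0: "ten_mult 0 q = 0" "ten_mult q 0 = 0"
  by (simp_all add: ten_mult_def free_bilin_def)

lemma ten_mult_diff:
  "ten_mult (p - p') q = ten_mult p q - ten_mult p' q" "ten_mult q (p - p') = ten_mult q p -
      ten_mult q p'"
  using ten_mult_bilinear(1)[of "p - p'" p' q] ten_mult_bilinear(2)[of q "p - p'" p'] by simp_all

lemma ten_mult_assoc: "ten_mult (ten_mult p q) r = ten_mult p (ten_mult q r)"
proof (induction p rule: free_induct)
  case (step x y c p)
  have "ten_mult (ten_mult (mon x y) q) r = ten_mult (mon x y) (ten_mult q r)"
  proof (induction q rule: free_induct)
    case (step x' y' c q)
    have "ten_mult (ten_mult (mon x y) (mon x' y')) r = ten_mult (mon x y) (ten_mult (mon x' y') r)"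
    proof (induction r rule: free_induct)
      case (step x'' y'' c r)
      then show ?case by (simp add: ten_mult_bilinear ten_mult_mon mult.assoc)
    qed (simp add: ten_mult_0)
    then show ?case using step by (simp add: ten_mult_bilinear)
  qed (simp add: ten_mult_0)
  then show ?case using step by (simp add: ten_mult_bilinear)
qed (simp add: ten_mult_0)

text \<open>A basis of \<open>R\<close> is extended to a basis of the whole space, and the basis of
  \<open>R\<close> is sent to 0. Then \<open>\<pi> p\<close> is a linearly chosen representative of
  the coset of \<open>p\<close>.\<close>

lemma projection_along_subspace:
  fixes R :: "('c \<Rightarrow>\<^sub>0 'k::field) set"
  assumes R: "free_vs.subspace R"
  obtains \<pi> :: "('c \<Rightarrow>\<^sub>0 'k) \<Rightarrow> ('c \<Rightarrow>\<^sub>0 'k)" where "\<And>p q. \<pi> (p + q) = \<pi> p + \<pi> q"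
    "\<And>c p. \<pi> (free_scale c p) = free_scale c (\<pi> p)" "\<And>r. r \<in> R \<Longrightarrow> \<pi> r = 0" "\<And>p. \<pi> p - p \<in> R"
proof -
  interpret P: vector_space_pair "free_scale :: 'k \<Rightarrow> ('c \<Rightarrow>\<^sub>0 'k) \<Rightarrow> _" "free_scale :: 'k \<Rightarrow> ('c \<Rightarrow>\<^sub>0
      'k) \<Rightarrow> _" ..
  obtain B where B: "B \<subseteq> R" "free_vs.independent B" "R \<subseteq> free_vs.span B"
    using free_vs.maximal_independent_subset by blast
  obtain C where C: "B \<subseteq> C" "free_vs.independent C" "UNIV \<subseteq> free_vs.span C"
    using free_vs.maximal_independent_subset_extend[OF subset_UNIV B(2)] by metis
  obtain \<pi> where \<pi>: "Vector_Spaces.linear free_scale free_scale \<pi>" "\<forall>b\<in>C. \<pi> b = (if b \<in> B then 0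
      else b)"
    using P.linear_independent_extend[OF C(2), of "\<lambda>b. if b \<in> B then 0 else b"] by blast
  note lin = P.linear_add[OF \<pi>(1)] P.linear_scale[OF \<pi>(1)] P.linear_0[OF \<pi>(1)]
  have 0: "\<pi> r = 0" if "r \<in> R" for r
  proof -
    have "r \<in> free_vs.span B" using that B(3) by blast
    then show ?thesis
    proof (induction rule: free_vs.span_induct_alt)
      case (step c x y)
      then have "\<pi> x = 0" using \<pi>(2) C(1) by auto
      then show ?case using step by (simp add: lin)
    qed (simp add: lin)
  qed
  have 1: "\<pi> p - p \<in> R" for p
  proof -
    have "p \<in> free_vs.span C" using C(3) by blast
    then show ?thesis
    proof (induction rule: free_vs.span_induct_alt)
      case base
      then show ?case using free_vs.subspace_0[OF R] by (simp add: lin)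
    next
      case (step c x y)
      have "\<pi> x - x \<in> R" using \<pi>(2) step(1) B(1) free_vs.subspace_0[OF R] free_vs.subspace_neg[OF R]
          by auto
      then have "free_scale c (\<pi> x - x) + (\<pi> y - y) \<in> R"
        using step(2) by (intro free_vs.subspace_add[OF R] free_vs.subspace_scale[OF R])
      then show ?case by (simp add: lin free_vs.scale_right_diff_distrib algebra_simps)
    qed
  qed
  show ?thesis by (rule that[of \<pi>, OF lin(1,2) 0 1])
qed

lemma tensor_rel_intros:
  "mon (x + x') y - mon x y - mon x' y \<in> tensor_rel sF UNIV sA UNIV"
  "mon x (y + y') - mon x y - mon x y' \<in> tensor_rel sF UNIV sA UNIV"
  "mon (sF c x) y - free_scale c (mon x y) \<in> tensor_rel sF UNIV sA UNIV"
  "mon x (sA c y) - free_scale c (mon x y) \<in> tensor_rel sF UNIV sA UNIV"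
  unfolding tensor_rel_def by (rule free_vs.span_base, blast)+

text \<open>This makes the multiplication, and hence the commutator, well defined on cosets. By
  bilinearity it is checked on generators and monomials.\<close>

lemma tensor_rel_ideal:
  assumes F: "k_algebra sF" and A: "k_algebra sA" and r: "r \<in> tensor_rel sF UNIV sA UNIV"
  shows "ten_mult p r \<in> tensor_rel sF UNIV sA UNIV" "ten_mult r p \<in> tensor_rel sF UNIV sA UNIV"
proof -
  interpret F: k_algebra sF by fact
  interpret A: k_algebra sA by fact
  let ?R = "tensor_rel sF UNIV sA UNIV"
  have sR: "free_vs.subspace ?R" by (simp add: tensor_rel_def)
  let ?G = "{mon (x + x') y - mon x y - mon x' y |x x' y. x \<in> UNIV \<and> x' \<in> UNIV \<and> y \<in> UNIV} \<union>
     {mon x (y + y') - mon x y - mon x y' |x y y'. x \<in> UNIV \<and> y \<in> UNIV \<and> y' \<in> UNIV} \<union>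
     {mon (sF c x) y - free_scale c (mon x y) |c x y. x \<in> UNIV \<and> y \<in> UNIV} \<union>
     {mon x (sA c y) - free_scale c (mon x y) |c x y. x \<in> UNIV \<and> y \<in> UNIV}"
  have gen: "ten_mult (mon a b) z \<in> ?R \<and> ten_mult z (mon a b) \<in> ?R" if "z \<in> ?G" for a b z
    using that
    by (elim UnE CollectE exE conjE; hypsubst)
      (simp_all only: ten_mult_diff ten_mult_mon ten_mult_bilinear distrib_left distrib_right
        F.scale_mult_left F.scale_mult_right A.scale_mult_left A.scale_mult_right tensor_rel_intros
            simp_thms)
  have mon: "ten_mult (mon a b) r \<in> ?R \<and> ten_mult r (mon a b) \<in> ?R" for a b
    using r unfolding tensor_rel_def
  proof (induction rule: free_vs.span_induct_alt)
    case base
    then show ?case by (simp add: ten_mult_0 free_vs.span_zero)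
  next
    case (step c x y)
    then show ?case using gen[OF step(1), of a b] unfolding tensor_rel_def
      by (simp add: ten_mult_bilinear free_vs.span_add free_vs.span_scale)
  qed
  have "ten_mult p r \<in> ?R \<and> ten_mult r p \<in> ?R"
  proof (induction p rule: free_induct)
    case zero
    then show ?case using free_vs.subspace_0[OF sR] by (simp add: ten_mult_0)
  next
    case (step x y c p)
    then show ?case using mon[of x y]
      by (simp add: ten_mult_bilinear free_vs.subspace_add[OF sR] free_vs.subspace_scale[OF sR])
  qed
  then show "ten_mult p r \<in> ?R" "ten_mult r p \<in> ?R" by blast+
qed

text \<open>
  The tensor product is a set of cosets whose operations depend on the scalar multiplications, so
  it is not a type. A linear projection \<open>\<pi>\<close> of the free vector space with the bilinearity
  relations as kernel transports its structure to the type of the free vector space.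
\<close>

locale tensor_cosets = F: k_algebra sF + A: char_0_unital_k_algebra sA
  for sF :: "'k::field_char_0 \<Rightarrow> 'f::ring \<Rightarrow> 'f" and sA :: "'k \<Rightarrow> 'a::{ring,monoid_mult} \<Rightarrow> 'a" +
  fixes \<pi> :: "('f \<times> 'a \<Rightarrow>\<^sub>0 'k) \<Rightarrow> ('f \<times> 'a \<Rightarrow>\<^sub>0 'k)"
  assumes pi_add: "\<pi> (p + q) = \<pi> p + \<pi> q"
    and pi_scale: "\<pi> (free_scale c p) = free_scale c (\<pi> p)"
    and pi_rel: "r \<in> tensor_rel sF UNIV sA UNIV \<Longrightarrow> \<pi> r = 0"
    and pi_diff_rel: "\<pi> p - p \<in> tensor_rel sF UNIV sA UNIV"
begin

abbreviation "Rel \<equiv> tensor_rel sF UNIV sA UNIV"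
abbreviation "TL \<equiv> tensor_lie sF sA"

definition com :: "('f \<times> 'a \<Rightarrow>\<^sub>0 'k) \<Rightarrow> ('f \<times> 'a \<Rightarrow>\<^sub>0 'k) \<Rightarrow> ('f \<times> 'a \<Rightarrow>\<^sub>0 'k)" where
  "com p q = ten_mult p q - ten_mult q p"

definition coset :: "('f \<times> 'a \<Rightarrow>\<^sub>0 'k) \<Rightarrow> ('f \<times> 'a \<Rightarrow>\<^sub>0 'k) set" where
  "coset p = (+) p ` Rel"

lemma subspace_R: "free_vs.subspace Rel"
  by (simp add: tensor_rel_def)

lemma pi_diff: "\<pi> (p - q) = \<pi> p - \<pi> q"
  using pi_add[of "p - q" q] by simp

lemma pi_eqI: "p - q \<in> Rel \<Longrightarrow> \<pi> p = \<pi> q"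
  using pi_rel[of "p - q"] by (simp add: pi_diff)

lemma com_rel: "r \<in> Rel \<Longrightarrow> com p r \<in> Rel" "r \<in> Rel \<Longrightarrow> com r p \<in> Rel"
  unfolding com_def
  by (intro free_vs.subspace_diff[OF subspace_R]
      tensor_rel_ideal[OF F.k_algebra_axioms A.k_algebra_axioms]; assumption)+

lemma com_bilinear:
  "com (p + p') q = com p q + com p' q" "com q (p + p') = com q p + com q p'"
  "com (free_scale c p) q = free_scale c (com p q)" "com q (free_scale c p) = free_scale c (com q
      p)"
  "com (p - p') q = com p q - com p' q" "com q (p - p') = com q p - com q p'"
  unfolding com_def ten_mult_bilinear ten_mult_diff free_vs.scale_right_diff_distrib by simp_all

lemma com_congruent: "p - p' \<in> Rel \<Longrightarrow> q - q' \<in> Rel \<Longrightarrow> com p q - com p' q' \<in> Rel"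
proof -
  assume "p - p' \<in> Rel" "q - q' \<in> Rel"
  then have "com (p - p') q + com p' (q - q') \<in> Rel"
    by (intro free_vs.subspace_add[OF subspace_R] com_rel)
  then show ?thesis by (simp add: com_bilinear)
qed

text \<open>Inner projections may be dropped under an outer one, which reduces the Jacobi identity
  for the projected bracket to associativity of \<open>ten_mult\<close>.\<close>

lemma pi_com: "\<pi> (com (\<pi> p) q) = \<pi> (com p q)" "\<pi> (com p (\<pi> q)) = \<pi> (com p q)"
proof -
  have 0: "x - x \<in> Rel" for x using free_vs.subspace_0[OF subspace_R] by simp
  show "\<pi> (com (\<pi> p) q) = \<pi> (com p q)" by (rule pi_eqI[OF com_congruent[OF pi_diff_rel 0]])
  show "\<pi> (com p (\<pi> q)) = \<pi> (com p q)" by (rule pi_eqI[OF com_congruent[OF 0 pi_diff_rel]])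
qed

sublocale tensor_bracket sF sA free_scale "\<lambda>f x. \<pi> (mon f x)" "\<lambda>p q. \<pi> (com p q)"
proof
  fix f f' :: 'f and x x' :: 'a and c :: 'k and u u' v v' w :: "'f \<times> 'a \<Rightarrow>\<^sub>0 'k"
  have "\<pi> (mon (f + f') x - mon f x - mon f' x) = 0" by (rule pi_rel[OF tensor_rel_intros(1)])
  then show "\<pi> (mon (f + f') x) = \<pi> (mon f x) + \<pi> (mon f' x)" unfolding pi_diff by (simp add:
      diff_diff_eq)
  have "\<pi> (mon f (x + x') - mon f x - mon f x') = 0" by (rule pi_rel[OF tensor_rel_intros(2)])
  then show "\<pi> (mon f (x + x')) = \<pi> (mon f x) + \<pi> (mon f x')" unfolding pi_diff by (simp add:
      diff_diff_eq)
  have "\<pi> (mon (sF c f) x - free_scale c (mon f x)) = 0" by (rule pi_rel[OF tensor_rel_intros(3)])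
  then show "\<pi> (mon (sF c f) x) = free_scale c (\<pi> (mon f x))" by (simp add: pi_diff pi_scale)
  have "\<pi> (mon f (sA c x) - free_scale c (mon f x)) = 0" by (rule pi_rel[OF tensor_rel_intros(4)])
  then show "\<pi> (mon f (sA c x)) = free_scale c (\<pi> (mon f x))" by (simp add: pi_diff pi_scale)
  show "\<pi> (com (u + u') v) = \<pi> (com u v) + \<pi> (com u' v)" "\<pi> (com u (v + v')) = \<pi> (com u v) + \<pi> (com
      u v')"
    "\<pi> (com (free_scale c u) v) = free_scale c (\<pi> (com u v))"
    "\<pi> (com u (free_scale c v)) = free_scale c (\<pi> (com u v))"
    by (simp_all only: com_bilinear pi_add pi_scale)
  show "\<pi> (com (\<pi> (mon f x)) (\<pi> (mon f' x'))) = \<pi> (mon (f * f') (x * x')) - \<pi> (mon (f' * f) (x' *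
      x))"
    unfolding pi_com unfolding com_def ten_mult_mon pi_diff ..
  show "\<pi> (com (\<pi> (com u v)) w) = \<pi> (com u (\<pi> (com v w))) - \<pi> (com v (\<pi> (com u w)))"
    unfolding pi_com pi_diff[symmetric]
    by (simp add: com_def ten_mult_diff ten_mult_assoc algebra_simps)
qed

lemma coset_eqI: "p - q \<in> Rel \<Longrightarrow> coset p = coset q"
proof -
  have sub: "coset p \<subseteq> coset q" if "p - q \<in> Rel" for p q
  proof
    fix u assume "u \<in> coset p"
    then obtain r where "r \<in> Rel" "u = p + r" unfolding coset_def by blast
    then have "(p - q) + r \<in> Rel" "u = q + ((p - q) + r)"
      using free_vs.subspace_add[OF subspace_R that] by simp_all
    then show "u \<in> coset q" unfolding coset_def by blast
  qed
  assume pq: "p - q \<in> Rel"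
  then have "q - p \<in> Rel" using free_vs.subspace_neg[OF subspace_R pq] by simp
  then show ?thesis using sub pq by blast
qed

lemma coset_mem: "u \<in> coset p \<Longrightarrow> u - p \<in> Rel"
  unfolding coset_def by auto

lemma self_in_coset: "p \<in> coset p"
  unfolding coset_def using free_vs.subspace_0[OF subspace_R] by (intro image_eqI[of _ _ 0]) auto

lemma coset_nonempty: "coset p \<noteq> {}"
  using self_in_coset by blast

text \<open>Each operation of \<open>quotient_lie\<close> is a union over representatives; all
  members of the union are the same coset, and the index sets are nonempty. The bracket is stated
  with \<open>\<pi>\<close> to match the bracket of the sublocale.\<close>

lemma tensor_lie_simps:
  "lzero TL = coset 0" "ladd TL (coset p) (coset q) = coset (p + q)"
  "lsmult TL c (coset p) = coset (free_scale c p)"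
  "lbracket TL (coset p) (coset q) = coset (\<pi> (com p q))"
proof -
  show "lzero TL = coset 0" by (simp add: tensor_lie_def quotient_lie_def coset_def)
  have "coset (u + v) = coset (p + q)" if "u \<in> coset p" "v \<in> coset q" for u v
    using free_vs.subspace_add[OF subspace_R coset_mem[OF that(1)] coset_mem[OF that(2)]]
    by (intro coset_eqI) (simp add: algebra_simps)
  then have "(\<Union>u\<in>coset p. \<Union>v\<in>coset q. coset (u + v)) = coset (p + q)"
    by (intro SUP_eq_const coset_nonempty)
  then show "ladd TL (coset p) (coset q) = coset (p + q)"
    by (simp add: tensor_lie_def quotient_lie_def coset_def)
  have "coset (free_scale c u) = coset (free_scale c p)" if "u \<in> coset p" for u
    using free_vs.subspace_scale[OF subspace_R coset_mem[OF that], of c]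
    by (intro coset_eqI) (simp add: free_vs.scale_right_diff_distrib)
  then have "(\<Union>u\<in>coset p. coset (free_scale c u)) = coset (free_scale c p)"
    by (intro SUP_eq_const coset_nonempty)
  then show "lsmult TL c (coset p) = coset (free_scale c p)"
    by (simp add: tensor_lie_def quotient_lie_def coset_def)
  have "coset (com u v) = coset (\<pi> (com p q))" if "u \<in> coset p" "v \<in> coset q" for u v
  proof -
    have "coset (com u v) = coset (com p q)"
      by (rule coset_eqI[OF com_congruent[OF coset_mem[OF that(1)] coset_mem[OF that(2)]]])
    also have "\<dots> = coset (\<pi> (com p q))" by (rule coset_eqI[OF pi_diff_rel, symmetric])
    finally show ?thesis .
  qed
  then have "(\<Union>u\<in>coset p. \<Union>v\<in>coset q. coset (com u v)) = coset (\<pi> (com p q))"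
    by (intro SUP_eq_const coset_nonempty)
  then show "lbracket TL (coset p) (coset q) = coset (\<pi> (com p q))"
    by (simp add: tensor_lie_def quotient_lie_def coset_def com_def ten_mult_def)
qed

lemma lie_span_coset: "lie_span TL (coset ` S) = coset ` free_vs.span S"
proof
  show "lie_span TL (coset ` S) \<subseteq> coset ` free_vs.span S"
  proof
    fix U assume "U \<in> lie_span TL (coset ` S)"
    then show "U \<in> coset ` free_vs.span S"
    proof (induction rule: lie_span.induct)
      case zero
      then show ?case using free_vs.span_zero by (auto simp: tensor_lie_simps)
    next
      case (base x)
      then show ?case using free_vs.span_base by auto
    next
      case (add x y)
      then show ?case by (auto simp: tensor_lie_simps free_vs.span_add)
    next
      case (smult x c)
      then show ?case by (auto simp: tensor_lie_simps free_vs.span_scale)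
    qed
  qed
  show "coset ` free_vs.span S \<subseteq> lie_span TL (coset ` S)"
  proof (rule image_subsetI)
    fix p assume "p \<in> free_vs.span S"
    then show "coset p \<in> lie_span TL (coset ` S)"
    proof (induction rule: free_vs.span_induct_alt)
      case base
      then show ?case using lie_span.zero[of TL "coset ` S"] by (simp add: tensor_lie_simps)
    next
      case (step c x y)
      then have "ladd TL (lsmult TL c (coset x)) (coset y) \<in> lie_span TL (coset ` S)"
        by (intro lie_span.add[OF lie_span.smult[OF lie_span.base]]) auto
      then show ?case by (simp add: tensor_lie_simps)
    qed
  qed
qed

lemma lie_generated_coset: "lie_generated TL (coset ` S) = coset ` gen S"
proof
  show "lie_generated TL (coset ` S) \<subseteq> coset ` gen S"
  proof
    fix U assume "U \<in> lie_generated TL (coset ` S)"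
    then show "U \<in> coset ` gen S"
    proof (induction rule: lie_generated.induct)
      case zero
      then show ?case using gen.zero by (auto simp: tensor_lie_simps)
    next
      case (base x)
      then show ?case using gen.base by auto
    next
      case (add x y)
      then show ?case by (auto simp: tensor_lie_simps gen.add)
    next
      case (smult x c)
      then show ?case by (auto simp: tensor_lie_simps gen.smult)
    next
      case (bracket x y)
      then show ?case by (auto simp: tensor_lie_simps gen.bracket)
    qed
  qed
  show "coset ` gen S \<subseteq> lie_generated TL (coset ` S)"
  proof (rule image_subsetI)
    fix p assume "p \<in> gen S"
    then show "coset p \<in> lie_generated TL (coset ` S)"
    proof (induction rule: gen.induct)
      case zero
      then show ?case using lie_generated.zero[of TL "coset ` S"] by (simp add: tensor_lie_simps)
    next
      case (base x)
      then show ?case by (intro lie_generated.base) simp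
    next
      case (add x y)
      then show ?case using lie_generated.add[of "coset x" TL "coset ` S" "coset y"] by (simp add:
          tensor_lie_simps)
    next
      case (smult x c)
      then show ?case using lie_generated.smult[of "coset x" TL "coset ` S" c] by (simp add:
          tensor_lie_simps)
    next
      case (bracket x y)
      then show ?case using lie_generated.bracket[of "coset x" TL "coset ` S" "coset y"] by (simp
          add: tensor_lie_simps)
    qed
  qed
qed

lemma tensor_dot_coset: "tensor_dot sF sA S T = coset ` dot S T"
proof -
  have "pure_tensor sF sA x y = coset (\<pi> (mon x y))" for x y
    using coset_eqI[OF pi_diff_rel[of "mon x y"]] by (simp add: pure_tensor_def coset_def)
  then have "{pure_tensor sF sA x y |x y. x \<in> S \<and> y \<in> T} = coset ` {\<pi> (mon x y) |x y. x \<in> S \<and> y \<in>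
      T}"
    by auto
  then show ?thesis unfolding tensor_dot_def dot_def by (simp only: lie_span_coset)
qed

lemma pair_lie_coset: "pair_lie sA g sF = coset ` gen (dot UNIV g)"
  unfolding pair_lie_def tensor_dot_coset lie_generated_coset ..

theorem pair_lie_eq_of_perfect:
  assumes g: "A.lie_subalgebra g" and "perfect_pair sA g"
  shows "pair_lie sA g sF = lie_span TL (tensor_dot sF sA UNIV g \<union>
    (\<Union>k\<in>{1..}. tensor_dot sF sA (I_ideal sF k) (comm_span sA g (gpow sA g (k + 1))) \<union>
      tensor_dot sF sA (comm_span sF UNIV (I_ideal sF (k - 1))) (gpow sA g (k + 1))))"
  unfolding pair_lie_coset gen_eq_closed_form[OF assms] closed_form_def[OF g]
  by (simp only: tensor_dot_coset image_Un[symmetric] image_UN[symmetric] lie_span_coset)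

theorem pair_lie_eq_of_semisimple:
  assumes g: "A.lie_subalgebra g" and ss: "semisimple_lie sA g"
  shows "pair_lie sA g sF = lie_span TL (tensor_dot sF sA UNIV g \<union>
    (\<Union>k\<in>{2..}. tensor_dot sF sA (I_ideal sF (k - 1)) (comm_span sA g (gpow sA g k)) \<union>
      tensor_dot sF sA (comm_span sF UNIV (I_ideal sF (k - 2))) (Z_k sA g k)))"
proof -
  have fd: "A.fin_dim g" using ss A.span_superset unfolding semisimple_lie_def A.fin_dim_def by
      blast
  have rad: "h = {0}" if "lie_ideal sA g h" "solvable_lie sA h" for h
    using ss that unfolding semisimple_lie_def by blast
  have "perfect_pair sA g"
    by (rule A.perfect_pair_if_perfect[OF g A.semisimple_perfect[OF g fd rad]])
  moreover have "closed_form g = semisimple_form g"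
    by (rule closed_form_eq_semisimple_form[OF g A.gpow_semisimple_decomposition[OF g fd rad]]) auto
  ultimately show ?thesis
    unfolding pair_lie_coset using gen_eq_closed_form[OF g]
    by (simp only: semisimple_form_def tensor_dot_coset image_Un[symmetric] image_UN[symmetric]
        lie_span_coset)
qed

end
theorem theorem4p3:
  fixes sA :: "'k::field_char_0 \<Rightarrow> 'a::{ring,monoid_mult} \<Rightarrow> 'a"
    and g :: "'a set"
  assumes "compatible_pair sA g"
  shows
    "(perfect_pair sA g \<longrightarrow>
       (\<forall>sF :: 'k \<Rightarrow> 'f::ring \<Rightarrow> 'f. k_algebra sF \<longrightarrow>
         pair_lie sA g sF =
           lie_span (tensor_lie sF sA)
             (tensor_dot sF sA UNIV g \<union>
              (\<Union>k\<in>{1..}.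
                 tensor_dot sF sA (I_ideal sF k) (comm_span sA g (gpow sA g (k + 1))) \<union>
                 tensor_dot sF sA (comm_span sF UNIV (I_ideal sF (k - 1))) (gpow sA g (k + 1))))))
     \<and> (strongly_graded (closure_lie sA g) \<longrightarrow> perfect_pair sA g)
     \<and> (semisimple_lie sA g \<longrightarrow>
       (\<forall>sF :: 'k \<Rightarrow> 'f::ring \<Rightarrow> 'f. k_algebra sF \<longrightarrow>
         pair_lie sA g sF =
           lie_span (tensor_lie sF sA)
             (tensor_dot sF sA UNIV g \<union>
              (\<Union>k\<in>{2..}.
                 tensor_dot sF sA (I_ideal sF (k - 1)) (comm_span sA g (gpow sA g k)) \<union>
                 tensor_dot sF sA (comm_span sF UNIV (I_ideal sF (k - 2))) (Z_k sA g k)))))"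
proof -
  interpret A: k_algebra sA using assms by (simp add: compatible_pair_def)
  interpret A: char_0_unital_k_algebra sA ..
  have g: "A.lie_subalgebra g"
    using assms A.comm_spanI unfolding compatible_pair_def A.lie_subalgebra_def ad_def by blast
  \<comment> \<open>The bilinearity relations depend on \<open>sF\<close>, so a projection is chosen
    for each algebra separately.\<close>
  have cosets: "\<exists>\<pi>. tensor_cosets sF sA \<pi>" if F: "k_algebra sF" for sF :: "'k \<Rightarrow> 'f \<Rightarrow> 'f"
  proof -
    interpret F: k_algebra sF by fact
    have "free_vs.subspace (tensor_rel sF UNIV sA UNIV)" by (simp add: tensor_rel_def)
    then obtain \<pi> :: "('f \<times> 'a \<Rightarrow>\<^sub>0 'k) \<Rightarrow> ('f \<times> 'a \<Rightarrow>\<^sub>0 'k)" where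
      "\<And>p q. \<pi> (p + q) = \<pi> p + \<pi> q" "\<And>c p. \<pi> (free_scale c p) = free_scale c (\<pi> p)"
      "\<And>r. r \<in> tensor_rel sF UNIV sA UNIV \<Longrightarrow> \<pi> r = 0" "\<And>p. \<pi> p - p \<in> tensor_rel sF UNIV sA UNIV"
      using projection_along_subspace by metis
    then have "tensor_cosets sF sA \<pi>" by unfold_locales
    then show ?thesis by blast
  qed
  show ?thesis
    using tensor_cosets.pair_lie_eq_of_perfect[OF _ g] tensor_cosets.pair_lie_eq_of_semisimple[OF _ g]
      A.perfect_pair_if_perfect[OF g A.strongly_graded_imp_perfect[OF g]] cosets
    by blast
qed

end
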